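(* Let $\mu$ be a symmetric probability measure on $\mathbb{R}$ with all moments finite, whose even moments are $$m_{2n}(\mu)=\sum_{V\in\mathcal{P}_2(2n)}t(V),\qquad n\ge1,$$ where $t:\mathcal{P}_2(\infty)\to\mathbb{C}$ is normalized and strongly multiplicative. For $0\le b\le1$ put $\mu_b=D_{\sqrt b}(\mu)\boxplus D_{\sqrt{1-b}}(\gamma_0)$. Then for all $n\ge1$ and all $0\le b\le 1$, $$m_{2n}(\mu_b)=\sum_{V\in\mathcal{P}_2(2n)}b^{H(V)}\,t(V).$$ Moreover the free cumulants of $\mu$ and $\mu_b$ satisfy $$r_{2n}(\mu)=\sum_{\substack{V\in\mathcal{P}_2(2n)\\ cc(V)=1}}t(V)\qquad(n\ge1),$$ $$r_{2n}(\mu_b)=b^n\sum_{\substack{V\in\mathcal{P}_2(2n)\\ cc(V)=1}}t(V)=b^n\,r_{2n}(\mu)\qquad (n>1,\ 0\le b\le 1),$$ and $r_2(\mu_b)=r_2(\mu)$.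
   Context: $\mathcal{P}_2(2n)$ is the set of pair-partitions of $\{1,\dots,2n\}$ (partitions into $n$ blocks of size two, each block written $(i,j)$ with $i<j$), and $\mathcal{P}_2(\infty)=\bigcup_{n\ge1}\mathcal{P}_2(2n)$. A pair-partition of an arbitrary finite totally ordered set with $2n$ elements is identified with an element of $\mathcal{P}_2(2n)$ through the order-preserving bijection. Two blocks $(i_1,j_1),(i_2,j_2)$ cross if $i_1<i_2<j_1<j_2$ or $i_2<i_1<j_2<j_1$. A block of $V$ is a singleton if it crosses no other block of $V$; $h(V)$ is the number of singletons of $V$, and $H(V)=n-h(V)$ for $V\in\mathcal{P}_2(2n)$. $cc(V)$ is the number of connected components of the graph whose vertices are the blocks of $V$ and whose edges join crossing blocks. Convention: $0^0=1$. $t$ is normalized if $t(\{(1,2)\})=1$; $t$ is strongly multiplicative if $t(V_1\cup V_2)=t(V_1)t(V_2)$ whenever $V_1,V_2$ are pair-partitions of disjoint finite sets of integers such that no block of $V_1$ crosses a block of $V_2$. $m_n(\nu)=\int x^n\,d\nu(x)$. $\gamma_0$ is the Wigner semicircle law with density $\frac1{2\pi}\sqrt{4-x^2}$ on $[-2,2]$. $D_\lambda\nu(E)=\nu(\lambda^{-1}E)$ for Borel $E\subset\mathbb{R}$ and $\lambda>0$ (dilation), and $D_0\nu=\delta_0$. $\boxplus$ is free additive convolution of probability measures on $\mathbb{R}$. The free cumulants $r_n(\nu)$ of a measure with all moments are determined by $m_n(\nu)=\sum_{\pi\in NC(n)}\prod_{B\in\pi}r_{|B|}(\nu)$, with $NC(n)$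 the non-crossing partitions of $\{1,\dots,n\}$. *)

theory Defs
  imports
    "HOL-Probability.Probability"
    "HOL-Complex_Analysis.Complex_Analysis"
    "HOL-Library.Disjoint_Sets"
begin

section \<open>Partitions\<close>

text \<open>Two distinct blocks of a partition cross if they contain interlacing points. For blocks of
  size two, \<open>{i\<^sub>1, j\<^sub>1}\<close> and \<open>{i\<^sub>2, j\<^sub>2}\<close> with \<open>i\<^sub>1 < j\<^sub>1\<close>, \<open>i\<^sub>2 < j\<^sub>2\<close>, this says
  \<open>i\<^sub>1 < i\<^sub>2 < j\<^sub>1 < j\<^sub>2\<close> or \<open>i\<^sub>2 < i\<^sub>1 < j\<^sub>2 < j\<^sub>1\<close>.\<close>

definition crosses :: "'a::linorder set \<Rightarrow> 'a set \<Rightarrow> bool" where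
  "crosses B C \<longleftrightarrow>
     (\<exists>i\<^sub>1\<in>B. \<exists>j\<^sub>1\<in>B. \<exists>i\<^sub>2\<in>C. \<exists>j\<^sub>2\<in>C.
        i\<^sub>1 < i\<^sub>2 \<and> i\<^sub>2 < j\<^sub>1 \<and> j\<^sub>1 < j\<^sub>2 \<or> i\<^sub>2 < i\<^sub>1 \<and> i\<^sub>1 < j\<^sub>2 \<and> j\<^sub>2 < j\<^sub>1)"

definition pair_partitions :: "'a set \<Rightarrow> 'a set set set" where
  "pair_partitions A = {V. partition_on A V \<and> (\<forall>B\<in>V. card B = 2)}"

definition noncrossing_partitions :: "'a::linorder set \<Rightarrow> 'a set set set" where
  "noncrossing_partitions A =
     {\<pi>. partition_on A \<pi> \<and> (\<forall>B\<in>\<pi>. \<forall>C\<in>\<pi>. B \<noteq> C \<longrightarrow> \<not> crosses B C)}"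

definition singletons :: "'a::linorder set set \<Rightarrow> 'a set set" where
  "singletons V = {B \<in> V. \<forall>C\<in>V. C \<noteq> B \<longrightarrow> \<not> crosses B C}"

definition num_singletons :: "'a::linorder set set \<Rightarrow> nat" where
  "num_singletons V = card (singletons V)"

definition num_nonsingletons :: "'a::linorder set set \<Rightarrow> nat" where
  "num_nonsingletons V = card V - num_singletons V"

text \<open>The connected components are the equivalence classes of blocks under the reflexive
  transitive closure of the (symmetric) crossing relation.\<close>

definition num_components :: "'a::linorder set set \<Rightarrow> nat" where
  "num_components V = card (V // {(B, C). B \<in> V \<and> C \<in> V \<and> crosses B C}\<^sup>*)"

text \<open>The order-preserving bijection of a finite set \<open>S\<close> onto \<open>{1..card S}\<close> maps \<open>x\<close> to the
  number of elements of \<open>S\<close> that are at most \<open>x\<close>.\<close>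

definition standardize :: "'a::linorder set set \<Rightarrow> nat set set" where
  "standardize V = (\<lambda>B. (\<lambda>x. card {y \<in> \<Union>V. y \<le> x}) ` B) ` V"

text \<open>Functions on pair-partitions of \<open>{1..2*n}\<close>, \<open>n \<ge> 1\<close>, are total functions here; their values
  on other arguments are irrelevant below. In particular only nonempty partitions enter.\<close>

definition normalized :: "(nat set set \<Rightarrow> complex) \<Rightarrow> bool" where
  "normalized t \<longleftrightarrow> t {{1, 2}} = 1"

definition strongly_multiplicative :: "(nat set set \<Rightarrow> complex) \<Rightarrow> bool" where
  "strongly_multiplicative t \<longleftrightarrow>
     (\<forall>(A\<^sub>1 :: int set) A\<^sub>2 V\<^sub>1 V\<^sub>2.
        finite A\<^sub>1 \<and> finite A\<^sub>2 \<and> A\<^sub>1 \<noteq> {} \<and> A\<^sub>2 \<noteq> {} \<and> A\<^sub>1 \<inter> A\<^sub>2 = {} \<and>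
        V\<^sub>1 \<in> pair_partitions A\<^sub>1 \<and> V\<^sub>2 \<in> pair_partitions A\<^sub>2 \<and>
        (\<forall>B\<in>V\<^sub>1. \<forall>C\<in>V\<^sub>2. \<not> crosses B C) \<longrightarrow>
        t (standardize (V\<^sub>1 \<union> V\<^sub>2)) = t (standardize V\<^sub>1) * t (standardize V\<^sub>2))"

section \<open>Moments and free cumulants\<close>

definition has_all_moments :: "real measure \<Rightarrow> bool" where
  "has_all_moments \<nu> \<longleftrightarrow> (\<forall>n. integrable \<nu> (\<lambda>x. x ^ n))"

definition moment :: "real measure \<Rightarrow> nat \<Rightarrow> real" where
  "moment \<nu> n = (\<integral>x. x ^ n \<partial>\<nu>)"

text \<open>The moment-cumulant formula determines \<open>r n\<close> for \<open>n \<ge> 1\<close>, since the one-block partition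
  contributes \<open>r n\<close> and all others only involve smaller indices; the index 0 is unused.\<close>

definition free_cumulant :: "real measure \<Rightarrow> nat \<Rightarrow> real" where
  "free_cumulant \<nu> =
     (THE r. r 0 = 0 \<and>
        (\<forall>n\<ge>1. moment \<nu> n = (\<Sum>\<pi>\<in>noncrossing_partitions {1..n}. \<Prod>B\<in>\<pi>. r (card B))))"

section \<open>Measures on the real line\<close>

definition symmetric_measure :: "real measure \<Rightarrow> bool" where
  "symmetric_measure \<nu> \<longleftrightarrow> distr \<nu> borel uminus = \<nu>"

text \<open>As the push-forward under multiplication by \<open>c\<close>, this gives the Dirac measure at 0 for
  \<open>c = 0\<close> and a probability measure.\<close>

definition dilate :: "real \<Rightarrow> real measure \<Rightarrow> real measure" where
  "dilate c \<nu> = distr \<nu> borel (\<lambda>x. c * x)"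

definition semicircle :: "real measure" where
  "semicircle =
     density lborel (\<lambda>x. ennreal (indicator {-2..2} x * (1 / (2 * pi) * sqrt (4 - x\<^sup>2))))"

section \<open>Free additive convolution\<close>

text \<open>For arbitrary probability measures on the line (bounded support or not) we follow Bercovici
  and Voiculescu: \<open>\<mu> \<boxplus> \<nu>\<close> is the unique probability measure whose Voiculescu transform is the sum
  of those of \<open>\<mu>\<close> and \<open>\<nu>\<close>. The Voiculescu transform is \<open>F\<^sup>-\<^sup>1(z) - z\<close>, where
  \<open>F\<^sup>-\<^sup>1\<close> is the right inverse, on some truncated cone, of the reciprocal \<open>F\<close> of the Cauchy
  transform, normalised by \<open>F\<^sup>-\<^sup>1(z) / z \<rightarrow> 1\<close> at infinity.\<close>

definition cauchy_transform :: "real measure \<Rightarrow> complex \<Rightarrow> complex" where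
  "cauchy_transform \<nu> z = (\<integral>x. 1 / (z - complex_of_real x) \<partial>\<nu>)"

definition truncated_cone :: "real \<Rightarrow> real \<Rightarrow> complex set" where
  "truncated_cone \<alpha> \<beta> = {z. Im z > \<beta> \<and> \<bar>Re z\<bar> < \<alpha> * Im z}"

definition has_voiculescu_transform ::
    "real measure \<Rightarrow> (complex \<Rightarrow> complex) \<Rightarrow> complex set \<Rightarrow> bool" where
  "has_voiculescu_transform \<nu> \<phi> D \<longleftrightarrow>
     \<phi> holomorphic_on D \<and>
     (\<forall>z\<in>D. Im (z + \<phi> z) > 0 \<and> 1 / cauchy_transform \<nu> (z + \<phi> z) = z) \<and>
     ((\<lambda>z. (z + \<phi> z) / z) \<longlongrightarrow> 1) (inf at_infinity (principal D))"

definition is_free_convolution :: "real measure \<Rightarrow> real measure \<Rightarrow> real measure \<Rightarrow> bool" where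
  "is_free_convolution \<mu> \<nu> \<rho> \<longleftrightarrow>
     real_distribution \<rho> \<and>
     (\<exists>\<alpha>>0. \<exists>\<beta>>0. \<exists>\<phi> \<psi>.
        has_voiculescu_transform \<mu> \<phi> (truncated_cone \<alpha> \<beta>) \<and>
        has_voiculescu_transform \<nu> \<psi> (truncated_cone \<alpha> \<beta>) \<and>
        has_voiculescu_transform \<rho> (\<lambda>z. \<phi> z + \<psi> z) (truncated_cone \<alpha> \<beta>))"

definition free_convolution :: "real measure \<Rightarrow> real measure \<Rightarrow> real measure"
    (infixl "\<boxplus>" 65) where
  "\<mu> \<boxplus> \<nu> = (THE \<rho>. is_free_convolution \<mu> \<nu> \<rho>)"

definition semicircle_mix :: "real measure \<Rightarrow> real \<Rightarrow> real measure" where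
  "semicircle_mix \<mu> b = dilate (sqrt b) \<mu> \<boxplus> dilate (sqrt (1 - b)) semicircle"

end

theory Submission
  imports Defs "HOL-Real_Asymp.Real_Asymp"
begin

text \<open>The unions of the blocks of the connected components of a pair-partition form a non-crossing
  partition, and conversely connected pair-partitions of the blocks of a non-crossing partition can
  be glued. Since \<open>t\<close> and \<open>b\<^sup>H\<close> are multiplicative over the components, both moment formulas turn
  into moment-cumulant formulas, whose cumulants are sums over connected pair-partitions.

  On the analytic side, \<open>w \<mapsto> w + s G(w)\<close> with \<open>G\<close> the Cauchy transform of the first measure has a
  right inverse \<open>\<omega>\<close> on the whole upper half plane, and \<open>G \<circ> \<omega>\<close> is the Cauchy transform of the free
  convolution with the semicircle law of variance \<open>s\<close>. The measures need not have compact support, so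
  the moments are read off from the asymptotic expansion of \<open>G \<circ> \<omega>\<close> along the imaginary axis; the
  expansion is computed by formal power series and only the second cumulant changes, by \<open>s\<close>.\<close>

unbundle no vec_syntax

section \<open>Connected components of pair-partitions\<close>

text \<open>The exponent H counts the pairs outside one-pair components. On cumulants this reads:
  dilation by \<open>sqrt b\<close> multiplies the cumulant of index 2n by \<open>b ^ n\<close>, and
  the semicircle of variance 1 - b adds 1 - b to the second one alone. The second cumulant is 1
  because \<open>t\<close> is normalized, so b + (1 - b) = 1 restores it; this is the weight 1 of a
  pair that crosses nothing.

  The convolution is a definite description, so existence and uniqueness of its value must be proved
  for laws of unbounded support. Existence asks when a function on the upper half plane is a Cauchy
  transform (Nevanlinna); uniqueness rests on the injectivity of Cauchy transforms high up, which
  second moments provide.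

  Moment series may diverge, so formal power series carry the algebra and Landau estimates the
  analysis. That the perturbed law has moments is not known beforehand: existence and values come
  together from its expansion. Symmetry of \<mu> makes G imaginary on the imaginary axis, so
  \<open>w + s G(w)\<close> stays on that axis and links the sample points of both expansions. The
  weights are complex; their connected sums are real by uniqueness of cumulants.\<close>

definition crossing_rel :: "'a::linorder set set \<Rightarrow> ('a set \<times> 'a set) set" where
  "crossing_rel V = {(B, C). B \<in> V \<and> C \<in> V \<and> crosses B C}"

definition crossing_components :: "'a::linorder set set \<Rightarrow> 'a set set set" where
  "crossing_components V = V // (crossing_rel V)\<^sup>*"

definition crossing_connected :: "'a::linorder set set \<Rightarrow> bool" where
  "crossing_connected K \<longleftrightarrow> K \<noteq> {} \<and> (\<forall>B\<in>K. \<forall>C\<in>K. (B, C) \<in> (crossing_rel K)\<^sup>*)"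

lemma num_components_eq: "num_components V = card (crossing_components V)"
  by (simp add: num_components_def crossing_components_def crossing_rel_def)

lemma crosses_sym: "crosses B C \<longleftrightarrow> crosses C B"
  unfolding crosses_def by blast

lemma crosses_mono:
  assumes "crosses B C" "B \<subseteq> B'" "C \<subseteq> C'"
  shows "crosses B' C'"
proof -
  from assms(1) obtain i1 j1 i2 j2 where "i1 \<in> B" "j1 \<in> B" "i2 \<in> C" "j2 \<in> C"
    and "i1 < i2 \<and> i2 < j1 \<and> j1 < j2 \<or> i2 < i1 \<and> i1 < j2 \<and> j2 < j1"
    unfolding crosses_def by blast
  then show ?thesis using assms(2,3) unfolding crosses_def by (meson subsetD)
qed

lemma crossing_rel_mono: "K \<subseteq> V \<Longrightarrow> crossing_rel K \<subseteq> crossing_rel V"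
  by (auto simp: crossing_rel_def)

lemma sym_crossing_rel: "sym (crossing_rel V)"
  by (auto simp: crossing_rel_def sym_def crosses_sym)

lemma crossing_rel_Image_subset: "B \<in> V \<Longrightarrow> (crossing_rel V)\<^sup>* `` {B} \<subseteq> V"
  by (auto simp: crossing_rel_def elim: rtranclE)

text \<open>The reflexive transitive closure relates every set to itself, also outside
  \<open>V\<close>, so it is not an equivalence on \<open>V\<close>. Restricted to
  \<open>V \<times> V\<close> it is one, with the same classes, and the library on quotients
  applies.\<close>

lemma components_restrict: "crossing_components V = V // ((crossing_rel V)\<^sup>* \<inter> V \<times> V)"
proof -
  have "(crossing_rel V)\<^sup>* `` {B} = ((crossing_rel V)\<^sup>* \<inter> V \<times> V) `` {B}" if "B \<in> V" for B
    using crossing_rel_Image_subset[OF that] that by auto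
  then show ?thesis unfolding crossing_components_def quotient_def by auto
qed

lemma equiv_crossing_rel: "equiv V ((crossing_rel V)\<^sup>* \<inter> V \<times> V)"
proof (rule equivI)
  show "sym ((crossing_rel V)\<^sup>* \<inter> V \<times> V)"
    using sym_rtrancl[OF sym_crossing_rel[of V]] by (auto simp: sym_def)
  show "trans ((crossing_rel V)\<^sup>* \<inter> V \<times> V)"
    using trans_rtrancl[of "crossing_rel V"] unfolding trans_def by blast
qed (auto simp: refl_on_def)

lemma partition_on_components: "partition_on V (crossing_components V)"
  unfolding components_restrict by (rule partition_on_quotient[OF equiv_crossing_rel])

text \<open>A path of crossings that starts in a class never leaves it, so each of its steps is
  already a crossing inside the class.\<close>

lemma component_crossing_connected:
  assumes "K \<in> crossing_components V"
  shows "crossing_connected K"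
proof -
  from assms obtain B where B: "B \<in> V" "K = (crossing_rel V)\<^sup>* `` {B}"
    by (auto simp: crossing_components_def elim: quotientE)
  have KV: "K \<subseteq> V" using B crossing_rel_Image_subset by auto
  have path: "(B, C) \<in> (crossing_rel K)\<^sup>*" if "(B, C) \<in> (crossing_rel V)\<^sup>*" for C
    using that
  proof (induction rule: rtrancl_induct)
    case (step C D)
    have "C \<in> K" "D \<in> K" using step B by (auto intro: rtrancl_into_rtrancl)
    then have "(C, D) \<in> crossing_rel K" using step(2) by (auto simp: crossing_rel_def)
    then show ?case using step.IH by (rule rtrancl_into_rtrancl[rotated])
  qed simp
  have "sym ((crossing_rel K)\<^sup>*)" by (rule sym_rtrancl[OF sym_crossing_rel])
  then have "(C, D) \<in> (crossing_rel K)\<^sup>*" if "C \<in> K" "D \<in> K" for C D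
    using path B that by (meson Image_singleton_iff rtrancl_trans symD)
  moreover have "B \<in> K" using B by auto
  ultimately show ?thesis by (auto simp: crossing_connected_def)
qed

lemma components_not_crossing:
  assumes "K \<in> crossing_components V" "L \<in> crossing_components V" "K \<noteq> L" "B \<in> K" "C \<in> L"
  shows "\<not> crosses B C"
proof
  assume c: "crosses B C"
  have V: "B \<in> V" "C \<in> V"
    using partition_on_components[of V] assms by (auto simp: partition_on_def)
  have "(B, C) \<in> (crossing_rel V)\<^sup>* \<inter> V \<times> V"
    using c V by (auto simp: crossing_rel_def)
  then show False
    using quotient_eqI[OF equiv_crossing_rel, of K V L B C] assms
    unfolding components_restrict by auto
qed

text \<open>A path of crossings cannot leave a part, and inside a part everything is reachable; so
  the parts are the classes. This identifies the components of a glued pairing without computing a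
  closure.\<close>

lemma components_unique:
  assumes P: "partition_on V P" "\<And>K. K \<in> P \<Longrightarrow> crossing_connected K"
    and nc: "\<And>K L B C. K \<in> P \<Longrightarrow> L \<in> P \<Longrightarrow> K \<noteq> L \<Longrightarrow> B \<in> K \<Longrightarrow> C \<in> L \<Longrightarrow> \<not> crosses B C"
  shows "crossing_components V = P"
proof -
  have cls: "(crossing_rel V)\<^sup>* `` {B} = K" if K: "K \<in> P" and B: "B \<in> K" for B K
  proof
    have "C \<in> K" if "(B, C) \<in> (crossing_rel V)\<^sup>*" for C
      using that
    proof (induction rule: rtrancl_induct)
      case (step C D)
      then have "D \<in> V" and cr: "crosses C D" by (auto simp: crossing_rel_def)
      then obtain L where L: "L \<in> P" "D \<in> L" using P(1) by (auto simp: partition_on_def)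
      show ?case using nc[OF K L(1) _ step(3) L(2)] cr L by auto
    qed (use B in simp)
    then show "(crossing_rel V)\<^sup>* `` {B} \<subseteq> K" by auto
    have "K \<subseteq> V" using P(1) K by (auto simp: partition_on_def)
    then have "(crossing_rel K)\<^sup>* \<subseteq> (crossing_rel V)\<^sup>*"
      by (intro rtrancl_mono crossing_rel_mono)
    then show "K \<subseteq> (crossing_rel V)\<^sup>* `` {B}"
      using P(2)[OF K] B by (auto simp: crossing_connected_def)
  qed
  show ?thesis
  proof
    show "crossing_components V \<subseteq> P"
    proof
      fix L assume "L \<in> crossing_components V"
      then obtain B where B: "B \<in> V" "L = (crossing_rel V)\<^sup>* `` {B}"
        by (auto simp: crossing_components_def elim: quotientE)
      then obtain K where "K \<in> P" "B \<in> K" using P(1) by (auto simp: partition_on_def)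
      then show "L \<in> P" using cls B by auto
    qed
    show "P \<subseteq> crossing_components V"
    proof
      fix K assume K: "K \<in> P"
      then have "K \<noteq> {}" using P(2) by (auto simp: crossing_connected_def)
      then obtain B where B: "B \<in> K" by auto
      then have "B \<in> V" using P(1) K by (auto simp: partition_on_def)
      then show "K \<in> crossing_components V"
        using cls[OF K B] unfolding crossing_components_def by (auto intro: quotientI)
    qed
  qed
qed

lemma components_connected: "crossing_connected K \<Longrightarrow> crossing_components K = {K}"
  by (rule components_unique) (auto simp: partition_on_def crossing_connected_def disjoint_def)

lemma num_components_eq_1_iff: "num_components K = 1 \<longleftrightarrow> crossing_connected K"
proof
  assume "num_components K = 1"
  then obtain L where L: "crossing_components K = {L}"
    unfolding num_components_eq by (auto simp: card_1_singleton_iff)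
  then have "L = K" using partition_on_components[of K] by (auto simp: partition_on_def)
  then show "crossing_connected K" using component_crossing_connected L by blast
qed (simp add: num_components_eq components_connected)

text \<open>Confinement spreads along crossings: a block that crosses one inside the interval has a
  point between two points of it, hence a point in the interval, and then \<open>all\<close>
  confines the whole block.\<close>

lemma connected_interval:
  assumes L: "crossing_connected L" and B: "B \<in> L" "x \<in> B" "p < x" "x < q"
    and all: "\<And>C y. C \<in> L \<Longrightarrow> y \<in> C \<Longrightarrow> p < y \<Longrightarrow> y < q \<Longrightarrow> C \<subseteq> {p<..<q}"
  shows "\<Union>L \<subseteq> {p<..<q}"
proof -
  have "C \<subseteq> {p<..<q}" if "(B, C) \<in> (crossing_rel L)\<^sup>*" for C
    using that
  proof (induction rule: rtrancl_induct)
    case base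
    then show ?case using all B by blast
  next
    case (step C D)
    then have D: "D \<in> L" and "crosses C D" by (auto simp: crossing_rel_def)
    then obtain i j y where "i \<in> C" "j \<in> C" "y \<in> D" "i < y" "y < j"
      unfolding crosses_def by blast
    moreover from this have "p < i" "j < q" using step.IH by auto
    ultimately show ?case using all[OF D, of y] by (meson less_trans)
  qed
  then show ?thesis using L B by (auto simp: crossing_connected_def)
qed

text \<open>No block of \<open>K\<close> crosses a block C of \<open>L\<close>. By connectedness,
  \<open>K\<close> lies entirely between two points of C as soon as it has one point there
  (\<open>side\<close>). Hence no block of \<open>L\<close> separates \<open>i1\<close> from
  \<open>j1\<close>, so \<open>L\<close>, having the point \<open>i2\<close> between them, is
  confined to that interval, against the position of \<open>j2\<close>.\<close>

lemma union_connected_not_crossing_aux: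
  assumes K: "crossing_connected K" and L: "crossing_connected L"
    and nc: "\<And>B C. B \<in> K \<Longrightarrow> C \<in> L \<Longrightarrow> \<not> crosses B C"
    and disj: "\<Union>K \<inter> \<Union>L = {}" and two: "\<And>C. C \<in> L \<Longrightarrow> card C = 2"
    and ij: "i1 \<in> \<Union>K" "j1 \<in> \<Union>K" "i2 \<in> \<Union>L" "j2 \<in> \<Union>L"
  shows "\<not> (i1 < i2 \<and> i2 < j1 \<and> j1 < j2)"
proof
  assume less: "i1 < i2 \<and> i2 < j1 \<and> j1 < j2"
  have side: "\<Union>K \<subseteq> {c<..<d}" if C: "C \<in> L" "c \<in> C" "d \<in> C" and x: "x \<in> \<Union>K" "c < x" "x < d" for C c d x
  proof -
    obtain B where B: "B \<in> K" "x \<in> B" using x by auto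
    show ?thesis
    proof (rule connected_interval[OF K B x(2,3)])
      fix D y assume D: "D \<in> K" "y \<in> D" "c < y" "y < d"
      show "D \<subseteq> {c<..<d}"
      proof
        fix z assume z: "z \<in> D"
        have "z \<noteq> c" "z \<noteq> d" using disj D z C by auto
        moreover have "\<not> z < c" using nc[OF D(1) C(1)] z D C unfolding crosses_def by blast
        moreover have "\<not> d < z" using nc[OF D(1) C(1)] z D C unfolding crosses_def by blast
        ultimately show "z \<in> {c<..<d}" by auto
      qed
    qed
  qed
  obtain B where B: "B \<in> L" "i2 \<in> B" using ij by auto
  have "\<Union>L \<subseteq> {i1<..<j1}"
  proof (rule connected_interval[OF L B])
    fix C y assume C: "C \<in> L" "y \<in> C" "i1 < y" "y < j1"
    show "C \<subseteq> {i1<..<j1}"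
    proof
      fix z assume z: "z \<in> C"
      have "z \<noteq> i1" "z \<noteq> j1" using disj C z ij by auto
      moreover have "\<not> z < i1" using side[OF C(1) z C(2) ij(1)] C ij less by force
      moreover have "\<not> j1 < z" using side[OF C(1) C(2) z ij(2)] C ij less by force
      ultimately show "z \<in> {i1<..<j1}" by auto
    qed
  qed (use less in auto)
  then show False using ij less by (meson greaterThanLessThan_iff less_asym subsetD)
qed

lemma union_connected_not_crossing:
  assumes K: "crossing_connected K" and L: "crossing_connected L"
    and nc: "\<And>B C. B \<in> K \<Longrightarrow> C \<in> L \<Longrightarrow> \<not> crosses B C"
    and disj: "\<Union>K \<inter> \<Union>L = {}"
    and two: "\<And>C. C \<in> K \<Longrightarrow> card C = 2" "\<And>C. C \<in> L \<Longrightarrow> card C = 2"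
  shows "\<not> crosses (\<Union>K) (\<Union>L)"
proof
  assume "crosses (\<Union>K) (\<Union>L)"
  then obtain i1 j1 i2 j2 where m: "i1 \<in> \<Union>K" "j1 \<in> \<Union>K" "i2 \<in> \<Union>L" "j2 \<in> \<Union>L"
    and o: "i1 < i2 \<and> i2 < j1 \<and> j1 < j2 \<or> i2 < i1 \<and> i1 < j2 \<and> j2 < j1"
    unfolding crosses_def by metis
  have "\<not> (i1 < i2 \<and> i2 < j1 \<and> j1 < j2)"
    using nc two m by (intro union_connected_not_crossing_aux[OF K L _ disj]) auto
  moreover have "\<not> (i2 < i1 \<and> i1 < j2 \<and> j2 < j1)"
  proof (rule union_connected_not_crossing_aux[OF L K])
    show "\<not> crosses B C" if "B \<in> L" "C \<in> K" for B C
      using nc[OF that(2,1)] crosses_sym[of B C] by simp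
  qed (use two m disj in auto)
  ultimately show False using o by blast
qed

section \<open>Connected pairings and their gluing along a non-crossing partition\<close>

definition connected_pairings :: "'a::linorder set \<Rightarrow> 'a set set set" where
  "connected_pairings B = {K \<in> pair_partitions B. num_components K = 1}"

lemma connected_pairingsD:
  assumes "K \<in> connected_pairings B"
  shows "partition_on B K" "\<And>C. C \<in> K \<Longrightarrow> card C = 2" "crossing_connected K" "\<Union>K = B"
  using assms by (auto simp: connected_pairings_def pair_partitions_def partition_on_def
      num_components_eq_1_iff[simplified])

lemma finite_pair_partitions: "finite A \<Longrightarrow> finite (pair_partitions A)"
  unfolding pair_partitions_def
  by (rule finite_subset[OF _ finitely_many_partition_on[of A]]) auto

lemma finite_connected_pairings: "finite B \<Longrightarrow> finite (connected_pairings B)"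
  unfolding connected_pairings_def by (simp add: finite_pair_partitions)

lemma finite_noncrossing_partitions: "finite A \<Longrightarrow> finite (noncrossing_partitions A)"
  unfolding noncrossing_partitions_def
  by (rule finite_subset[OF _ finitely_many_partition_on[of A]]) auto

text \<open>A component can be read off from its union, which makes the passage from components to
  blocks of a non-crossing partition invertible.\<close>

lemma Union_component_blocks:
  assumes V: "partition_on A V" and K: "K \<in> crossing_components V"
  shows "{C \<in> V. C \<subseteq> \<Union>K} = K"
proof
  have KV: "K \<subseteq> V" using partition_on_components[of V] K by (auto simp: partition_on_def)
  show "{C \<in> V. C \<subseteq> \<Union>K} \<subseteq> K"
  proof
    fix C assume "C \<in> {C \<in> V. C \<subseteq> \<Union>K}"
    then have C: "C \<in> V" "C \<subseteq> \<Union>K" by auto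
    then have "C \<noteq> {}" using V by (auto simp: partition_on_def)
    then obtain x where x: "x \<in> C" by auto
    then obtain D where D: "D \<in> K" "x \<in> D" using C by auto
    then have "D \<in> V" using KV by auto
    then have "C = D" using V C x D unfolding partition_on_def disjoint_def by blast
    then show "C \<in> K" using D by simp
  qed
  show "K \<subseteq> {C \<in> V. C \<subseteq> \<Union>K}" using KV by auto
qed

lemma component_connected_pairings:
  assumes V: "V \<in> pair_partitions A" and K: "K \<in> crossing_components V"
  shows "K \<in> connected_pairings (\<Union>K)"
proof -
  have KV: "K \<subseteq> V" using partition_on_components[of V] K by (auto simp: partition_on_def)
  have "partition_on (\<Union>K) K" using V KV
    by (auto simp: pair_partitions_def partition_on_def disjoint_def)
  then show ?thesis using V KV component_crossing_connected[OF K]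
    by (auto simp: connected_pairings_def pair_partitions_def num_components_eq_1_iff[simplified])
qed

lemma disjoint_Union_components:
  assumes V: "partition_on A V" and K: "K \<in> crossing_components V" "L \<in> crossing_components V" "K \<noteq> L"
  shows "\<Union>K \<inter> \<Union>L = {}"
proof -
  have sub: "K \<subseteq> V" "L \<subseteq> V" "K \<inter> L = {}"
    using partition_on_components[of V] K by (auto simp: partition_on_def disjoint_def)
  show ?thesis
  proof (rule ccontr)
    assume "\<Union>K \<inter> \<Union>L \<noteq> {}"
    then obtain x B C where x: "x \<in> B" "x \<in> C" "B \<in> K" "C \<in> L" by auto
    then have "B \<in> V" "C \<in> V" using sub by auto
    then have "B = C" using V x unfolding partition_on_def disjoint_def by blast
    then show False using sub x by auto
  qed
qed

lemma Union_components_noncrossing: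
  assumes V: "V \<in> pair_partitions A"
  shows "Union ` crossing_components V \<in> noncrossing_partitions A"
proof -
  have p: "partition_on A V" using V by (simp add: pair_partitions_def)
  have pc: "partition_on V (crossing_components V)" by (rule partition_on_components)
  have "partition_on A (Union ` crossing_components V)"
  proof (rule partition_onI)
    show "\<Union> (Union ` crossing_components V) = A"
      using p pc by (auto simp: partition_on_def)
  next
    fix p q assume "p \<in> Union ` crossing_components V" "q \<in> Union ` crossing_components V" "p \<noteq> q"
    then show "disjnt p q" using disjoint_Union_components[OF p] by (auto simp: disjnt_def)
  next
    have "q \<noteq> {}" if "q \<in> Union ` crossing_components V" for q
    proof -
      from that obtain K where K: "K \<in> crossing_components V" "q = \<Union>K" by auto
      then have "K \<noteq> {}" "K \<subseteq> V" using pc by (auto simp: partition_on_def)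
      then obtain B where "B \<in> K" "B \<in> V" by auto
      moreover from this have "B \<noteq> {}" using p by (auto simp: partition_on_def)
      ultimately show "q \<noteq> {}" using K by auto
    qed
    then show "{} \<notin> Union ` crossing_components V" by blast
  qed
  moreover have "\<not> crosses B C"
    if BC: "B \<in> Union ` crossing_components V" "C \<in> Union ` crossing_components V" "B \<noteq> C" for B C
  proof -
    obtain K where K: "K \<in> crossing_components V" "B = \<Union>K" using BC(1) by auto
    obtain L where L: "L \<in> crossing_components V" "C = \<Union>L" using BC(2) by auto
    have KL: "K \<in> crossing_components V" "L \<in> crossing_components V" "B = \<Union>K" "C = \<Union>L" "K \<noteq> L"
      using BC(3) K L by auto
    show ?thesis unfolding KL
    proof (rule union_connected_not_crossing)
      show "crossing_connected K" "crossing_connected L"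
        using KL component_crossing_connected by auto
      show "\<Union>K \<inter> \<Union>L = {}" using KL disjoint_Union_components[OF p] by auto
      show "\<And>B C. B \<in> K \<Longrightarrow> C \<in> L \<Longrightarrow> \<not> crosses B C" using components_not_crossing[OF KL(1,2,5)] .
      have "K \<subseteq> V" "L \<subseteq> V" using pc KL by (auto simp: partition_on_def)
      then show "\<And>C. C \<in> K \<Longrightarrow> card C = 2" "\<And>C. C \<in> L \<Longrightarrow> card C = 2"
        using V by (auto simp: pair_partitions_def)
    qed
  qed
  ultimately show ?thesis by (auto simp: noncrossing_partitions_def)
qed

text \<open>Crossing is monotone in both sets, so pairs chosen inside different blocks of
  \<open>\<pi>\<close> cannot cross; \<open>components_unique\<close> then recognizes the chosen
  pairings as the components of their union.\<close>

lemma glue_connected_pairings: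
  assumes \<pi>: "\<pi> \<in> noncrossing_partitions A" and f: "f \<in> Pi\<^sub>E \<pi> connected_pairings"
  shows "\<Union>(f ` \<pi>) \<in> pair_partitions A" "crossing_components (\<Union>(f ` \<pi>)) = f ` \<pi>" "inj_on f \<pi>"
    "\<And>B. B \<in> \<pi> \<Longrightarrow> \<Union>(f B) = B"
proof -
  have p: "partition_on A \<pi>"
    and nc: "\<And>B C. B \<in> \<pi> \<Longrightarrow> C \<in> \<pi> \<Longrightarrow> B \<noteq> C \<Longrightarrow> \<not> crosses B C"
    using \<pi> by (auto simp: noncrossing_partitions_def)
  have fB: "f B \<in> connected_pairings B" if "B \<in> \<pi>" for B using f that by auto
  note D = connected_pairingsD[OF fB]
  show U: "\<Union>(f B) = B" if "B \<in> \<pi>" for B using D(4) that by auto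
  show inj: "inj_on f \<pi>" by (rule inj_onI) (use U in metis)
  have sub: "C \<subseteq> B" if "B \<in> \<pi>" "C \<in> f B" for B C using U that by auto
  have ne: "C \<noteq> {}" if "B \<in> \<pi>" "C \<in> f B" for B C using D(1) that by (auto simp: partition_on_def)
  have dj: "B \<inter> C = {}" if "B \<in> \<pi>" "C \<in> \<pi>" "B \<noteq> C" for B C
    using p that by (auto simp: partition_on_def disjoint_def)
  have dj2: "X \<inter> Y = {}" if "B \<in> \<pi>" "X \<in> f B" "C \<in> \<pi>" "Y \<in> f C" "X \<noteq> Y" for B C X Y
  proof (cases "B = C")
    case True
    then show ?thesis using D(1)[OF that(1)] that by (auto simp: partition_on_def disjoint_def)
  next
    case False
    then show ?thesis using dj sub that by blast
  qed
  have "\<Union>(\<Union>(f ` \<pi>)) = (\<Union>B\<in>\<pi>. \<Union>(f B))" by blast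
  also have "\<dots> = \<Union>\<pi>" using U by auto
  also have "\<dots> = A" using p by (auto simp: partition_on_def)
  finally have UA: "\<Union>(\<Union>(f ` \<pi>)) = A" .
  have "partition_on A (\<Union>(f ` \<pi>))"
  proof (rule partition_onI)
    show "\<Union>(\<Union>(f ` \<pi>)) = A" by (rule UA)
  next
    fix X Y assume "X \<in> \<Union>(f ` \<pi>)" "Y \<in> \<Union>(f ` \<pi>)" "X \<noteq> Y"
    then show "disjnt X Y" using dj2 unfolding disjnt_def by blast
  qed (use ne in blast)
  then show "\<Union>(f ` \<pi>) \<in> pair_partitions A"
    using D(2) by (auto simp: pair_partitions_def)
  show "crossing_components (\<Union>(f ` \<pi>)) = f ` \<pi>"
  proof (rule components_unique)
    show "partition_on (\<Union>(f ` \<pi>)) (f ` \<pi>)"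
    proof (rule partition_onI)
      show "{} \<notin> f ` \<pi>" using D(3) by (auto simp: crossing_connected_def)
      fix X Y assume "X \<in> f ` \<pi>" "Y \<in> f ` \<pi>" "X \<noteq> Y"
      then obtain B C where BC: "B \<in> \<pi>" "C \<in> \<pi>" "B \<noteq> C" "X = f B" "Y = f C" by auto
      show "disjnt X Y" unfolding disjnt_def
      proof (rule ccontr)
        assume "X \<inter> Y \<noteq> {}"
        then obtain Z where "Z \<in> X" "Z \<in> Y" by auto
        then have "Z \<subseteq> B \<inter> C" "Z \<noteq> {}" using BC sub ne by blast+
        then show False using dj BC by auto
      qed
    qed auto
    show "\<And>K. K \<in> f ` \<pi> \<Longrightarrow> crossing_connected K" using D(3) by auto
    fix K L X Y assume "K \<in> f ` \<pi>" "L \<in> f ` \<pi>" "K \<noteq> L" "X \<in> K" "Y \<in> L"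
    then obtain B C where BC: "B \<in> \<pi>" "C \<in> \<pi>" "B \<noteq> C" "X \<in> f B" "Y \<in> f C" by auto
    then show "\<not> crosses X Y" using nc[OF BC(1,2,3)] crosses_mono[OF _ sub[OF BC(1,4)] sub[OF BC(2,5)]] by metis
  qed
qed

text \<open>The product of sums expands into a sum over choice functions \<open>f\<close>, one
  connected pairing for each block. The pairs \<open>(\<pi>, f)\<close> correspond to
  pair-partitions by gluing, with the unions of the components as inverse.\<close>

lemma sum_pair_partitions_components:
  fixes \<tau> :: "'a::linorder set set \<Rightarrow> 'b::comm_semiring_1"
  assumes "finite A"
  shows "(\<Sum>V\<in>pair_partitions A. \<Prod>K\<in>crossing_components V. \<tau> K) =
         (\<Sum>\<pi>\<in>noncrossing_partitions A. \<Prod>B\<in>\<pi>. \<Sum>K\<in>connected_pairings B. \<tau> K)"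
proof -
  have fin: "finite \<pi>" "\<And>B. B \<in> \<pi> \<Longrightarrow> finite B" if "\<pi> \<in> noncrossing_partitions A" for \<pi>
  proof -
    have p: "partition_on A \<pi>" using that by (simp add: noncrossing_partitions_def)
    show "finite \<pi>" by (rule finite_elements[OF assms p])
    show "finite B" if "B \<in> \<pi>" for B
      using p that assms by (metis Sup_upper finite_subset partition_onD1)
  qed
  have "(\<Sum>\<pi>\<in>noncrossing_partitions A. \<Prod>B\<in>\<pi>. \<Sum>K\<in>connected_pairings B. \<tau> K) =
      (\<Sum>\<pi>\<in>noncrossing_partitions A. \<Sum>f\<in>Pi\<^sub>E \<pi> connected_pairings. \<Prod>B\<in>\<pi>. \<tau> (f B))"
    using fin by (intro sum.cong refl prod_sum_PiE) (auto intro: finite_connected_pairings)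
  also have "\<dots> = (\<Sum>(\<pi>, f)\<in>Sigma (noncrossing_partitions A) (\<lambda>\<pi>. Pi\<^sub>E \<pi> connected_pairings).
      \<Prod>B\<in>\<pi>. \<tau> (f B))"
    using assms fin by (intro sum.Sigma)
      (auto intro!: finite_noncrossing_partitions finite_PiE finite_connected_pairings)
  also have "\<dots> = (\<Sum>V\<in>pair_partitions A. \<Prod>K\<in>crossing_components V. \<tau> K)"
  proof (rule sum.reindex_bij_witness[where
        j = "\<lambda>(\<pi>, f). \<Union>(f ` \<pi>)" and
        i = "\<lambda>V. (Union ` crossing_components V, \<lambda>B\<in>Union ` crossing_components V. {C \<in> V. C \<subseteq> B})"])
    fix V assume V: "V \<in> pair_partitions A"
    have p: "partition_on A V" using V by (simp add: pair_partitions_def)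
    have "\<Union> ((\<lambda>B\<in>Union ` crossing_components V. {C \<in> V. C \<subseteq> B}) ` Union ` crossing_components V)
        = \<Union> (crossing_components V)"
      using Union_component_blocks[OF p] by auto
    also have "\<dots> = V" using partition_on_components[of V] by (auto simp: partition_on_def)
    finally show "(case (Union ` crossing_components V, \<lambda>B\<in>Union ` crossing_components V. {C \<in> V. C \<subseteq> B})
        of (\<pi>, f) \<Rightarrow> \<Union> (f ` \<pi>)) = V" by simp
    show "(Union ` crossing_components V, \<lambda>B\<in>Union ` crossing_components V. {C \<in> V. C \<subseteq> B})
        \<in> Sigma (noncrossing_partitions A) (\<lambda>\<pi>. Pi\<^sub>E \<pi> connected_pairings)"
      using Union_components_noncrossing[OF V] component_connected_pairings[OF V]
      by (auto simp: Union_component_blocks[OF p])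
  next
    fix a assume a: "a \<in> Sigma (noncrossing_partitions A) (\<lambda>\<pi>. Pi\<^sub>E \<pi> connected_pairings)"
    obtain \<pi> f where af: "a = (\<pi>, f)" "\<pi> \<in> noncrossing_partitions A" "f \<in> Pi\<^sub>E \<pi> connected_pairings"
      using a by auto
    note G = glue_connected_pairings[OF af(2,3)]
    show "(case a of (\<pi>, f) \<Rightarrow> \<Union> (f ` \<pi>)) \<in> pair_partitions A" using G af by simp
    have U: "Union ` f ` \<pi> = \<pi>" using G(4) by (simp add: image_image)
    have "{C \<in> \<Union>(f ` \<pi>). C \<subseteq> B} = f B" if "B \<in> \<pi>" for B
    proof -
      have "partition_on A (\<Union>(f ` \<pi>))" using G(1) by (simp add: pair_partitions_def)
      from Union_component_blocks[OF this, of "f B"] show ?thesis using G(2) G(4)[OF that] that by simp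
    qed
    then have "(\<lambda>B\<in>\<pi>. {C \<in> \<Union>(f ` \<pi>). C \<subseteq> B}) = f"
      using af(3) by (intro ext) (auto simp: PiE_def extensional_def)
    then show "(Union ` crossing_components (case a of (\<pi>, f) \<Rightarrow> \<Union> (f ` \<pi>)),
        \<lambda>B\<in>Union ` crossing_components (case a of (\<pi>, f) \<Rightarrow> \<Union> (f ` \<pi>)).
          {C \<in> case a of (\<pi>, f) \<Rightarrow> \<Union> (f ` \<pi>). C \<subseteq> B}) = a"
      by (simp only: af(1) prod.case G(2) U)
    show "(\<Prod>K\<in>crossing_components (case a of (\<pi>, f) \<Rightarrow> \<Union> (f ` \<pi>)). \<tau> K) = (case a of (\<pi>, f) \<Rightarrow> \<Prod>B\<in>\<pi>. \<tau> (f B))"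
      by (simp only: af(1) prod.case G(2) prod.reindex[OF G(3)] o_def)
  qed
  finally show ?thesis by simp
qed

section \<open>Strongly multiplicative weights\<close>

lemma crosses_image:
  assumes f: "strict_mono_on A f" and "B \<subseteq> A" "C \<subseteq> A"
  shows "crosses (f ` B) (f ` C) \<longleftrightarrow> crosses B C"
proof -
  have "f x < f y \<longleftrightarrow> x < y" if "x \<in> A" "y \<in> A" for x y
    using f that by (simp add: strict_mono_on_less)
  then show ?thesis
    using assms(2,3) by (simp add: crosses_def subset_eq cong: bex_cong_simp)
qed

lemma partition_on_image:
  assumes "partition_on A V" "inj_on f A"
  shows "partition_on (f ` A) ((`) f ` V)"
proof (rule partition_onI)
  show "\<Union>((`) f ` V) = f ` A" using assms(1) by (auto simp: partition_on_def)
  show "{} \<notin> (`) f ` V" using assms(1) by (auto simp: partition_on_def)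
  fix p q assume "p \<in> (`) f ` V" "q \<in> (`) f ` V" "p \<noteq> q"
  then obtain B C where BC: "B \<in> V" "C \<in> V" "p = f ` B" "q = f ` C" "B \<noteq> C" by auto
  then have "B \<inter> C = {}" "B \<subseteq> A" "C \<subseteq> A" using assms(1) by (auto simp: partition_on_def disjoint_def)
  then show "disjnt p q" using assms(2) BC inj_on_image_Int[OF assms(2), of B C]
    by (simp add: disjnt_def)
qed

lemma pair_partitions_image:
  assumes "V \<in> pair_partitions A" "inj_on f A"
  shows "(`) f ` V \<in> pair_partitions (f ` A)"
proof -
  have "card (f ` B) = card B" if "B \<in> V" for B
    using assms that by (intro card_image inj_on_subset[OF assms(2)])
      (auto simp: pair_partitions_def partition_on_def)
  then show ?thesis using assms partition_on_image by (auto simp: pair_partitions_def)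
qed

lemma crossing_connected_image:
  assumes f: "strict_mono_on A f" and K: "crossing_connected K" "K \<subseteq> Pow A"
  shows "crossing_connected ((`) f ` K)"
proof -
  have "(f ` B, f ` C) \<in> (crossing_rel ((`) f ` K))\<^sup>*" if "(B, C) \<in> (crossing_rel K)\<^sup>*" for B C
    using that
  proof (induction rule: rtrancl_induct)
    case (step C D)
    then have CD: "C \<in> K" "D \<in> K" "crosses C D" by (auto simp: crossing_rel_def)
    then have "C \<subseteq> A" "D \<subseteq> A" using K by auto
    then have "(f ` C, f ` D) \<in> crossing_rel ((`) f ` K)"
      using CD crosses_image[OF f, of C D] by (auto simp: crossing_rel_def)
    then show ?case using step.IH by (rule rtrancl_into_rtrancl[rotated])
  qed simp
  then show ?thesis using K(1) by (auto simp: crossing_connected_def)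
qed

lemma connected_pairings_image:
  assumes f: "strict_mono_on A f" and K: "K \<in> connected_pairings A"
  shows "(`) f ` K \<in> connected_pairings (f ` A)"
proof -
  note D = connected_pairingsD[OF K]
  have "inj_on f A" by (rule strict_mono_on_imp_inj_on[OF f])
  then have "(`) f ` K \<in> pair_partitions (f ` A)"
    using K by (intro pair_partitions_image) (auto simp: connected_pairings_def)
  moreover have "crossing_connected ((`) f ` K)"
    using D by (intro crossing_connected_image[OF f]) auto
  ultimately show ?thesis by (simp add: connected_pairings_def num_components_eq_1_iff[simplified])
qed

lemma strict_mono_on_inv_into:
  fixes f :: "'a::linorder \<Rightarrow> 'b::linorder"
  assumes "strict_mono_on A f"
  shows "strict_mono_on (f ` A) (inv_into A f)"
proof (rule strict_mono_onI)
  fix x y assume xy: "x \<in> f ` A" "y \<in> f ` A" "x < y"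
  have "inj_on f A" by (rule strict_mono_on_imp_inj_on[OF assms])
  then show "inv_into A f x < inv_into A f y"
    using xy strict_mono_on_less[OF assms] by (metis f_inv_into_f inv_into_into)
qed

section \<open>Standardization as the image under a strictly increasing rank map\<close>

definition rank_in :: "'a::linorder set \<Rightarrow> 'a \<Rightarrow> nat" where
  "rank_in A x = card {y \<in> A. y \<le> x}"

lemma standardize_eq_image:
  assumes "partition_on A V"
  shows "standardize V = (`) (rank_in A) ` V"
  using assms by (simp add: standardize_def rank_in_def partition_on_def)

lemma strict_mono_on_rank_in:
  assumes "finite A"
  shows "strict_mono_on A (rank_in A)"
proof (rule strict_mono_onI)
  fix x y assume "x \<in> A" "y \<in> A" "x < y"
  then have "{z \<in> A. z \<le> x} \<subseteq> {z \<in> A. z \<le> y}" "y \<in> {z \<in> A. z \<le> y}" "y \<notin> {z \<in> A. z \<le> x}"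
    by auto
  then have "{z \<in> A. z \<le> x} \<subset> {z \<in> A. z \<le> y}" by blast
  then show "rank_in A x < rank_in A y"
    unfolding rank_in_def using assms by (intro psubset_card_mono) auto
qed

lemma rank_in_image:
  assumes "finite A"
  shows "rank_in A ` A = {1..card A}"
proof (rule card_subset_eq)
  show "rank_in A ` A \<subseteq> {1..card A}"
  proof (rule image_subsetI)
    fix x assume "x \<in> A"
    then have "{y \<in> A. y \<le> x} \<noteq> {}" by auto
    then have "0 < card {y \<in> A. y \<le> x}" using assms by (simp add: card_gt_0_iff)
    moreover have "card {y \<in> A. y \<le> x} \<le> card A" using assms by (intro card_mono) auto
    ultimately show "rank_in A x \<in> {1..card A}" by (simp add: rank_in_def)
  qed
  show "card (rank_in A ` A) = card {1..card A}"
    using strict_mono_on_imp_inj_on[OF strict_mono_on_rank_in[OF assms]] by (simp add: card_image)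
qed simp

lemma image_image_inv_into:
  assumes "inj_on f A" "partition_on A V"
  shows "(`) (inv_into A f) ` (`) f ` V = V"
proof -
  have "inv_into A f ` f ` B = B" if "B \<in> V" for B
    using assms that by (intro inv_into_image_cancel) (auto simp: partition_on_def)
  then show ?thesis by (simp add: image_image)
qed

lemma image_inv_into_image:
  assumes "partition_on (f ` A) V"
  shows "(`) f ` (`) (inv_into A f) ` V = V"
proof -
  have "f ` inv_into A f ` B = B" if "B \<in> V" for B
    using assms that by (intro image_inv_into_cancel[OF refl]) (auto simp: partition_on_def)
  then show ?thesis by (simp add: image_image)
qed

text \<open>This makes the total weight of the connected pairings of a block depend on its size
  only, as the cumulant of a block must.\<close>

lemma sum_connected_pairings_standardize:
  assumes "finite A"
  shows "(\<Sum>K\<in>connected_pairings A. g (standardize K)) = sum g (connected_pairings {1..card A})"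
proof (rule sum.reindex_bij_witness[where j = standardize
      and i = "\<lambda>V. (`) (inv_into A (rank_in A)) ` V"])
  let ?r = "rank_in A"
  note sm = strict_mono_on_rank_in[OF assms] and im = rank_in_image[OF assms]
  have inj: "inj_on ?r A" by (rule strict_mono_on_imp_inj_on[OF sm])
  fix K assume K: "K \<in> connected_pairings A"
  note S = standardize_eq_image[OF connected_pairingsD(1)[OF K]]
  show "(`) (inv_into A ?r) ` standardize K = K"
    unfolding S by (rule image_image_inv_into[OF inj connected_pairingsD(1)[OF K]])
  show "standardize K \<in> connected_pairings {1..card A}"
    unfolding S using connected_pairings_image[OF sm K] im by simp
next
  let ?r = "rank_in A"
  note sm = strict_mono_on_rank_in[OF assms] and im = rank_in_image[OF assms]
  have inj: "inj_on ?r A" by (rule strict_mono_on_imp_inj_on[OF sm])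
  fix V assume V: "V \<in> connected_pairings {1..card A}"
  have "(`) (inv_into A ?r) ` V \<in> connected_pairings (inv_into A ?r ` {1..card A})"
    using V im strict_mono_on_inv_into[OF sm] by (intro connected_pairings_image) auto
  moreover have "inv_into A ?r ` {1..card A} = A"
    unfolding im[symmetric] by (rule inv_into_image_cancel[OF inj]) simp
  ultimately show W: "(`) (inv_into A ?r) ` V \<in> connected_pairings A" by simp
  show "standardize ((`) (inv_into A ?r) ` V) = V"
    unfolding standardize_eq_image[OF connected_pairingsD(1)[OF W]]
    using connected_pairingsD(1)[OF V] im by (intro image_inv_into_image) auto
qed simp

lemma standardize_image:
  assumes f: "strict_mono_on A f" and V: "partition_on A V"
  shows "standardize ((`) f ` V) = standardize V"
proof -
  have inj: "inj_on f A" by (rule strict_mono_on_imp_inj_on[OF f])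
  have r: "rank_in (f ` A) (f x) = rank_in A x" if "x \<in> A" for x
  proof -
    have "{y \<in> f ` A. y \<le> f x} = f ` {y \<in> A. y \<le> x}"
      using strict_mono_on_less_eq[OF f] that by auto
    moreover have "inj_on f {y \<in> A. y \<le> x}" by (rule inj_on_subset[OF inj]) auto
    ultimately show ?thesis by (simp add: rank_in_def card_image)
  qed
  have "rank_in (f ` A) ` f ` B = rank_in A ` B" if "B \<in> V" for B
  proof -
    have "B \<subseteq> A" using V that by (auto simp: partition_on_def)
    then show ?thesis using r unfolding image_image by (intro image_cong) auto
  qed
  then show ?thesis
    unfolding standardize_eq_image[OF V] standardize_eq_image[OF partition_on_image[OF V inj]]
    by (simp add: image_image)
qed

lemma standardize_atLeastAtMost:
  assumes V: "partition_on {1..n::nat} V"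
  shows "standardize V = V"
proof -
  have r: "rank_in {1..n} x = x" if "x \<in> {1..n}" for x
  proof -
    have "{y \<in> {1..n}. y \<le> x} = {1..x}" using that by auto
    then show ?thesis by (simp add: rank_in_def)
  qed
  have "rank_in {1..n} ` B = B" if "B \<in> V" for B
  proof -
    have "B \<subseteq> {1..n}" using V that by (auto simp: partition_on_def)
    then show ?thesis using r by (auto simp: image_def subset_eq)
  qed
  then show ?thesis unfolding standardize_eq_image[OF V] by simp
qed

text \<open>Strong multiplicativity speaks of sets of integers. The embedding \<open>int\<close> is
  strictly increasing, so it changes neither crossings nor standardizations.\<close>

lemma strongly_multiplicative_nat:
  fixes A1 A2 :: "nat set"
  assumes t: "strongly_multiplicative t"
    and A: "finite A1" "finite A2" "A1 \<noteq> {}" "A2 \<noteq> {}" "A1 \<inter> A2 = {}"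
    and V: "V1 \<in> pair_partitions A1" "V2 \<in> pair_partitions A2"
    and nc: "\<And>B C. B \<in> V1 \<Longrightarrow> C \<in> V2 \<Longrightarrow> \<not> crosses B C"
  shows "t (standardize (V1 \<union> V2)) = t (standardize V1) * t (standardize V2)"
proof -
  have sm: "strict_mono_on A int" for A by (auto intro: strict_mono_onI)
  have p: "partition_on A1 V1" "partition_on A2 V2" using V by (auto simp: pair_partitions_def)
  have p12: "partition_on (A1 \<union> A2) (V1 \<union> V2)"
    using p A(5) by (auto simp: partition_on_def intro: disjoint_union)
  have "\<not> crosses B C" if "B \<in> (`) int ` V1" "C \<in> (`) int ` V2" for B C
    using nc that crosses_image[OF sm[of UNIV]] by auto
  moreover have "(`) int ` V1 \<in> pair_partitions (int ` A1)" "(`) int ` V2 \<in> pair_partitions (int ` A2)"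
    using V by (auto intro!: pair_partitions_image)
  moreover have "int ` A1 \<inter> int ` A2 = {}" using A(5) by auto
  ultimately have "t (standardize ((`) int ` V1 \<union> (`) int ` V2))
      = t (standardize ((`) int ` V1)) * t (standardize ((`) int ` V2))"
    using A t[unfolded strongly_multiplicative_def, THEN spec[of _ "int ` A1"], THEN spec[of _ "int ` A2"],
      THEN spec[of _ "(`) int ` V1"], THEN spec[of _ "(`) int ` V2"]] by blast
  then show ?thesis
    using standardize_image[OF sm p(1)] standardize_image[OF sm p(2)] standardize_image[OF sm p12]
    by (simp add: image_Un)
qed

text \<open>One component is split off at a time. Multiplicativity is given for nonempty ground
  sets, so the induction runs over nonempty sets of components and starts from a single one.\<close>

lemma strongly_multiplicative_prod_components:
  fixes A :: "nat set"
  assumes t: "strongly_multiplicative t" and A: "finite A" "A \<noteq> {}" and V: "V \<in> pair_partitions A"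
  shows "t (standardize V) = (\<Prod>K\<in>crossing_components V. t (standardize K))"
proof -
  have p: "partition_on A V" using V by (simp add: pair_partitions_def)
  note pc = partition_on_components[of V]
  have finV: "finite V" by (rule finite_elements[OF A(1) p])
  have finC: "finite (crossing_components V)" by (rule finite_elements[OF finV pc])
  have UC: "\<Union>(crossing_components V) = V" using pc by (auto simp: partition_on_def)
  have UA: "\<Union>V = A" using p by (auto simp: partition_on_def)
  have neV: "B \<noteq> {}" if "B \<in> V" for B using p that by (auto simp: partition_on_def)
  have neC: "K \<noteq> {}" if "K \<in> crossing_components V" for K using pc that by (auto simp: partition_on_def)
  have sub: "W \<in> pair_partitions (\<Union>W)" if "W \<subseteq> V" for W
    using V that by (auto simp: pair_partitions_def partition_on_def disjoint_def)
  have main: "P \<subseteq> crossing_components V \<longrightarrow> t (standardize (\<Union>P)) = (\<Prod>K\<in>P. t (standardize K))"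
    if "finite P" "P \<noteq> {}" for P
    using that
  proof (induction P rule: finite_ne_induct)
    case (insert K P)
    show ?case
    proof
      assume KP: "insert K P \<subseteq> crossing_components V"
      have VV: "K \<subseteq> V" "\<Union>P \<subseteq> V" using KP UC by auto
      have disj: "B \<inter> C = {}" "\<not> crosses B C" if BC: "B \<in> K" "C \<in> \<Union>P" for B C
      proof -
        obtain L where L: "L \<in> P" "C \<in> L" using BC by auto
        then have KL: "K \<noteq> L" "K \<in> crossing_components V" "L \<in> crossing_components V"
          using insert KP by auto
        show "B \<inter> C = {}" using disjoint_Union_components[OF p KL(2,3,1)] that L by auto
        show "\<not> crosses B C" by (rule components_not_crossing[OF KL(2,3,1) BC(1) L(2)])
      qed
      have neU: "\<Union>L \<noteq> {}" if L: "L \<in> crossing_components V" for L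
      proof -
        obtain B where "B \<in> L" using neC[OF L] by auto
        moreover from this have "B \<in> V" using UC L by auto
        ultimately show ?thesis using neV by auto
      qed
      obtain L where L: "L \<in> P" using insert(2) by auto
      have "\<Union>L \<noteq> {}" using neU L KP by auto
      then have ne: "\<Union>K \<noteq> {}" "\<Union>(\<Union>P) \<noteq> {}"
        using neU[of K] KP L by blast+
      have fin: "finite (\<Union>K)" "finite (\<Union>(\<Union>P))"
        using Union_mono[OF VV(1)] Union_mono[OF VV(2)] unfolding UA
        by (auto intro: finite_subset[OF _ A(1)])
      have "\<Union>K \<inter> \<Union>(\<Union>P) = {}" using disj(1) by fast
      from strongly_multiplicative_nat[OF t fin ne this sub[OF VV(1)] sub[OF VV(2)] disj(2)]
      have "t (standardize (K \<union> \<Union>P)) = t (standardize K) * t (standardize (\<Union>P))" .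
      then show "t (standardize (\<Union>(insert K P))) = (\<Prod>K\<in>insert K P. t (standardize K))"
        using insert KP by simp
    qed
  qed simp
  have "crossing_components V \<noteq> {}" using UC UA A(2) by auto
  from main[OF finC this] show ?thesis unfolding UC by simp
qed

lemma card_connected_pairings:
  assumes "finite A" "K \<in> connected_pairings A"
  shows "card A = 2 * card K"
proof -
  note D = connected_pairingsD[OF assms(2)]
  have "card (\<Union>K) = (\<Sum>C\<in>K. card C)"
    using D(1) assms(1) D(4) by (intro card_Union_disjoint)
      (auto simp: partition_on_def disjoint_def pairwise_def disjnt_def intro: finite_subset)
  then show ?thesis using D by simp
qed

text \<open>The singletons are exactly the blocks that form a component alone. So H is additive over
  components: one pair counts 0, a larger component counts all its pairs.\<close>

lemma num_nonsingletons_eq_sum: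
  assumes A: "finite A" and p: "partition_on A V"
  shows "num_nonsingletons V = (\<Sum>K\<in>crossing_components V. if card K = 1 then 0 else card K)"
proof -
  note pc = partition_on_components[of V]
  have finV: "finite V" by (rule finite_elements[OF A p])
  have finC: "finite (crossing_components V)" by (rule finite_elements[OF finV pc])
  have UC: "\<Union>(crossing_components V) = V" using pc by (auto simp: partition_on_def)
  have fK: "finite K" if "K \<in> crossing_components V" for K using UC that finV by (auto intro: finite_subset)
  have cV: "card V = (\<Sum>K\<in>crossing_components V. card K)"
    using card_Union_disjoint[of "crossing_components V"] pc fK UC
    by (auto simp: partition_on_def disjoint_def pairwise_def disjnt_def)
  have "{K \<in> crossing_components V. card K = 1} = (\<lambda>B. {B}) ` singletons V"
  proof (intro equalityI subsetI)
    fix K assume "K \<in> {K \<in> crossing_components V. card K = 1}"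
    then obtain B where B: "K = {B}" "K \<in> crossing_components V" by (auto simp: card_1_singleton_iff)
    have "\<not> crosses B C" if "C \<in> V" "C \<noteq> B" for C
    proof -
      obtain L where "L \<in> crossing_components V" "C \<in> L" using UC \<open>C \<in> V\<close> by auto
      moreover have "K \<noteq> L" using B(1) \<open>C \<in> L\<close> \<open>C \<noteq> B\<close> by auto
      ultimately show ?thesis using components_not_crossing[OF B(2), of L B C] B(1) by simp
    qed
    moreover have "B \<in> V" using B UC by auto
    ultimately have "B \<in> singletons V" by (simp add: singletons_def)
    then show "K \<in> (\<lambda>B. {B}) ` singletons V" using B(1) by simp
  next
    fix K assume "K \<in> (\<lambda>B. {B}) ` singletons V"
    then obtain B where B: "K = {B}" "B \<in> V" "\<And>C. C \<in> V \<Longrightarrow> C \<noteq> B \<Longrightarrow> \<not> crosses B C"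
      by (auto simp: singletons_def)
    have "(B, C) \<in> (crossing_rel V)\<^sup>* \<Longrightarrow> C = B" for C
      by (induction rule: rtrancl_induct) (use B in \<open>auto simp: crossing_rel_def\<close>)
    then have "(crossing_rel V)\<^sup>* `` {B} = {B}" by auto
    then show "K \<in> {K \<in> crossing_components V. card K = 1}"
      using B by (auto simp: crossing_components_def quotient_def)
  qed
  then have "num_singletons V = card {K \<in> crossing_components V. card K = 1}"
    by (simp add: num_singletons_def card_image)
  also have "\<dots> = (\<Sum>K\<in>crossing_components V. if card K = 1 then 1 else 0)"
    using finC by (simp add: sum.If_cases Int_def)
  finally have s: "num_singletons V = (\<Sum>K\<in>crossing_components V. if card K = 1 then 1 else 0)" .
  have "card V = num_singletons V + (\<Sum>K\<in>crossing_components V. if card K = 1 then 0 else card K)"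
    unfolding cV s sum.distrib[symmetric] by (intro sum.cong) auto
  then show ?thesis by (simp add: num_nonsingletons_def)
qed

text \<open>The index counts points, not pairs, so that this is the candidate for the cumulant of
  the same index, the odd ones included.\<close>

definition connected_sum :: "(nat set set \<Rightarrow> complex) \<Rightarrow> nat \<Rightarrow> complex" where
  "connected_sum t n = (\<Sum>V\<in>connected_pairings {1..n}. t V)"

text \<open>Both factors of the summand are products over components. A block of size 2 carries a
  single pair and gets weight 1; a block with more pairs gets one factor \<open>b\<close> for each
  of them. The case b = 1 describes \<mu> itself.\<close>

lemma sum_pair_partitions_eq_noncrossing:
  fixes b :: complex
  assumes t: "strongly_multiplicative t" and n: "n \<ge> 1"
  shows "(\<Sum>V\<in>pair_partitions {1..n}. b ^ num_nonsingletons V * t V) =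
    (\<Sum>\<pi>\<in>noncrossing_partitions {1..n}. \<Prod>B\<in>\<pi>.
       (if card B = 2 then 1 else b ^ (card B div 2)) * connected_sum t (card B))"
proof -
  define \<tau> where "\<tau> K = (if card K = 1 then 1 else b ^ card K) * t (standardize K)" for K :: "nat set set"
  have "b ^ num_nonsingletons V * t V = (\<Prod>K\<in>crossing_components V. \<tau> K)"
    if V: "V \<in> pair_partitions {1..n}" for V
  proof -
    have p: "partition_on {1..n} V" using V by (simp add: pair_partitions_def)
    have "t V = (\<Prod>K\<in>crossing_components V. t (standardize K))"
      using strongly_multiplicative_prod_components[OF t _ _ V] n standardize_atLeastAtMost[OF p] by simp
    moreover have "b ^ num_nonsingletons V = (\<Prod>K\<in>crossing_components V. if card K = 1 then 1 else b ^ card K)"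
      unfolding num_nonsingletons_eq_sum[OF _ p, simplified] power_sum by (intro prod.cong) auto
    ultimately show ?thesis unfolding \<tau>_def by (simp add: prod.distrib)
  qed
  then have "(\<Sum>V\<in>pair_partitions {1..n}. b ^ num_nonsingletons V * t V) =
      (\<Sum>V\<in>pair_partitions {1..n}. \<Prod>K\<in>crossing_components V. \<tau> K)" by simp
  also have "\<dots> = (\<Sum>\<pi>\<in>noncrossing_partitions {1..n}. \<Prod>B\<in>\<pi>. \<Sum>K\<in>connected_pairings B. \<tau> K)"
    by (rule sum_pair_partitions_components) simp
  also have "\<dots> = (\<Sum>\<pi>\<in>noncrossing_partitions {1..n}. \<Prod>B\<in>\<pi>.
       (if card B = 2 then 1 else b ^ (card B div 2)) * connected_sum t (card B))"
  proof (intro sum.cong prod.cong refl)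
    fix \<pi> B assume "\<pi> \<in> noncrossing_partitions {1..n}" "B \<in> \<pi>"
    then have "B \<subseteq> {1..n}" by (auto simp: noncrossing_partitions_def partition_on_def)
    then have B: "finite B" by (rule finite_subset) simp
    have "(\<Sum>K\<in>connected_pairings B. \<tau> K) = (\<Sum>K\<in>connected_pairings B.
        (if card B = 2 then 1 else b ^ (card B div 2)) * t (standardize K))"
      using card_connected_pairings[OF B] unfolding \<tau>_def by (intro sum.cong) auto
    also have "\<dots> = (if card B = 2 then 1 else b ^ (card B div 2)) * connected_sum t (card B)"
      unfolding connected_sum_def sum_connected_pairings_standardize[OF B, symmetric]
      by (simp add: sum_distrib_left)
    finally show "(\<Sum>K\<in>connected_pairings B. \<tau> K) =
      (if card B = 2 then 1 else b ^ (card B div 2)) * connected_sum t (card B)" .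
  qed
  finally show ?thesis .
qed

section \<open>Sums over non-crossing partitions and their generating function\<close>

definition noncrossing_sum :: "(nat \<Rightarrow> 'b::comm_semiring_1) \<Rightarrow> 'a::linorder set \<Rightarrow> 'b" where
  "noncrossing_sum r A = (\<Sum>\<pi>\<in>noncrossing_partitions A. \<Prod>B\<in>\<pi>. r (card B))"

lemma noncrossing_partitionsD:
  assumes "\<pi> \<in> noncrossing_partitions A"
  shows "partition_on A \<pi>" "\<Union>\<pi> = A" "{} \<notin> \<pi>" "\<And>B. B \<in> \<pi> \<Longrightarrow> B \<subseteq> A"
    "\<And>B C. B \<in> \<pi> \<Longrightarrow> C \<in> \<pi> \<Longrightarrow> B \<noteq> C \<Longrightarrow> B \<inter> C = {}"
    "\<And>B C. B \<in> \<pi> \<Longrightarrow> C \<in> \<pi> \<Longrightarrow> B \<noteq> C \<Longrightarrow> \<not> crosses B C"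
proof -
  show p: "partition_on A \<pi>" using assms by (simp add: noncrossing_partitions_def)
  show "\<Union>\<pi> = A" "{} \<notin> \<pi>" using p by (auto simp: partition_on_def)
  then show "\<And>B. B \<in> \<pi> \<Longrightarrow> B \<subseteq> A" by blast
  show "\<And>B C. B \<in> \<pi> \<Longrightarrow> C \<in> \<pi> \<Longrightarrow> B \<noteq> C \<Longrightarrow> B \<inter> C = {}"
    using p unfolding partition_on_def disjoint_def by blast
  show "\<And>B C. B \<in> \<pi> \<Longrightarrow> C \<in> \<pi> \<Longrightarrow> B \<noteq> C \<Longrightarrow> \<not> crosses B C"
    using assms by (simp add: noncrossing_partitions_def)
qed

lemma noncrossing_partitionsI:
  assumes "\<Union>\<pi> = A" "{} \<notin> \<pi>"
    "\<And>B C. B \<in> \<pi> \<Longrightarrow> C \<in> \<pi> \<Longrightarrow> B \<noteq> C \<Longrightarrow> B \<inter> C = {}"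
    "\<And>B C. B \<in> \<pi> \<Longrightarrow> C \<in> \<pi> \<Longrightarrow> B \<noteq> C \<Longrightarrow> \<not> crosses B C"
  shows "\<pi> \<in> noncrossing_partitions A"
proof -
  have "partition_on A \<pi>"
    using assms(1-3) by (intro partition_onI) (auto simp only: disjnt_def)
  then show ?thesis using assms(4) by (simp add: noncrossing_partitions_def)
qed

lemma noncrossing_partitions_empty: "noncrossing_partitions ({} :: 'a::linorder set) = {{}}"
proof -
  have "\<pi> = {}" if "\<pi> \<in> noncrossing_partitions {}" for \<pi> :: "'a set set"
    using noncrossing_partitionsD(2,3)[OF that] by auto
  moreover have "{} \<in> noncrossing_partitions ({} :: 'a set)"
    by (rule noncrossing_partitionsI) auto
  ultimately show ?thesis by blast
qed

lemma noncrossing_sum_empty [simp]: "noncrossing_sum r {} = 1"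
  by (simp add: noncrossing_sum_def noncrossing_partitions_empty)

lemma noncrossing_partitions_image:
  assumes f: "strict_mono_on A f" and \<pi>: "\<pi> \<in> noncrossing_partitions A"
  shows "(`) f ` \<pi> \<in> noncrossing_partitions (f ` A)"
proof -
  note D = noncrossing_partitionsD[OF \<pi>]
  have "\<not> crosses X Y" if XY: "X \<in> (`) f ` \<pi>" "Y \<in> (`) f ` \<pi>" "X \<noteq> Y" for X Y
  proof -
    obtain B C where BC: "B \<in> \<pi>" "C \<in> \<pi>" "X = f ` B" "Y = f ` C" "B \<noteq> C" using XY by blast
    then show ?thesis using crosses_image[OF f D(4)[OF BC(1)] D(4)[OF BC(2)]] D(6) by simp
  qed
  moreover have "partition_on (f ` A) ((`) f ` \<pi>)"
    by (rule partition_on_image[OF D(1) strict_mono_on_imp_inj_on[OF f]])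
  ultimately show ?thesis by (simp add: noncrossing_partitions_def)
qed

lemma noncrossing_sum_card:
  fixes A :: "'a::linorder set"
  assumes "finite A"
  shows "noncrossing_sum r A = noncrossing_sum r {1..card A}"
  unfolding noncrossing_sum_def
proof (rule sum.reindex_bij_witness[where j = "\<lambda>\<pi>. (`) (rank_in A) ` \<pi>"
      and i = "\<lambda>V. (`) (inv_into A (rank_in A)) ` V"])
  let ?r = "rank_in A"
  note sm = strict_mono_on_rank_in[OF assms] and im = rank_in_image[OF assms]
  have inj: "inj_on ?r A" by (rule strict_mono_on_imp_inj_on[OF sm])
  fix \<pi> assume \<pi>: "\<pi> \<in> noncrossing_partitions A"
  note D = noncrossing_partitionsD[OF \<pi>]
  show "(`) (inv_into A ?r) ` (`) (rank_in A) ` \<pi> = \<pi>"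
    by (rule image_image_inv_into[OF inj D(1)])
  show "(`) (rank_in A) ` \<pi> \<in> noncrossing_partitions {1..card A}"
    using noncrossing_partitions_image[OF sm \<pi>] im by simp
  have "inj_on ((`) ?r) \<pi>"
    using inj D(4) by (intro inj_onI) (metis inj_on_image_eq_iff)
  then have "(\<Prod>B\<in>(`) ?r ` \<pi>. r (card B)) = (\<Prod>B\<in>\<pi>. r (card (?r ` B)))"
    by (simp add: prod.reindex)
  also have "\<dots> = (\<Prod>B\<in>\<pi>. r (card B))"
    using inj D(4) by (intro prod.cong refl arg_cong[of _ _ r] card_image) (meson inj_on_subset)
  finally show "(\<Prod>B\<in>(`) ?r ` \<pi>. r (card B)) = (\<Prod>B\<in>\<pi>. r (card B))" .
next
  let ?r = "rank_in A"
  note sm = strict_mono_on_rank_in[OF assms] and im = rank_in_image[OF assms]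
  have inj: "inj_on ?r A" by (rule strict_mono_on_imp_inj_on[OF sm])
  fix V assume V: "V \<in> noncrossing_partitions {1..card A}"
  have "(`) (inv_into A ?r) ` V \<in> noncrossing_partitions (inv_into A ?r ` {1..card A})"
    using V im strict_mono_on_inv_into[OF sm] by (intro noncrossing_partitions_image) auto
  moreover have "inv_into A ?r ` {1..card A} = A"
    unfolding im[symmetric] by (rule inv_into_image_cancel[OF inj]) simp
  ultimately show "(`) (inv_into A ?r) ` V \<in> noncrossing_partitions A" by simp
  show "(`) (rank_in A) ` (`) (inv_into A ?r) ` V = V"
    using noncrossing_partitionsD(1)[OF V] im by (intro image_inv_into_image) auto
qed

text \<open>The weight of the block of the last element \<open>n\<close> is shifted by \<open>k\<close>; for \<open>n = 0\<close> the
  empty block plays its role. Deleting \<open>n\<close> from its block increments \<open>k\<close> and isolates the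
  interval between \<open>n\<close> and its predecessor in the block.\<close>

definition shifted_noncrossing_sum :: "(nat \<Rightarrow> 'b::comm_semiring_1) \<Rightarrow> nat \<Rightarrow> nat \<Rightarrow> 'b" where
  "shifted_noncrossing_sum r k n = (if n = 0 then r k else
     (\<Sum>\<pi>\<in>noncrossing_partitions {1..n}. \<Prod>B\<in>\<pi>. r (card B + (if n \<in> B then k else 0))))"

section \<open>Recursion over the predecessor of the last point in its block\<close>

definition block_of :: "nat set set \<Rightarrow> nat \<Rightarrow> nat set" where
  "block_of \<pi> n = (THE B. B \<in> \<pi> \<and> n \<in> B)"

text \<open>The points are at least 1, so the inserted 0 is a sentinel: it is the value when
  \<open>n\<close> is alone in its block.\<close>

definition block_pred :: "nat set set \<Rightarrow> nat \<Rightarrow> nat" where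
  "block_pred \<pi> n = Max (insert 0 (block_of \<pi> n - {n}))"

lemma block_of_eq:
  assumes "partition_on A \<pi>" "B \<in> \<pi>" "n \<in> B"
  shows "block_of \<pi> n = B"
  unfolding block_of_def using assms by (intro the_equality) (auto simp: partition_on_def disjoint_def)

lemma block_predD:
  assumes \<pi>: "\<pi> \<in> noncrossing_partitions {1..n}" and n: "n \<ge> 1" and p: "block_pred \<pi> n = p"
  obtains B where "B \<in> \<pi>" "n \<in> B" "B \<inter> {p<..<n} = {}" "p < n" "p \<ge> 1 \<Longrightarrow> p \<in> B" "p = 0 \<Longrightarrow> B = {n}"
proof -
  note D = noncrossing_partitionsD[OF \<pi>]
  obtain B where B: "B \<in> \<pi>" "n \<in> B" using D(2) n by (metis UnionE atLeastAtMost_iff order_refl)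
  have bo: "block_of \<pi> n = B" by (rule block_of_eq[OF D(1) B])
  have sub: "B \<subseteq> {1..n}" by (rule D(4)[OF B(1)])
  have fin: "finite (insert 0 (B - {n}))" using sub finite_subset by blast
  have pm: "p = Max (insert 0 (B - {n}))" using p bo by (simp add: block_pred_def)
  have pin: "p \<in> insert 0 (B - {n})" unfolding pm using fin by (intro Max_in) auto
  have le: "x \<le> p" if "x \<in> B" "x \<noteq> n" for x unfolding pm using fin that by (intro Max_ge) auto
  show thesis
  proof (rule that[OF B])
    show "B \<inter> {p<..<n} = {}" using le by fastforce
    show "p < n" using pin sub n by force
    show "p \<in> B" if "p \<ge> 1" using pin that by auto
    show "B = {n}" if "p = 0"
    proof -
      have "x = n" if "x \<in> B" for x using le[OF that] sub that \<open>p = 0\<close> by fastforce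
      then have "B \<subseteq> {n}" by blast
      then show ?thesis using B(2) by blast
    qed
  qed
qed

lemma block_predI:
  assumes \<pi>: "\<pi> \<in> noncrossing_partitions {1..n}" and B: "B \<in> \<pi>" "n \<in> B" "B \<inter> {p<..<n} = {}"
    and p: "p < n" "p \<ge> 1 \<Longrightarrow> p \<in> B"
  shows "block_pred \<pi> n = p"
proof -
  note D = noncrossing_partitionsD[OF \<pi>]
  have bo: "block_of \<pi> n = B" by (rule block_of_eq[OF D(1) B(1,2)])
  have sub: "B \<subseteq> {1..n}" by (rule D(4)[OF B(1)])
  have fin: "finite (insert 0 (B - {n}))" using sub finite_subset by blast
  have "x \<le> p" if "x \<in> B" "x \<noteq> n" for x
  proof -
    have "x < n" using sub that by fastforce
    moreover have "x \<notin> {p<..<n}" using B(3) that by blast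
    ultimately show ?thesis by auto
  qed
  moreover have "p \<in> insert 0 (B - {n})" using p by (cases "p = 0") auto
  ultimately show ?thesis unfolding block_pred_def bo by (intro Max_eqI fin) auto
qed

text \<open>Here \<open>{n}\<close> is a block; it contributes \<open>r (1 + k)\<close> and its
  removal leaves an arbitrary non-crossing partition of the other points.\<close>

lemma noncrossing_sum_pred_zero:
  assumes n: "n \<ge> 1"
  shows "(\<Sum>\<pi> | \<pi> \<in> noncrossing_partitions {1..n} \<and> block_pred \<pi> n = 0.
      \<Prod>B\<in>\<pi>. r (card B + (if n \<in> B then k else 0))) = noncrossing_sum r {1..<n} * r (Suc k)"
    (is "?L = _")
proof -
  have "?L = (\<Sum>\<pi>\<in>noncrossing_partitions {1..<n}. (\<Prod>B\<in>\<pi>. r (card B)) * r (Suc k))"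
  proof (rule sum.reindex_bij_witness[where j = "\<lambda>\<pi>. \<pi> - {{n}}" and i = "insert {n}"])
    fix \<pi> assume "\<pi> \<in> {\<pi> \<in> noncrossing_partitions {1..n}. block_pred \<pi> n = 0}"
    then have \<pi>: "\<pi> \<in> noncrossing_partitions {1..n}" "block_pred \<pi> n = 0" by auto
    note D = noncrossing_partitionsD[OF \<pi>(1)]
    obtain B where "B \<in> \<pi>" "p = 0 \<Longrightarrow> B = {n}" for p :: nat
      using block_predD[OF \<pi>(1) n \<pi>(2)] by metis
    then have Bn: "{n} \<in> \<pi>" by auto
    then show "insert {n} (\<pi> - {{n}}) = \<pi>" by auto
    have nin: "n \<notin> C" if "C \<in> \<pi> - {{n}}" for C using D(5)[OF Bn, of C] that by auto
    show "\<pi> - {{n}} \<in> noncrossing_partitions {1..<n}"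
    proof (rule noncrossing_partitionsI)
      have "\<Union>(\<pi> - {{n}}) = \<Union>\<pi> - {n}" using nin Bn by blast
      then show "\<Union>(\<pi> - {{n}}) = {1..<n}" using D(2) by auto
    qed (use D in auto)
    have "finite \<pi>" using finite_elements[OF _ D(1)] by simp
    then have "(\<Prod>B\<in>\<pi>. r (card B + (if n \<in> B then k else 0)))
        = r (1 + k) * (\<Prod>B\<in>\<pi> - {{n}}. r (card B + (if n \<in> B then k else 0)))"
      using Bn by (subst prod.remove[of _ "{n}"]) auto
    also have "(\<Prod>B\<in>\<pi> - {{n}}. r (card B + (if n \<in> B then k else 0))) = (\<Prod>B\<in>\<pi> - {{n}}. r (card B))"
      using nin by (intro prod.cong) auto
    finally show "(\<Prod>B\<in>\<pi> - {{n}}. r (card B)) * r (Suc k)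
        = (\<Prod>B\<in>\<pi>. r (card B + (if n \<in> B then k else 0)))" by (simp add: mult.commute)
  next
    fix \<pi> assume \<pi>: "\<pi> \<in> noncrossing_partitions {1..<n}"
    note D = noncrossing_partitionsD[OF \<pi>]
    have nin: "n \<notin> C" if "C \<in> \<pi>" for C using D(4)[OF that] by auto
    then show "insert {n} \<pi> - {{n}} = \<pi>" by auto
    have "insert {n} \<pi> \<in> noncrossing_partitions {1..n}"
    proof (rule noncrossing_partitionsI)
      show "\<Union>(insert {n} \<pi>) = {1..n}" using D(2) n by auto
      show "{} \<notin> insert {n} \<pi>" using D(3) by simp
      fix B C assume BC: "B \<in> insert {n} \<pi>" "C \<in> insert {n} \<pi>" "B \<noteq> C"
      then show "B \<inter> C = {}" using D(5) nin by auto
      show "\<not> crosses B C"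
      proof (cases "B = {n} \<or> C = {n}")
        case True
        then show ?thesis unfolding crosses_def by auto
      qed (use BC D(6) in auto)
    qed
    then show "insert {n} \<pi> \<in> {\<pi> \<in> noncrossing_partitions {1..n}. block_pred \<pi> n = 0}"
      using block_predI[of "insert {n} \<pi>" n "{n}" 0] n by auto
  qed
  then show ?thesis by (simp add: noncrossing_sum_def sum_distrib_right)
qed

text \<open>A block with a point x between \<open>p\<close> and \<open>n\<close> and a point y below
  \<open>p\<close> would cross \<open>Bn\<close> through y < p < x < n. So the arc from
  \<open>p\<close> to \<open>n\<close> isolates the interval below it.\<close>

lemma noncrossing_block_pred_inside:
  assumes \<pi>: "\<pi> \<in> noncrossing_partitions {1..n}" and Bn: "Bn \<in> \<pi>" "n \<in> Bn" "p \<in> Bn" "Bn \<inter> {p<..<n} = {}"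
    and B: "B \<in> \<pi>" "x \<in> B" "p < x" "x < n"
  shows "B \<subseteq> {p<..<n}"
proof
  note D = noncrossing_partitionsD[OF \<pi>]
  fix y assume y: "y \<in> B"
  have "B \<noteq> Bn" using B Bn by auto
  then have "\<not> crosses B Bn" "B \<inter> Bn = {}" using D(5,6) B Bn by auto
  moreover have "y \<le> n" using D(4)[OF B(1)] y by auto
  moreover have "crosses B Bn" if "y < p"
    unfolding crosses_def using that B Bn y by blast
  ultimately show "y \<in> {p<..<n}" using y Bn by (cases y p rule: linorder_cases) (auto simp: order_less_le)
qed

text \<open>The blocks inside the isolated interval form one free factor. In the others,
  \<open>n\<close> is deleted, so that \<open>p\<close> becomes the last point and its block has
  lost one element; raising the shift to \<open>Suc k\<close> leaves the argument of
  \<open>r\<close> unchanged. Inserting \<open>n\<close> again into the block of \<open>p\<close> is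
  the inverse.\<close>

lemma noncrossing_sum_pred_pos:
  assumes p: "1 \<le> p" "p < n"
  shows "(\<Sum>\<pi> | \<pi> \<in> noncrossing_partitions {1..n} \<and> block_pred \<pi> n = p.
      \<Prod>B\<in>\<pi>. r (card B + (if n \<in> B then k else 0)))
    = noncrossing_sum r {p<..<n} * shifted_noncrossing_sum r (Suc k) p" (is "?L = _")
proof -
  define ins where "ins B = (if p \<in> B then insert n B else B)" for B
  define low where "low \<pi> = {B \<in> \<pi>. \<not> B \<subseteq> {p<..<n}}" for \<pi>
  define upp where "upp \<pi> = {B \<in> \<pi>. B \<subseteq> {p<..<n}}" for \<pi>
  have "?L = (\<Sum>(\<pi>1, \<pi>2)\<in>noncrossing_partitions {p<..<n} \<times> noncrossing_partitions {1..p}.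
      (\<Prod>B\<in>\<pi>1. r (card B)) * (\<Prod>B\<in>\<pi>2. r (card B + (if p \<in> B then Suc k else 0))))"
  proof (rule sum.reindex_bij_witness[where i = "\<lambda>(\<pi>1, \<pi>2). \<pi>1 \<union> ins ` \<pi>2" and
        j = "\<lambda>\<pi>. (upp \<pi>, (\<lambda>B. B - {n}) ` low \<pi>)"])
    fix \<pi> assume "\<pi> \<in> {\<pi> \<in> noncrossing_partitions {1..n}. block_pred \<pi> n = p}"
    then have \<pi>: "\<pi> \<in> noncrossing_partitions {1..n}" "block_pred \<pi> n = p" by auto
    note D = noncrossing_partitionsD[OF \<pi>(1)]
    obtain Bn where Bn: "Bn \<in> \<pi>" "n \<in> Bn" "p \<in> Bn" "Bn \<inter> {p<..<n} = {}"
      using block_predD[OF \<pi>(1) _ \<pi>(2)] p by (metis le_trans less_imp_le)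
    note inside = noncrossing_block_pred_inside[OF \<pi>(1) Bn]
    have nB: "B = Bn" if "B \<in> \<pi>" "n \<in> B \<or> p \<in> B" for B using D(5)[OF that(1) Bn(1)] that(2) Bn by auto
    have lowD: "B - {n} \<subseteq> {1..p}" if B: "B \<in> low \<pi>" for B
    proof
      fix x assume x: "x \<in> B - {n}"
      then have "x \<in> {1..n}" using D(4)[of B] B by (auto simp: low_def)
      moreover have "\<not> (p < x \<and> x < n)" using inside[of B x] B x by (auto simp: low_def)
      ultimately show "x \<in> {1..p}" using x by auto
    qed
    have split: "\<pi> = upp \<pi> \<union> low \<pi>" "upp \<pi> \<inter> low \<pi> = {}" by (auto simp: upp_def low_def)
    have ins_low: "ins (B - {n}) = B" if "B \<in> low \<pi>" for B
      using nB[of B] that Bn p by (auto simp: ins_def low_def)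
    then have "ins ` (\<lambda>B. B - {n}) ` low \<pi> = low \<pi>" by (simp add: image_image)
    then show "(case (upp \<pi>, (\<lambda>B. B - {n}) ` low \<pi>) of (\<pi>1, \<pi>2) \<Rightarrow> \<pi>1 \<union> ins ` \<pi>2) = \<pi>"
      using split by simp
    have inj: "inj_on (\<lambda>B. B - {n}) (low \<pi>)" by (rule inj_on_inverseI[of _ ins]) (rule ins_low)
    have up: "upp \<pi> \<in> noncrossing_partitions {p<..<n}"
    proof (rule noncrossing_partitionsI)
      show "\<Union>(upp \<pi>) = {p<..<n}"
      proof
        show "{p<..<n} \<subseteq> \<Union>(upp \<pi>)"
        proof
          fix x assume x: "x \<in> {p<..<n}"
          then have "x \<in> \<Union>\<pi>" using D(2) by auto
          then obtain B where "B \<in> \<pi>" "x \<in> B" by auto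
          then show "x \<in> \<Union>(upp \<pi>)" using inside[of B x] x by (auto simp: upp_def)
        qed
      qed (auto simp: upp_def)
    qed (use D in \<open>auto simp: upp_def\<close>)
    have lo: "(\<lambda>B. B - {n}) ` low \<pi> \<in> noncrossing_partitions {1..p}"
    proof (rule noncrossing_partitionsI)
      show "\<Union>((\<lambda>B. B - {n}) ` low \<pi>) = {1..p}"
      proof
        show "\<Union>((\<lambda>B. B - {n}) ` low \<pi>) \<subseteq> {1..p}" using lowD by blast
        show "{1..p} \<subseteq> \<Union>((\<lambda>B. B - {n}) ` low \<pi>)"
        proof
          fix x assume x: "x \<in> {1..p}"
          then have "x \<in> \<Union>\<pi>" using D(2) p by auto
          then obtain B where "B \<in> \<pi>" "x \<in> B" by auto
          then have "B \<in> low \<pi>" "x \<in> B - {n}" using x p by (auto simp: low_def)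
          then show "x \<in> \<Union>((\<lambda>B. B - {n}) ` low \<pi>)" by auto
        qed
      qed
      have "B - {n} \<noteq> {}" if B: "B \<in> low \<pi>" for B
      proof
        assume e: "B - {n} = {}"
        have "B \<noteq> {}" "B \<in> \<pi>" using D(3) B by (auto simp: low_def)
        then have "n \<in> B" using e by auto
        then have "B = Bn" using nB \<open>B \<in> \<pi>\<close> by auto
        then show False using e Bn p by auto
      qed
      then show "{} \<notin> (\<lambda>B. B - {n}) ` low \<pi>" by auto
      fix X Y assume "X \<in> (\<lambda>B. B - {n}) ` low \<pi>" "Y \<in> (\<lambda>B. B - {n}) ` low \<pi>" "X \<noteq> Y"
      then obtain B C where BC: "B \<in> \<pi>" "C \<in> \<pi>" "B \<noteq> C" "X = B - {n}" "Y = C - {n}"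
        by (auto simp: low_def)
      show "X \<inter> Y = {}" using D(5)[OF BC(1-3)] BC by auto
      show "\<not> crosses X Y" using D(6)[OF BC(1-3)] crosses_mono[of X Y B C] BC by auto
    qed
    show "(upp \<pi>, (\<lambda>B. B - {n}) ` low \<pi>) \<in> noncrossing_partitions {p<..<n} \<times> noncrossing_partitions {1..p}"
      using up lo by simp
    have fin: "finite \<pi>" using finite_elements[OF _ D(1)] by simp
    have "(\<Prod>B\<in>\<pi>. r (card B + (if n \<in> B then k else 0))) =
        (\<Prod>B\<in>upp \<pi>. r (card B + (if n \<in> B then k else 0))) * (\<Prod>B\<in>low \<pi>. r (card B + (if n \<in> B then k else 0)))"
      using fin split by (subst split(1), intro prod.union_disjoint) (auto simp: upp_def low_def)
    also have "(\<Prod>B\<in>upp \<pi>. r (card B + (if n \<in> B then k else 0))) = (\<Prod>B\<in>upp \<pi>. r (card B))"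
      by (intro prod.cong refl) (auto simp: upp_def)
    also have "(\<Prod>B\<in>low \<pi>. r (card B + (if n \<in> B then k else 0))) =
        (\<Prod>B\<in>low \<pi>. r (card (B - {n}) + (if p \<in> B - {n} then Suc k else 0)))"
    proof (intro prod.cong refl arg_cong[of _ _ r])
      fix B assume B: "B \<in> low \<pi>"
      then have "B \<in> \<pi>" by (simp add: low_def)
      then have "finite B" using D(4) finite_subset by blast
      show "card B + (if n \<in> B then k else 0) = card (B - {n}) + (if p \<in> B - {n} then Suc k else 0)"
      proof (cases "n \<in> B")
        case True
        then have "B = Bn" using nB \<open>B \<in> \<pi>\<close> by auto
        then have "p \<in> B - {n}" using Bn p by auto
        moreover have "card B = Suc (card (B - {n}))" by (rule card.remove[OF \<open>finite B\<close> True])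
        ultimately show ?thesis using True by simp
      next
        case False
        then have "p \<notin> B" using nB[of B] \<open>B \<in> \<pi>\<close> Bn by auto
        then show ?thesis using False by simp
      qed
    qed
    also have "\<dots> = (\<Prod>B\<in>(\<lambda>B. B - {n}) ` low \<pi>. r (card B + (if p \<in> B then Suc k else 0)))"
      by (simp add: prod.reindex[OF inj])
    finally show "(case (upp \<pi>, (\<lambda>B. B - {n}) ` low \<pi>) of (\<pi>1, \<pi>2) \<Rightarrow>
        (\<Prod>B\<in>\<pi>1. r (card B)) * (\<Prod>B\<in>\<pi>2. r (card B + (if p \<in> B then Suc k else 0))))
        = (\<Prod>B\<in>\<pi>. r (card B + (if n \<in> B then k else 0)))" by simp
  next
    fix a assume a: "a \<in> noncrossing_partitions {p<..<n} \<times> noncrossing_partitions {1..p}"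
    obtain \<pi>1 \<pi>2 where af: "a = (\<pi>1, \<pi>2)" and \<pi>1: "\<pi>1 \<in> noncrossing_partitions {p<..<n}"
      and \<pi>2: "\<pi>2 \<in> noncrossing_partitions {1..p}" using a by auto
    note D1 = noncrossing_partitionsD[OF \<pi>1] and D2 = noncrossing_partitionsD[OF \<pi>2]
    let ?\<pi> = "\<pi>1 \<union> ins ` \<pi>2"
    have n2: "n \<notin> B" if "B \<in> \<pi>2" for B using D2(4)[OF that] p by auto
    have insD: "ins B - {n} = B" if "B \<in> \<pi>2" for B using n2[OF that] by (auto simp: ins_def)
    have ins_sub: "ins B \<subseteq> {1..p} \<union> {n}" if "B \<in> \<pi>2" for B using D2(4)[OF that] by (auto simp: ins_def)
    have ne2: "B \<noteq> {}" if "B \<in> \<pi>2" for B using D2(3) that by auto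
    have ins_nsub: "\<not> ins B \<subseteq> {p<..<n}" if B: "B \<in> \<pi>2" for B
    proof -
      obtain x where "x \<in> B" using ne2[OF B] by auto
      then have "x \<in> ins B" "x \<le> p" using D2(4)[OF B] by (auto simp: ins_def)
      then show ?thesis by auto
    qed
    have uppe: "upp ?\<pi> = \<pi>1" using ins_nsub D1(4) by (auto simp: upp_def)
    have lowe: "low ?\<pi> = ins ` \<pi>2" using ins_nsub D1(4) by (auto simp: low_def)
    have "(\<lambda>B. B - {n}) ` ins ` \<pi>2 = \<pi>2" using insD by (simp add: image_image)
    then show "(\<lambda>\<pi>. (upp \<pi>, (\<lambda>B. B - {n}) ` low \<pi>)) (case a of (\<pi>1, \<pi>2) \<Rightarrow> \<pi>1 \<union> ins ` \<pi>2) = a"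
      using uppe lowe af by simp
    have far: "B \<inter> ins C = {}" "\<not> crosses B (ins C)" if BC: "B \<in> \<pi>1" "C \<in> \<pi>2" for B C
    proof -
      have B: "B \<subseteq> {p<..<n}" by (rule D1(4)[OF BC(1)])
      have C: "\<not> (p < x \<and> x < n)" if "x \<in> ins C" for x using ins_sub[OF BC(2)] that by auto
      show "B \<inter> ins C = {}" using B C by fastforce
      show "\<not> crosses B (ins C)"
      proof
        assume "crosses B (ins C)"
        then obtain i1 j1 x where "i1 \<in> B" "j1 \<in> B" "x \<in> ins C" "i1 < x" "x < j1"
          unfolding crosses_def by blast
        then show False using B C[of x] by fastforce
      qed
    qed
    \<comment> \<open>\<open>C\<close> lies below \<open>p\<close>. A crossing that uses the new
      point \<open>n\<close> uses it as the last of the four points, and there \<open>p\<close> can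
      take its place, which gives a crossing in \<open>\<pi>2\<close>.\<close>
    have ins_nc: "\<not> crosses (ins B) (ins C)" if BC: "B \<in> \<pi>2" "C \<in> \<pi>2" "B \<noteq> C" "p \<in> B" for B C
    proof
      have pC: "p \<notin> C" using D2(5)[OF BC(1-3)] BC(4) by auto
      then have iC: "ins C = C" by (simp add: ins_def)
      have Cp: "x < p" if "x \<in> C" for x using D2(4)[OF BC(2)] that pC
        by (metis atLeastAtMost_iff order_le_less subsetD)
      have iB: "ins B = insert n B" using BC(4) by (simp add: ins_def)
      assume "crosses (ins B) (ins C)"
      then obtain i1 j1 i2 j2 where c: "i1 \<in> insert n B" "j1 \<in> insert n B" "i2 \<in> C" "j2 \<in> C"
        and o: "i1 < i2 \<and> i2 < j1 \<and> j1 < j2 \<or> i2 < i1 \<and> i1 < j2 \<and> j2 < j1"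
        unfolding crosses_def iB iC by blast
      have "i2 < p" "j2 < p" using Cp c by auto
      moreover from this have "i1 < p" using o by linarith
      ultimately have i1: "i1 \<in> B" using c p by auto
      have "crosses B C"
        using o
      proof
        assume o1: "i1 < i2 \<and> i2 < j1 \<and> j1 < j2"
        then have "j1 \<in> B" using c \<open>j2 < p\<close> p by auto
        then show ?thesis using o1 i1 c unfolding crosses_def by blast
      next
        assume o2: "i2 < i1 \<and> i1 < j2 \<and> j2 < j1"
        then show ?thesis using i1 c BC(4) \<open>j2 < p\<close> unfolding crosses_def by blast
      qed
      then show False using D2(6)[OF BC(1-3)] by simp
    qed
    have P: "?\<pi> \<in> noncrossing_partitions {1..n}"
    proof (rule noncrossing_partitionsI)
      have "p \<in> \<Union>\<pi>2" using D2(2) p by auto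
      then have "\<Union>(ins ` \<pi>2) = insert n (\<Union>\<pi>2)" by (auto simp: ins_def split: if_splits)
      then have "\<Union>?\<pi> = {p<..<n} \<union> insert n {1..p}" using D1(2) D2(2) by auto
      then show "\<Union>?\<pi> = {1..n}" using p by auto
      have "ins B \<noteq> {}" if "B \<in> \<pi>2" for B using ne2[OF that] by (auto simp: ins_def)
      then show "{} \<notin> ?\<pi>" using D1(3) by auto
      fix X Y assume XY: "X \<in> ?\<pi>" "Y \<in> ?\<pi>" "X \<noteq> Y"
      then consider "X \<in> \<pi>1" "Y \<in> \<pi>1" | C where "X \<in> \<pi>1" "C \<in> \<pi>2" "Y = ins C"
        | B where "Y \<in> \<pi>1" "B \<in> \<pi>2" "X = ins B"
        | B C where "B \<in> \<pi>2" "C \<in> \<pi>2" "X = ins B" "Y = ins C" "B \<noteq> C" by auto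
      then have "X \<inter> Y = {} \<and> \<not> crosses X Y"
      proof cases
        case 1
        then show ?thesis using D1(5,6) XY(3) by auto
      next
        case 2
        then show ?thesis using far by auto
      next
        case 3
        then show ?thesis using far[of Y B] crosses_sym[of Y X] by auto
      next
        case 4
        have d: "B \<inter> C = {}" "n \<notin> B" "n \<notin> C" using D2(5) n2 4 by auto
        then have "X \<inter> Y = {}" unfolding 4 by (auto simp: ins_def)
        moreover have "\<not> crosses X Y"
        proof (cases "p \<in> B \<or> p \<in> C")
          case True
          then show ?thesis using ins_nc[of B C] ins_nc[of C B] 4 crosses_sym[of X Y] by auto
        next
          case False
          then show ?thesis using D2(6) 4 by (simp add: ins_def)
        qed
        ultimately show ?thesis by simp
      qed
      then show "X \<inter> Y = {}" "\<not> crosses X Y" by auto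
    qed
    have "p \<in> \<Union>\<pi>2" using D2(2) p by auto
    then obtain B where B: "B \<in> \<pi>2" "p \<in> B" by auto
    then have "ins B \<in> ?\<pi>" "n \<in> ins B" "p \<in> ins B" by (auto simp: ins_def)
    moreover have "ins B \<inter> {p<..<n} = {}" using ins_sub[OF B(1)] by fastforce
    ultimately have "block_pred ?\<pi> n = p" using p by (intro block_predI[OF P, of "ins B"]) auto
    then show "(case a of (\<pi>1, \<pi>2) \<Rightarrow> \<pi>1 \<union> ins ` \<pi>2) \<in> {\<pi> \<in> noncrossing_partitions {1..n}. block_pred \<pi> n = p}"
      using P af by simp
  qed
  then show ?thesis using p
    by (simp add: noncrossing_sum_def shifted_noncrossing_sum_def sum_product sum.cartesian_product)
qed

text \<open>The partitions are grouped by the predecessor p of \<open>n\<close>. The convention at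
  argument 0 of \<open>shifted_noncrossing_sum\<close> lets the case p = 0 join the sum.\<close>

lemma shifted_noncrossing_sum_rec:
  assumes n: "n \<ge> 1"
  shows "shifted_noncrossing_sum r k n =
    (\<Sum>p<n. noncrossing_sum r {1..n - 1 - p} * shifted_noncrossing_sum r (Suc k) p)"
proof -
  let ?g = "\<lambda>\<pi>. \<Prod>B\<in>\<pi>. r (card B + (if n \<in> B then k else 0))"
  have "shifted_noncrossing_sum r k n = sum ?g (noncrossing_partitions {1..n})"
    using n by (simp add: shifted_noncrossing_sum_def)
  also have "\<dots> = (\<Sum>p<n. \<Sum>\<pi> | \<pi> \<in> noncrossing_partitions {1..n} \<and> block_pred \<pi> n = p. ?g \<pi>)"
  proof (rule sum.group[symmetric])
    show "(\<lambda>\<pi>. block_pred \<pi> n) ` noncrossing_partitions {1..n} \<subseteq> {..<n}"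
      using block_predD[OF _ n refl] by auto
  qed (simp_all add: finite_noncrossing_partitions)
  also have "\<dots> = (\<Sum>p<n. noncrossing_sum r {1..n - 1 - p} * shifted_noncrossing_sum r (Suc k) p)"
  proof (intro sum.cong refl)
    fix p assume "p \<in> {..<n}"
    then have p: "p < n" by simp
    have c: "noncrossing_sum r {p<..<n} = noncrossing_sum r {1..n - 1 - p}"
      using noncrossing_sum_card[of "{p<..<n}" r] p by simp
    show "(\<Sum>\<pi> | \<pi> \<in> noncrossing_partitions {1..n} \<and> block_pred \<pi> n = p. ?g \<pi>)
      = noncrossing_sum r {1..n - 1 - p} * shifted_noncrossing_sum r (Suc k) p"
    proof (cases "p = 0")
      case True
      have "{1..<n} = {1..n - 1 - p}" using True n by auto
      then show ?thesis using noncrossing_sum_pred_zero[OF n, of r k] True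
        by (simp add: shifted_noncrossing_sum_def)
    next
      case False
      then show ?thesis using noncrossing_sum_pred_pos[of p n r k] p c by simp
    qed
  qed
  finally show ?thesis .
qed

section \<open>Generating series of moments and cumulants\<close>

definition cumulant_fps :: "(nat \<Rightarrow> 'b::comm_ring_1) \<Rightarrow> 'b fps" where
  "cumulant_fps r = Abs_fps (\<lambda>n. if n = 0 then 1 else r n)"

definition noncrossing_fps :: "(nat \<Rightarrow> 'b::comm_ring_1) \<Rightarrow> 'b fps" where
  "noncrossing_fps r = Abs_fps (\<lambda>n. noncrossing_sum r {1..n})"

lemma noncrossing_sum_cong:
  assumes "\<And>n. n \<ge> 1 \<Longrightarrow> r n = r' n" "finite A"
  shows "noncrossing_sum r A = noncrossing_sum r' A"
  unfolding noncrossing_sum_def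
proof (intro sum.cong prod.cong refl assms(1))
  fix \<pi> B assume \<pi>: "\<pi> \<in> noncrossing_partitions A" and B: "B \<in> \<pi>"
  note D = noncrossing_partitionsD[OF \<pi>]
  have "finite B" using D(4)[OF B] assms(2) finite_subset by blast
  moreover have "B \<noteq> {}" using D(3) B by auto
  ultimately show "1 \<le> card B" by (simp add: Suc_le_eq card_gt_0_iff)
qed

text \<open>The functional equation M(z) = C(z M(z)) of free probability, where C(z) = 1 + z R(z)
  and R is the R-transform. The recursion says that the series \<open>U k\<close> of shifted sums
  satisfy \<open>U k = r' k + z M U (k + 1)\<close>; iterated from \<open>U 0 = M\<close>, this
  produces the powers of z M one by one.\<close>

lemma noncrossing_fps_eq_compose:
  "noncrossing_fps r = cumulant_fps r oo (fps_X * noncrossing_fps r)"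
proof -
  \<comment> \<open>The value 1 at index 0 makes the shifted sum with \<open>k = 0\<close> agree
    with the sum over the empty partition at \<open>n = 0\<close>.\<close>
  define r' where "r' n = (if n = 0 then 1 else r n)" for n
  define M where "M = noncrossing_fps r"
  have rr: "noncrossing_sum r' {1..n} = noncrossing_sum r {1..n}" for n :: nat
    by (rule noncrossing_sum_cong) (auto simp: r'_def)
  define U where "U k = Abs_fps (shifted_noncrossing_sum r' k)" for k
  have U: "U k = fps_const (r' k) + fps_X * M * U (Suc k)" for k
  proof (rule fps_ext)
    fix n show "U k $ n = (fps_const (r' k) + fps_X * M * U (Suc k)) $ n"
    proof (cases n)
      case 0
      then show ?thesis by (simp add: U_def shifted_noncrossing_sum_def mult.assoc)
    next
      case (Suc m)
      have "U k $ n = (\<Sum>p<n. noncrossing_sum r' {1..n - 1 - p} * shifted_noncrossing_sum r' (Suc k) p)"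
        unfolding U_def fps_nth_Abs_fps using Suc by (intro shifted_noncrossing_sum_rec) simp
      also have "\<dots> = (\<Sum>p=0..m. M $ (m - p) * U (Suc k) $ p)"
        unfolding Suc using rr by (intro sum.cong) (auto simp: M_def noncrossing_fps_def U_def)
      also have "\<dots> = (U (Suc k) * M) $ m" unfolding fps_mult_nth by (simp add: mult.commute)
      also have "\<dots> = (fps_const (r' k) + fps_X * M * U (Suc k)) $ n"
        using Suc by (simp add: mult.assoc mult.commute)
      finally show ?thesis .
    qed
  qed
  have U0: "U 0 = M"
  proof (rule fps_ext)
    fix n show "U 0 $ n = M $ n"
      by (cases "n = 0") (simp_all add: U_def M_def noncrossing_fps_def shifted_noncrossing_sum_def
        noncrossing_sum_def[of r', symmetric] rr[simplified], simp add: r'_def)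
  qed
  \<comment> \<open>The remainder is divisible by \<open>fps_X ^ N\<close>, so with N = n + 1 it
    does not touch the coefficient n.\<close>
  have exp: "M = (\<Sum>k<N. fps_const (r' k) * (fps_X * M) ^ k) + (fps_X * M) ^ N * U N" for N
  proof (induction N)
    case (Suc N)
    have "(fps_X * M) ^ N * U N = fps_const (r' N) * (fps_X * M) ^ N + (fps_X * M) ^ Suc N * U (Suc N)"
      by (subst U[of N]) (simp add: algebra_simps)
    then show ?case using Suc by (simp add: add.assoc)
  qed (simp add: U0)
  show ?thesis unfolding M_def[symmetric]
  proof (rule fps_ext)
    fix n
    have "((fps_X * M) ^ Suc n * U (Suc n)) $ n = 0"
      by (simp add: power_mult_distrib mult.assoc fps_X_power_mult_nth del: power_Suc)
    then have "M $ n = (\<Sum>k<Suc n. fps_const (r' k) * (fps_X * M) ^ k) $ n"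
      using arg_cong[OF exp[of "Suc n"], of "\<lambda>f. f $ n"] by simp
    also have "\<dots> = (\<Sum>k=0..n. r' k * ((fps_X * M) ^ k) $ n)"
      by (simp add: fps_sum_nth lessThan_Suc_atMost atMost_atLeast0 del: sum.lessThan_Suc)
    also have "\<dots> = (cumulant_fps r oo (fps_X * M)) $ n"
      by (simp add: fps_compose_nth cumulant_fps_def r'_def)
    finally show "M $ n = (cumulant_fps r oo (fps_X * M)) $ n" .
  qed
qed

text \<open>Every block of a partition other than the one-block one is a proper subset, so the
  system is triangular. The complex instance also serves to show that cumulants of real moments are
  real.\<close>

lemma noncrossing_cumulants_unique:
  fixes r r' :: "nat \<Rightarrow> 'b::comm_ring_1"
  assumes eq: "\<And>n::nat. n \<ge> 1 \<Longrightarrow> noncrossing_sum r {1..n} = noncrossing_sum r' {1..n}" and "n \<ge> 1"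
  shows "r n = r' n"
  using assms(2)
proof (induction n rule: less_induct)
  case (less n)
  have fin: "finite (noncrossing_partitions {1..n})" by (simp add: finite_noncrossing_partitions)
  have one: "{{1..n}} \<in> noncrossing_partitions {1..n}"
    using less(2) by (intro noncrossing_partitionsI) auto
  have split: "noncrossing_sum s {1..n} = s n +
      (\<Sum>\<pi>\<in>noncrossing_partitions {1..n} - {{{1..n}}}. \<Prod>B\<in>\<pi>. s (card B))" for s :: "nat \<Rightarrow> 'b"
    unfolding noncrossing_sum_def by (subst sum.remove[OF fin one]) simp
  have "(\<Sum>\<pi>\<in>noncrossing_partitions {1..n} - {{{1..n}}}. \<Prod>B\<in>\<pi>. r (card B)) =
    (\<Sum>\<pi>\<in>noncrossing_partitions {1..n} - {{{1..n}}}. \<Prod>B\<in>\<pi>. r' (card B))"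
  proof (intro sum.cong prod.cong refl)
    fix \<pi> B assume \<pi>: "\<pi> \<in> noncrossing_partitions {1..n} - {{{1..n}}}" and B: "B \<in> \<pi>"
    then have NC: "\<pi> \<in> noncrossing_partitions {1..n}" "\<pi> \<noteq> {{1..n}}" by auto
    note D = noncrossing_partitionsD[OF NC(1)]
    have "B \<noteq> {1..n}"
    proof
      assume Bn: "B = {1..n}"
      have "C = B" if C: "C \<in> \<pi>" for C
      proof (rule ccontr)
        assume "C \<noteq> B"
        then have "C \<inter> B = {}" using D(5)[OF C B] by simp
        then have "C = {}" using D(4)[OF C] Bn by auto
        then show False using C D(3) by auto
      qed
      then have "\<pi> = {B}" using B by blast
      then show False using NC(2) Bn by simp
    qed
    then have "B \<subset> {1..n}" using D(4)[OF B] by auto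
    then have "card B < card {1..n}" by (intro psubset_card_mono) auto
    moreover have "finite B" using D(4)[OF B] finite_subset by blast
    moreover have "B \<noteq> {}" using D(3) B by auto
    ultimately show "r (card B) = r' (card B)"
      using less(1)[of "card B"] by (simp add: Suc_le_eq card_gt_0_iff)
  qed
  then show ?case using split[of r] split[of r'] eq[OF less(2)] by simp
qed

section \<open>The Cauchy transform determines the measure\<close>

lemma poisson_kernel_integral:
  fixes y x :: real
  assumes y: "y > 0"
  shows "integrable lborel (\<lambda>u. y / ((u - x)\<^sup>2 + y\<^sup>2))"
    and "(\<integral>u. y / ((u - x)\<^sup>2 + y\<^sup>2) \<partial>lborel) = pi"
proof -
  let ?f = "\<lambda>u::real. inverse (1 + u\<^sup>2)"
  have i: "integrable lborel ?f"
    using integrable_inverse_1_plus_square by (simp add: set_integrable_def)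
  have v: "(\<integral>u. ?f u \<partial>lborel) = pi"
    using LBINT_inverse_1_plus_square
    by (simp add: interval_lebesgue_integral_def set_lebesgue_integral_def)
  have e: "?f (- x / y + (1 / y) * u) = y * (y / ((u - x)\<^sup>2 + y\<^sup>2))" for u
  proof -
    have "1 + (- x / y + (1 / y) * u)\<^sup>2 = ((u - x)\<^sup>2 + y\<^sup>2) / y\<^sup>2"
      using y by (simp add: field_simps power2_eq_square)
    then show ?thesis by (simp add: inverse_eq_divide power2_eq_square)
  qed
  have "integrable lborel (\<lambda>u. ?f (- x / y + (1 / y) * u))"
    using y by (intro lborel_integrable_real_affine i) auto
  then have "integrable lborel (\<lambda>u. (1 / y) * (y * (y / ((u - x)\<^sup>2 + y\<^sup>2))))"
    unfolding e by (rule integrable_mult_right)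
  then show "integrable lborel (\<lambda>u. y / ((u - x)\<^sup>2 + y\<^sup>2))" using y by simp
  have "pi = \<bar>1 / y\<bar> *\<^sub>R (\<integral>u. ?f (- x / y + (1 / y) * u) \<partial>lborel)"
    unfolding v[symmetric] using y by (intro lborel_integral_real_affine) auto
  also have "\<dots> = \<bar>1 / y\<bar> * (y * (\<integral>u. y / ((u - x)\<^sup>2 + y\<^sup>2) \<partial>lborel))"
    by (simp only: e integral_mult_right_zero real_scaleR_def)
  also have "\<dots> = (\<integral>u. y / ((u - x)\<^sup>2 + y\<^sup>2) \<partial>lborel)"
    using y by simp
  finally show "(\<integral>u. y / ((u - x)\<^sup>2 + y\<^sup>2) \<partial>lborel) = pi" ..
qed

section \<open>Poisson smoothing and inversion of the Cauchy transform\<close>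

lemma Im_cauchy_kernel:
  "Im (1 / (z - complex_of_real x)) = - (Im z / ((Re z - x)\<^sup>2 + (Im z)\<^sup>2))"
  by (simp add: Im_divide)

lemma norm_cauchy_kernel_le:
  assumes "Im z > 0"
  shows "norm (1 / (z - complex_of_real x)) \<le> 1 / Im z"
proof -
  have "Im z \<le> norm (z - complex_of_real x)" using abs_Im_le_cmod[of "z - complex_of_real x"] by simp
  then show ?thesis using assms by (simp add: norm_divide frac_le)
qed

lemma cauchy_kernel_nonzero: "Im z > 0 \<Longrightarrow> z - complex_of_real x \<noteq> 0"
  by (auto simp: complex_eq_iff)

lemma isCont_cauchy_kernel: "Im z > 0 \<Longrightarrow> isCont (\<lambda>x. 1 / (z - complex_of_real x)) x"
  using cauchy_kernel_nonzero[of z x] by (intro continuous_intros) auto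

context real_distribution
begin

lemma borel_measurable_continuous: "(\<And>x. isCont f x) \<Longrightarrow> f \<in> borel_measurable M"
  for f :: "real \<Rightarrow> 'b::real_normed_vector"
  by (simp add: measurable_cong_sets[OF events_eq_borel refl] borel_measurable_continuous_onI
      continuous_at_imp_continuous_on)

lemma integrable_cauchy_kernel:
  assumes "Im z > 0"
  shows "integrable M (\<lambda>x. 1 / (z - complex_of_real x))"
  using norm_cauchy_kernel_le[OF assms] isCont_cauchy_kernel[OF assms]
  by (intro integrable_const_bound[where B = "1 / Im z"] borel_measurable_continuous) auto

lemma norm_cauchy_transform_le:
  assumes "Im z > 0"
  shows "norm (cauchy_transform M z) \<le> 1 / Im z"
proof -
  have "norm (cauchy_transform M z) \<le> (\<integral>x. norm (1 / (z - complex_of_real x)) \<partial>M)"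
    unfolding cauchy_transform_def by (rule integral_norm_bound)
  also have "\<dots> \<le> (\<integral>x. 1 / Im z \<partial>M)"
    using norm_cauchy_kernel_le[OF assms] integrable_cauchy_kernel[OF assms]
    by (intro integral_mono integrable_norm) auto
  finally show ?thesis using prob_space by simp
qed

lemma Im_cauchy_transform:
  assumes "Im z > 0"
  shows "Im (cauchy_transform M z) = - (\<integral>x. Im z / ((Re z - x)\<^sup>2 + (Im z)\<^sup>2) \<partial>M)"
    and "integrable M (\<lambda>x. Im z / ((Re z - x)\<^sup>2 + (Im z)\<^sup>2))"
proof -
  have i: "integrable M (\<lambda>x. Im (1 / (z - complex_of_real x)))"
    by (rule integrable_Im[OF integrable_cauchy_kernel[OF assms]])
  then show "integrable M (\<lambda>x. Im z / ((Re z - x)\<^sup>2 + (Im z)\<^sup>2))"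
    unfolding Im_cauchy_kernel by simp
  have "Im (cauchy_transform M z) = (\<integral>x. Im (1 / (z - complex_of_real x)) \<partial>M)"
    unfolding cauchy_transform_def by (rule integral_Im[symmetric, OF integrable_cauchy_kernel[OF assms]])
  then show "Im (cauchy_transform M z) = - (\<integral>x. Im z / ((Re z - x)\<^sup>2 + (Im z)\<^sup>2) \<partial>M)"
    unfolding Im_cauchy_kernel by simp
qed

text \<open>On the line of height \<open>e\<close>, the function \<open>- Im G / pi\<close> is the
  density of the convolution of the measure with the Cauchy law of scale \<open>e\<close>. Its
  Fourier transform therefore factors, by Fubini and a translation.\<close>

lemma char_poisson:
  assumes e: "e > 0"
  shows "(\<integral>u. iexp (t * u) * complex_of_real (- Im (cauchy_transform M (Complex u e)) / pi) \<partial>lborel)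
    = char M t * (\<integral>v. iexp (t * v) * complex_of_real (e / (v\<^sup>2 + e\<^sup>2) / pi) \<partial>lborel)"
proof -
  interpret pair_sigma_finite M lborel
    by (rule pair_sigma_finite.intro) (auto intro: prob_space_imp_sigma_finite prob_space_axioms sigma_finite_lborel)
  define F where "F = (\<lambda>x u. iexp (t * u) * complex_of_real (e / ((u - x)\<^sup>2 + e\<^sup>2) / pi))"
  have nF: "norm (F x u) = e / ((u - x)\<^sup>2 + e\<^sup>2) / pi" for x u
    unfolding F_def norm_mult norm_of_real using e by simp
  have [measurable]: "case_prod F \<in> borel_measurable (M \<Otimes>\<^sub>M lborel)"
    unfolding F_def split_beta' by measurable
  have "integrable (M \<Otimes>\<^sub>M lborel) (case_prod F)"
  proof (rule Fubini_integrable)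
    have "(\<integral>u. norm (case_prod F (x, u)) \<partial>lborel) = 1" for x
      by (simp only: prod.case nF integral_divide_zero poisson_kernel_integral(2)[OF e]) simp
    then show "integrable M (\<lambda>x. \<integral>u. norm (case_prod F (x, u)) \<partial>lborel)" by simp
    show "AE x in M. integrable lborel (\<lambda>u. case_prod F (x, u))"
    proof (rule AE_I2)
      fix x
      have "integrable lborel (\<lambda>u. norm (F x u))"
        unfolding nF by (intro integrable_divide_zero poisson_kernel_integral(1)[OF e])
      moreover have "F x \<in> borel_measurable lborel" unfolding F_def by measurable
      ultimately show "integrable lborel (\<lambda>u. case_prod F (x, u))"
        by (simp add: integrable_norm_iff)
    qed
  qed simp
  from Fubini_integral[OF this]
  have "(\<integral>u. (\<integral>x. F x u \<partial>M) \<partial>lborel) = (\<integral>x. (\<integral>u. F x u \<partial>lborel) \<partial>M)" .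
  moreover have "(\<integral>x. F x u \<partial>M) = iexp (t * u) * complex_of_real (- Im (cauchy_transform M (Complex u e)) / pi)" for u
  proof -
    have "(\<integral>x. F x u \<partial>M) = iexp (t * u) * complex_of_real ((\<integral>x. e / ((u - x)\<^sup>2 + e\<^sup>2) \<partial>M) / pi)"
      unfolding F_def by (simp only: integral_mult_right_zero integral_complex_of_real integral_divide_zero)
    then show ?thesis using Im_cauchy_transform(1)[of "Complex u e"] e by simp
  qed
  moreover have "(\<integral>u. F x u \<partial>lborel)
      = iexp (t * x) * (\<integral>v. iexp (t * v) * complex_of_real (e / (v\<^sup>2 + e\<^sup>2) / pi) \<partial>lborel)" for x
  proof -
    have "(\<integral>u. F x u \<partial>lborel) = (\<integral>v. F x (x + 1 * v) \<partial>lborel)"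
      using lborel_integral_real_affine[of 1 "F x" x] by simp
    also have "\<dots> = (\<integral>v. iexp (t * x) * (iexp (t * v) * complex_of_real (e / (v\<^sup>2 + e\<^sup>2) / pi)) \<partial>lborel)"
      by (intro Bochner_Integration.integral_cong refl) (simp add: F_def exp_add[symmetric] ring_distribs mult.assoc[symmetric])
    finally show ?thesis by (simp only: integral_mult_right_zero)
  qed
  ultimately show ?thesis by (simp only: char_def integral_mult_left_zero)
qed

end

text \<open>Rescaling the variable moves the scale out of the density into the oscillating factor,
  where dominated convergence with the standard Cauchy density applies.\<close>

lemma char_cauchy_distribution_tendsto:
  "(\<lambda>n. \<integral>v. iexp (t * v) * complex_of_real ((1 / real (Suc n)) / (v\<^sup>2 + (1 / real (Suc n))\<^sup>2) / pi) \<partial>lborel)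
    \<longlonglongrightarrow> 1"
proof -
  let ?k = "\<lambda>v::real. 1 / (v\<^sup>2 + 1\<^sup>2)"
  have eq: "(\<integral>v. iexp (t * v) * complex_of_real (e / (v\<^sup>2 + e\<^sup>2) / pi) \<partial>lborel)
      = (\<integral>v. iexp (t * (e * v)) * complex_of_real (?k v / pi) \<partial>lborel)" if e: "e > 0" for e
  proof -
    have "(\<integral>v. iexp (t * v) * complex_of_real (e / (v\<^sup>2 + e\<^sup>2) / pi) \<partial>lborel)
        = \<bar>e\<bar> *\<^sub>R (\<integral>v. iexp (t * (0 + e * v)) * complex_of_real (e / ((0 + e * v)\<^sup>2 + e\<^sup>2) / pi) \<partial>lborel)"
      using e by (intro lborel_integral_real_affine) auto
    also have "\<dots> = (\<integral>v. \<bar>e\<bar> *\<^sub>R (iexp (t * (0 + e * v)) * complex_of_real (e / ((0 + e * v)\<^sup>2 + e\<^sup>2) / pi)) \<partial>lborel)"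
      by simp
    also have "\<dots> = (\<integral>v. iexp (t * (e * v)) * complex_of_real (?k v / pi) \<partial>lborel)"
    proof (intro Bochner_Integration.integral_cong refl)
      fix v
      have "(e * v)\<^sup>2 + e\<^sup>2 = (e * e) * (v\<^sup>2 + 1\<^sup>2)" by (simp add: algebra_simps power2_eq_square)
      then have "e * (e / ((e * v)\<^sup>2 + e\<^sup>2)) = ?k v"
        using e by simp
      then have "e * (e / ((e * v)\<^sup>2 + e\<^sup>2) / pi) = ?k v / pi"
        by (metis times_divide_eq_right)
      moreover have "\<bar>e\<bar> *\<^sub>R (X * complex_of_real Y) = X * complex_of_real (e * Y)" for X Y
        using e by (simp add: scaleR_conv_of_real)
      ultimately show "\<bar>e\<bar> *\<^sub>R (iexp (t * (0 + e * v)) * complex_of_real (e / ((0 + e * v)\<^sup>2 + e\<^sup>2) / pi))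
          = iexp (t * (e * v)) * complex_of_real (?k v / pi)"
        by (simp only: add_0)
    qed
    finally show ?thesis .
  qed
  have "(\<lambda>n. \<integral>v. iexp (t * (1 / real (Suc n) * v)) * complex_of_real (?k v / pi) \<partial>lborel)
      \<longlonglongrightarrow> (\<integral>v. iexp (t * (0 * v)) * complex_of_real (?k v / pi) \<partial>lborel)"
  proof (rule integral_dominated_convergence[where w = "\<lambda>v. ?k v / pi"])
    show "integrable lborel (\<lambda>v. ?k v / pi)"
      using poisson_kernel_integral(1)[of 1 0] by (intro integrable_divide_zero) simp
    show "AE v in lborel. (\<lambda>n. iexp (t * (1 / real (Suc n) * v)) * complex_of_real (?k v / pi))
        \<longlonglongrightarrow> iexp (t * (0 * v)) * complex_of_real (?k v / pi)"
      by (intro AE_I2 tendsto_intros LIMSEQ_inverse_real_of_nat[unfolded inverse_eq_divide])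
    show "AE v in lborel. norm (iexp (t * (1 / real (Suc n) * v)) * complex_of_real (?k v / pi)) \<le> ?k v / pi" for n
      unfolding norm_mult norm_of_real by (intro AE_I2) simp
  qed measurable
  moreover have "(\<integral>v. iexp (t * (0 * v)) * complex_of_real (?k v / pi) \<partial>lborel) = 1"
  proof -
    have "(\<integral>v. iexp (t * (0 * v)) * complex_of_real (?k v / pi) \<partial>lborel)
        = (\<integral>v. complex_of_real (?k v / pi) \<partial>lborel)" by simp
    also have "\<dots> = complex_of_real ((\<integral>v. ?k v \<partial>lborel) / pi)"
      by (simp only: integral_complex_of_real integral_divide_zero)
    also have "\<dots> = 1" using poisson_kernel_integral(2)[of 1 0] by simp
    finally show ?thesis .
  qed
  ultimately show ?thesis using eq[of "1 / real (Suc n)" for n] by simp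
qed

text \<open>Equal Cauchy transforms give equal characteristic functions up to the common factor
  \<open>K e\<close>, which tends to 1 as the smoothing scale tends to 0.\<close>

theorem cauchy_transform_inject:
  assumes M: "real_distribution M" and N: "real_distribution N"
    and eq: "\<And>z. Im z > 0 \<Longrightarrow> cauchy_transform M z = cauchy_transform N z"
  shows "M = N"
proof (rule Levy_uniqueness[OF M N], rule ext)
  fix t
  define K where "K e = (\<integral>v. iexp (t * v) * complex_of_real (e / (v\<^sup>2 + e\<^sup>2) / pi) \<partial>lborel)" for e
  have K: "char M t * K e = char N t * K e" if e: "e > 0" for e
  proof -
    have "cauchy_transform M (Complex u e) = cauchy_transform N (Complex u e)" for u
      using eq e by simp
    then show ?thesis
      unfolding K_def real_distribution.char_poisson[OF M e, symmetric]
        real_distribution.char_poisson[OF N e, symmetric] by (simp only:)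
  qed
  have K1: "(\<lambda>n. K (1 / real (Suc n))) \<longlonglongrightarrow> 1"
    unfolding K_def by (rule char_cauchy_distribution_tendsto)
  have "(\<lambda>n. char M t * K (1 / real (Suc n))) \<longlonglongrightarrow> char M t * 1"
    by (intro tendsto_mult tendsto_const K1)
  moreover have "char M t * K (1 / real (Suc n)) = char N t * K (1 / real (Suc n))" for n
    by (rule K) simp
  then have "(\<lambda>n. char M t * K (1 / real (Suc n))) \<longlonglongrightarrow> char N t * 1"
    by (simp only:) (intro tendsto_mult tendsto_const K1)
  ultimately show "char M t = char N t" using LIMSEQ_unique by fastforce
qed

section \<open>Nevanlinna's representation on the half plane\<close>

text \<open>A real segment is closed by a semicircle of radius R in the upper half plane, which
  contributes at most \<open>\<bar>C\<bar> * pi / R\<close>. Holomorphy slightly below the axis puts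
  the whole contour inside an open convex domain.\<close>

lemma integral_real_line_holomorphic_eq_0:
  fixes h :: "complex \<Rightarrow> complex"
  assumes hol: "h holomorphic_on {w. Im w > - \<delta>}" and \<delta>: "\<delta> > 0"
    and int: "integrable lborel (\<lambda>x. h (complex_of_real x))"
    and bnd: "\<And>w. Im w \<ge> 0 \<Longrightarrow> norm w \<ge> R0 \<Longrightarrow> norm (h w) \<le> C / (norm w)\<^sup>2"
  shows "(\<integral>x. h (complex_of_real x) \<partial>lborel) = 0"
proof -
  let ?S = "{w. Im w > - \<delta>}"
  have conv: "convex ?S" by (rule convex_halfspace_Im_gt)
  have C: "0 \<le> \<bar>C\<bar>" by simp
  have arc: "norm (\<integral>x. indicator {-R..R} x *\<^sub>R h (complex_of_real x) \<partial>lborel) \<le> \<bar>C\<bar> * pi / R"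
    if R: "R > 0" "R \<ge> R0" for R
  proof -
    let ?l = "linepath (complex_of_real (-R)) (complex_of_real R)"
    let ?a = "part_circlepath 0 R 0 pi"
    have a_pts: "norm x = R \<and> Im x \<ge> 0" if "x \<in> path_image ?a" for x
    proof -
      from that obtain s where s: "x = complex_of_real R * exp (\<i> * complex_of_real s)" "0 \<le> s" "s \<le> pi"
        by (auto simp: path_image_part_circlepath closed_segment_eq_real_ivl)
      have "Im x = R * sin s" using s(1) by (simp add: Im_exp)
      then show ?thesis using s R sin_ge_zero[of s] by (simp add: norm_mult)
    qed
    have ima: "path_image ?a \<subseteq> ?S" using a_pts \<delta> by (auto intro: less_le_trans[of _ 0])
    have "closed_segment (complex_of_real (-R)) (complex_of_real R) \<subseteq> ?S"
      using \<delta> by (intro closed_segment_subset conv) auto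
    then have iml: "path_image ?l \<subseteq> ?S" by simp
    have ends: "pathfinish ?l = pathstart ?a" "pathfinish ?a = pathstart ?l"
      using R by (simp_all add: pathstart_part_circlepath pathfinish_part_circlepath exp_eq_polar)
    have "(h has_contour_integral 0) (?l +++ ?a)"
      using ends ima iml by (intro Cauchy_theorem_convex_simple[OF hol conv])
        (auto simp: path_image_join valid_path_join)
    then have "contour_integral (?l +++ ?a) h = 0" by (rule contour_integral_unique)
    moreover have ci: "h contour_integrable_on ?l" "h contour_integrable_on ?a"
      using iml ima open_halfspace_Im_gt[of "-\<delta>"]
      by (auto intro!: contour_integrable_holomorphic_simple[OF hol])
    ultimately have la: "contour_integral ?l h = - contour_integral ?a h"
      using contour_integral_join[OF ci] by (simp add: eq_neg_iff_add_eq_0)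
    have bd: "norm (contour_integral ?a h) \<le> \<bar>C\<bar> / R\<^sup>2 * R * \<bar>pi - 0\<bar>"
    proof (rule contour_integral_bound_part_circlepath[OF ci(2)])
      fix x assume "x \<in> path_image ?a"
      then have "norm x = R" "Im x \<ge> 0" using a_pts by auto
      then have "norm (h x) \<le> C / R\<^sup>2" using bnd[of x] R by simp
      also have "\<dots> \<le> \<bar>C\<bar> / R\<^sup>2" by (intro divide_right_mono) auto
      finally show "norm (h x) \<le> \<bar>C\<bar> / R\<^sup>2" .
    qed (use R in auto)
    have li: "contour_integral ?l h = integral {-R..R} (\<lambda>x. h (complex_of_real x))"
      using R by (subst contour_integral_linepath_Reals_eq) auto
    have "integral {-R..R} (\<lambda>x. h (complex_of_real x))
        = (\<integral>x. indicator {-R..R} x *\<^sub>R h (complex_of_real x) \<partial>lborel)"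
    proof -
      have "set_integrable lborel {-R..R} (\<lambda>x. h (complex_of_real x))"
        unfolding set_integrable_def using int by (intro integrable_mult_indicator) auto
      from set_borel_integral_eq_integral(2)[OF this]
      show ?thesis by (simp add: set_lebesgue_integral_def)
    qed
    then have "norm (\<integral>x. indicator {-R..R} x *\<^sub>R h (complex_of_real x) \<partial>lborel) = norm (contour_integral ?a h)"
      using la li by (metis norm_minus_cancel)
    then show ?thesis using bd R by (simp add: power2_eq_square)
  qed
  have lim: "(\<lambda>n. \<integral>x. indicator {-real n..real n} x *\<^sub>R h (complex_of_real x) \<partial>lborel)
      \<longlonglongrightarrow> (\<integral>x. h (complex_of_real x) \<partial>lborel)"
  proof (rule integral_dominated_convergence[where w = "\<lambda>x. norm (h (complex_of_real x))"])
    show "AE x in lborel. (\<lambda>n. indicator {-real n..real n} x *\<^sub>R h (complex_of_real x))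
        \<longlonglongrightarrow> h (complex_of_real x)"
    proof (rule AE_I2)
      fix x :: real
      have "\<forall>\<^sub>F n in sequentially. \<bar>x\<bar> \<le> real n"
        using eventually_ge_at_top[of "nat \<lceil>\<bar>x\<bar>\<rceil>"] by eventually_elim linarith
      then have "\<forall>\<^sub>F n in sequentially. indicator {-real n..real n} x *\<^sub>R h (complex_of_real x) = h (complex_of_real x)"
        by eventually_elim (auto simp: indicator_def)
      then show "(\<lambda>n. indicator {-real n..real n} x *\<^sub>R h (complex_of_real x)) \<longlonglongrightarrow> h (complex_of_real x)"
        by (rule tendsto_eventually)
    qed
    show "AE x in lborel. norm (indicator {-real n..real n} x *\<^sub>R h (complex_of_real x)) \<le> norm (h (complex_of_real x))" for n
      by (rule AE_I2) (simp add: indicator_def)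
  qed (use int in \<open>auto intro: borel_measurable_integrable\<close>)
  have "(\<lambda>n. \<bar>C\<bar> * pi / real n) \<longlonglongrightarrow> 0"
    by (rule lim_const_over_n)
  moreover have "\<forall>\<^sub>F n in sequentially.
      norm (\<integral>x. indicator {-real n..real n} x *\<^sub>R h (complex_of_real x) \<partial>lborel) \<le> \<bar>C\<bar> * pi / real n"
    using eventually_gt_at_top[of "nat \<lceil>\<bar>R0\<bar>\<rceil>"]
    by eventually_elim (rule arc, linarith+)
  ultimately have "(\<lambda>n. \<integral>x. indicator {-real n..real n} x *\<^sub>R h (complex_of_real x) \<partial>lborel) \<longlonglongrightarrow> 0"
    by (rule Lim_null_comparison[rotated])
  then show ?thesis using lim LIMSEQ_unique by blast
qed

section \<open>Boundary values on the real line and Cauchy's formula in the half plane\<close>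

lemma integrable_inverse_1_plus_square_lborel: "integrable lborel (\<lambda>x::real. c / (1 + x\<^sup>2))"
  using integrable_mult_right[OF poisson_kernel_integral(1)[of 1 0], of c] by (simp add: add.commute)

lemma norm_diff_real_lower_bound:
  assumes "Im z \<noteq> 0"
  obtains c where "c > 0" "\<And>x. c * (1 + \<bar>x\<bar>) \<le> norm (complex_of_real x - z)"
proof
  define N where "N = 1 + norm z"
  \<comment> \<open>For 1 + |x| at most 2 N the imaginary part bounds the distance from below;
    beyond that the triangle inequality leaves at least half of 1 + |x|. The constant serves both
    cases.\<close>
  define c where "c = min \<bar>Im z\<bar> 1 / (2 * N)"
  have N: "N \<ge> 1" by (simp add: N_def)
  show "c > 0" using assms N by (simp add: c_def)
  show "c * (1 + \<bar>x\<bar>) \<le> norm (complex_of_real x - z)" for x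
  proof (cases "1 + \<bar>x\<bar> \<le> 2 * N")
    case True
    have "c * (1 + \<bar>x\<bar>) \<le> c * (2 * N)" using True \<open>c > 0\<close> by (intro mult_left_mono) auto
    also have "\<dots> = min \<bar>Im z\<bar> 1" using N by (simp add: c_def)
    also have "\<dots> \<le> \<bar>Im (complex_of_real x - z)\<bar>" by simp
    also have "\<dots> \<le> norm (complex_of_real x - z)" by (rule abs_Im_le_cmod)
    finally show ?thesis .
  next
    case False
    have "c \<le> 1 / 2" using N by (simp add: c_def field_simps min_def)
    then have "c * (1 + \<bar>x\<bar>) \<le> 1 / 2 * (1 + \<bar>x\<bar>)" by (intro mult_right_mono) auto
    also have "\<dots> \<le> \<bar>x\<bar> - norm z" using False by (simp add: N_def field_simps)
    also have "\<dots> \<le> norm (complex_of_real x - z)"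
      using norm_triangle_ineq2[of "complex_of_real x" z] by simp
    finally show ?thesis .
  qed
qed

lemma integrable_decay_divide:
  fixes f :: "real \<Rightarrow> complex"
  assumes meas: "f \<in> borel_measurable borel" and f: "\<And>x. norm (f x) \<le> C / (1 + \<bar>x\<bar>)" and z: "Im z \<noteq> 0"
  shows "integrable lborel (\<lambda>x. f x / (complex_of_real x - z))"
proof -
  obtain c where c: "c > 0" "\<And>x. c * (1 + \<bar>x\<bar>) \<le> norm (complex_of_real x - z)"
    using norm_diff_real_lower_bound[OF z] by auto
  have C: "C \<ge> 0" using order_trans[OF norm_ge_zero f[of 0]] by simp
  show ?thesis
  proof (rule Bochner_Integration.integrable_bound[OF integrable_inverse_1_plus_square_lborel[of "C / c"]])
    show "AE x in lborel. norm (f x / (complex_of_real x - z)) \<le> norm ((C / c) / (1 + x\<^sup>2))"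
    proof (rule AE_I2)
      fix x :: real
      have "norm (f x / (complex_of_real x - z)) \<le> (C / (1 + \<bar>x\<bar>)) / (c * (1 + \<bar>x\<bar>))"
        unfolding norm_divide using f[of x] c C by (intro frac_le) auto
      also have "\<dots> = (C / c) / ((1 + \<bar>x\<bar>) * (1 + \<bar>x\<bar>))" using c by simp
      also have "\<dots> \<le> (C / c) / (1 + x\<^sup>2)"
      proof (rule divide_left_mono)
        show "1 + x\<^sup>2 \<le> (1 + \<bar>x\<bar>) * (1 + \<bar>x\<bar>)" by (simp add: algebra_simps power2_eq_square)
        show "0 < (1 + \<bar>x\<bar>) * (1 + \<bar>x\<bar>) * (1 + x\<^sup>2)" by (intro mult_pos_pos add_pos_nonneg) auto
      qed (use C c in auto)
      also have "\<dots> \<le> norm ((C / c) / (1 + x\<^sup>2))"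
        unfolding real_norm_def by (rule abs_ge_self)
      finally show "norm (f x / (complex_of_real x - z)) \<le> norm ((C / c) / (1 + x\<^sup>2))" .
    qed
  qed (use meas in measurable)
qed

text \<open>Subtracting from \<open>f(w)/(w - z)\<close> a multiple of \<open>1/((w - z)(w - cnj z))\<close> removes the pole at \<open>z\<close>,
  so that no winding number has to be computed.\<close>

lemma half_plane_cauchy_formula:
  fixes f :: "complex \<Rightarrow> complex"
  assumes hol: "f holomorphic_on {w. Im w > - \<delta>}" and \<delta>: "\<delta> > 0"
    and bnd: "\<And>w. Im w \<ge> 0 \<Longrightarrow> norm (f w) \<le> C / (1 + norm w)" and z: "Im z > 0"
  shows "integrable lborel (\<lambda>x. complex_of_real (- Im (f (complex_of_real x)) / pi) / (z - complex_of_real x))"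
    and "(\<integral>x. complex_of_real (- Im (f (complex_of_real x)) / pi) / (z - complex_of_real x) \<partial>lborel) = f z"
proof -
  have C: "C \<ge> 0" using order_trans[OF norm_ge_zero bnd[of 0]] by simp
  \<comment> \<open>With \<eta> at most \<open>Im z\<close>, the conjugate point stays outside the
    open half plane \<open>Im w > - \<eta>\<close>, so \<open>z\<close> is the only pole to be
    removed.\<close>
  define \<eta> where "\<eta> = min \<delta> (Im z)"
  have \<eta>: "\<eta> > 0" "\<eta> \<le> \<delta>" "\<eta> \<le> Im z" using \<delta> z by (auto simp: \<eta>_def)
  have hol': "f holomorphic_on {w. Im w > - \<eta>}"
    by (rule holomorphic_on_subset[OF hol]) (use \<eta> in auto)
  have contf: "continuous_on {w. Im w > - \<eta>} f" by (rule holomorphic_on_imp_continuous_on[OF hol'])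
  have fr: "continuous_on UNIV (\<lambda>x. f (complex_of_real x))"
    by (rule continuous_on_compose2[OF contf]) (use \<eta> in \<open>auto intro!: continuous_intros\<close>)
  have meas: "(\<lambda>x. f (complex_of_real x)) \<in> borel_measurable borel"
    by (rule borel_measurable_continuous_onI[OF fr])
  have bndr: "norm (f (complex_of_real x)) \<le> C / (1 + \<bar>x\<bar>)" for x using bnd[of "complex_of_real x"] by simp
  have int1: "integrable lborel (\<lambda>x. f (complex_of_real x) / (complex_of_real x - z))"
    and int2: "integrable lborel (\<lambda>x. f (complex_of_real x) / (complex_of_real x - cnj z))"
    using z by (auto intro!: integrable_decay_divide[OF meas bndr])
  have nz: "w - cnj z \<noteq> 0" if "Im w > - \<eta>" for w using that \<eta> by (auto simp: complex_eq_iff)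
  have far: "norm w / 2 \<le> norm (w - z)" "norm w / 2 \<le> norm (w - cnj z)" if "norm w \<ge> 2 * norm z" for w
    using norm_triangle_ineq2[of w z] norm_triangle_ineq2[of w "cnj z"] that by auto

  have "(\<integral>x. (\<lambda>w. f w / (w - cnj z)) (complex_of_real x) \<partial>lborel) = 0"
  proof (rule integral_real_line_holomorphic_eq_0[OF _ \<eta>(1)])
    show "(\<lambda>w. f w / (w - cnj z)) holomorphic_on {w. - \<eta> < Im w}"
      using nz by (intro holomorphic_intros hol') auto
    show "integrable lborel (\<lambda>x. f (complex_of_real x) / (complex_of_real x - cnj z))" by (rule int2)
    fix w :: complex assume w: "Im w \<ge> 0" "norm w \<ge> 2 * norm z"
    have zp: "norm z > 0" using z by auto
    then have wn: "norm w > 0" using w by linarith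
    have "norm (f w / (w - cnj z)) \<le> (C / norm w) / (norm w / 2)"
      unfolding norm_divide
    proof (rule frac_le)
      have "norm (f w) \<le> C / (1 + norm w)" by (rule bnd[OF w(1)])
      also have "\<dots> \<le> C / norm w" using C wn by (intro divide_left_mono mult_pos_pos add_pos_nonneg) auto
      finally show "norm (f w) \<le> C / norm w" .
    qed (use C w far zp in auto)
    then show "norm (f w / (w - cnj z)) \<le> (2 * C) / (norm w)\<^sup>2" by (simp add: power2_eq_square mult.commute)
  qed
  then have I2: "(\<integral>x. f (complex_of_real x) / (complex_of_real x - cnj z) \<partial>lborel) = 0" by simp

  define F where "F = (\<lambda>w. f w - f z * (z - cnj z) / (w - cnj z))"
  define h where "h = (\<lambda>w. if w = z then deriv F z else (F w - F z) / (w - z))"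
  have Fz: "F z = 0" using nz[of z] \<eta> by (simp add: F_def)
  have "F holomorphic_on {w. - \<eta> < Im w}"
    unfolding F_def using nz by (intro holomorphic_intros hol') auto
  then have hh: "h holomorphic_on {w. - \<eta> < Im w}"
    unfolding h_def by (rule pole_lemma_open) (rule open_halfspace_Im_gt)
  \<comment> \<open>On the real line \<open>(x - cnj z) * (x - z)\<close> is the squared distance
    from \<open>z\<close>, so the subtracted term is a multiple of the Poisson kernel, whose
    integral is \<open>pi\<close>.\<close>
  have hr: "h (complex_of_real x) = f (complex_of_real x) / (complex_of_real x - z)
      - f z * (2 * \<i>) * complex_of_real (Im z / ((x - Re z)\<^sup>2 + (Im z)\<^sup>2))" for x
  proof -
    have n1: "complex_of_real x \<noteq> z" "complex_of_real x - cnj z \<noteq> 0" "complex_of_real x - z \<noteq> 0"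
      using z by (auto simp: complex_eq_iff)
    have m: "(complex_of_real x - cnj z) * (complex_of_real x - z) = complex_of_real ((x - Re z)\<^sup>2 + (Im z)\<^sup>2)"
      by (simp add: complex_eq_iff power2_eq_square algebra_simps)
    have d: "z - cnj z = 2 * \<i> * complex_of_real (Im z)" by (simp add: complex_eq_iff)
    have "h (complex_of_real x) = f (complex_of_real x) / (complex_of_real x - z)
        - f z * (z - cnj z) / ((complex_of_real x - cnj z) * (complex_of_real x - z))"
      using n1 by (simp add: h_def Fz) (simp add: F_def diff_divide_distrib)
    then show ?thesis unfolding m d by simp
  qed
  have pk: "integrable lborel (\<lambda>x. f z * (2 * \<i>) * complex_of_real (Im z / ((x - Re z)\<^sup>2 + (Im z)\<^sup>2)))"
    by (intro integrable_mult_right integrable_of_real poisson_kernel_integral(1) z)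
  have "(\<integral>x. h (complex_of_real x) \<partial>lborel) = 0"
  proof (rule integral_real_line_holomorphic_eq_0[OF hh \<eta>(1)])
    show "integrable lborel (\<lambda>x. h (complex_of_real x))"
      unfolding hr by (intro Bochner_Integration.integrable_diff int1 pk)
    fix w :: complex assume w: "Im w \<ge> 0" "norm w \<ge> max (2 * norm z) 1"
    have zp: "norm z > 0" using z by auto
    have wn: "norm w > 0" "w \<noteq> z" using w zp by auto
    let ?K = "norm (f z * (z - cnj z))"
    have "norm (F w) \<le> norm (f w) + ?K / norm (w - cnj z)"
      unfolding F_def using norm_triangle_ineq4[of "f w" "f z * (z - cnj z) / (w - cnj z)"] by (simp add: norm_divide)
    also have "\<dots> \<le> C / norm w + ?K / (norm w / 2)"
    proof (rule add_mono)
      have "norm (f w) \<le> C / (1 + norm w)" by (rule bnd[OF w(1)])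
      also have "\<dots> \<le> C / norm w" using C wn by (intro divide_left_mono mult_pos_pos add_pos_nonneg) auto
      finally show "norm (f w) \<le> C / norm w" .
      show "?K / norm (w - cnj z) \<le> ?K / (norm w / 2)"
        using wn far[of w] w by (intro divide_left_mono mult_pos_pos) auto
    qed
    also have "\<dots> = (C + 2 * ?K) / norm w" by (simp add: add_divide_distrib)
    finally have Fw: "norm (F w) \<le> (C + 2 * ?K) / norm w" .
    have "norm (h w) = norm (F w) / norm (w - z)" using wn by (simp add: h_def Fz norm_divide)
    also have "\<dots> \<le> ((C + 2 * ?K) / norm w) / (norm w / 2)"
      using wn far[of w] w C by (intro frac_le Fw) auto
    finally show "norm (h w) \<le> (2 * (C + 2 * ?K)) / (norm w)\<^sup>2" by (simp add: power2_eq_square mult.commute)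
  qed
  then have "(\<integral>x. f (complex_of_real x) / (complex_of_real x - z) \<partial>lborel)
      = (\<integral>x. f z * (2 * \<i>) * complex_of_real (Im z / ((x - Re z)\<^sup>2 + (Im z)\<^sup>2)) \<partial>lborel)"
    unfolding hr by (subst (asm) Bochner_Integration.integral_diff[OF int1 pk]) simp
  also have "\<dots> = f z * (2 * \<i>) * complex_of_real pi"
    by (simp only: integral_mult_right_zero integral_complex_of_real poisson_kernel_integral(2)[OF z])
  finally have I1: "(\<integral>x. f (complex_of_real x) / (complex_of_real x - z) \<partial>lborel) = f z * (2 * \<i>) * complex_of_real pi" .

  \<comment> \<open>Conjugating the vanishing integral replaces \<open>f\<close> by its conjugate
    over the same denominator. Subtracting it from \<open>I1\<close> leaves
    \<open>f - cnj f = 2 \<i> Im f\<close>, so the imaginary part alone on the line reproduces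
    \<open>f z\<close>.\<close>
  have I2': "(\<integral>x. cnj (f (complex_of_real x)) / (complex_of_real x - z) \<partial>lborel) = 0"
    using arg_cong[OF I2, of cnj] integral_bounded_linear[OF bounded_linear_cnj int2] by simp
  have int2': "integrable lborel (\<lambda>x. cnj (f (complex_of_real x)) / (complex_of_real x - z))"
    using integrable_bounded_linear[OF bounded_linear_cnj int2] by simp
  have e: "complex_of_real (- Im (f (complex_of_real x)) / pi) / (z - complex_of_real x)
      = (1 / (2 * \<i> * complex_of_real pi)) *
        (f (complex_of_real x) / (complex_of_real x - z) - cnj (f (complex_of_real x)) / (complex_of_real x - z))" for x
  proof -
    have n: "complex_of_real x - z \<noteq> 0" "z - complex_of_real x \<noteq> 0" using z by (auto simp: complex_eq_iff)
    have "f (complex_of_real x) - cnj (f (complex_of_real x)) = 2 * \<i> * complex_of_real (Im (f (complex_of_real x)))"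
      by (simp add: complex_eq_iff)
    then have "f (complex_of_real x) / (complex_of_real x - z) - cnj (f (complex_of_real x)) / (complex_of_real x - z)
        = 2 * \<i> * complex_of_real (Im (f (complex_of_real x))) / (complex_of_real x - z)"
      by (simp add: diff_divide_distrib[symmetric])
    also have "\<dots> = - (2 * \<i> * complex_of_real (Im (f (complex_of_real x))) / (z - complex_of_real x))"
      by (metis minus_diff_eq minus_divide_right)
    finally show ?thesis by simp
  qed
  show "integrable lborel (\<lambda>x. complex_of_real (- Im (f (complex_of_real x)) / pi) / (z - complex_of_real x))"
    unfolding e by (intro integrable_mult_right Bochner_Integration.integrable_diff int1 int2')
  show "(\<integral>x. complex_of_real (- Im (f (complex_of_real x)) / pi) / (z - complex_of_real x) \<partial>lborel) = f z"
    unfolding e integral_mult_right_zero Bochner_Integration.integral_diff[OF int1 int2'] I1 I2' by (simp add: algebra_simps)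
qed


text \<open>At height \<open>e\<close> the function has continuous boundary values, and
  \<open>- Im g / pi\<close> there is a nonnegative density \<open>p\<close> whose Cauchy transform
  is the shifted \<open>g\<close>. Its mass is the limit of the integrals of \<open>p\<close> times
  \<open>y\<^sup>2 / (y\<^sup>2 + x\<^sup>2)\<close>, which are the real parts of i y g(i y + i e);
  this factor increases to 1 in y, so monotone convergence gives mass 1.\<close>

lemma nevanlinna_shifted:
  fixes g :: "complex \<Rightarrow> complex"
  assumes hol: "g holomorphic_on {z. Im z > 0}" and neg: "\<And>z. Im z > 0 \<Longrightarrow> Im (g z) \<le> 0"
    and bnd: "\<And>z. Im z \<ge> e \<Longrightarrow> norm (g z) \<le> C / (1 + norm z)"
    and lim: "((\<lambda>y. \<i> * complex_of_real y * g (\<i> * complex_of_real y)) \<longlongrightarrow> 1) at_top" and e: "e > 0"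
  obtains M where "real_distribution M"
    "\<And>z. Im z > 0 \<Longrightarrow> cauchy_transform M z = g (z + \<i> * complex_of_real e)"
proof -
  define f where "f = (\<lambda>z. g (z + \<i> * complex_of_real e))"
  define p where "p = (\<lambda>x. - Im (f (complex_of_real x)) / pi)"
  have fh: "f holomorphic_on {w. Im w > - e}"
  proof -
    have "g \<circ> (\<lambda>z. z + \<i> * complex_of_real e) holomorphic_on {w. Im w > - e}"
      by (rule holomorphic_on_compose_gen[OF _ hol]) (auto intro!: holomorphic_intros)
    then show ?thesis by (simp add: f_def o_def)
  qed
  have "0 < 1 + norm (\<i> * complex_of_real e)" by (simp add: add_pos_nonneg)
  then have C: "C \<ge> 0" using order_trans[OF norm_ge_zero bnd[of "\<i> * complex_of_real e"]] e
    by (simp add: zero_le_divide_iff)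
  have fb: "norm (f w) \<le> ((1 + e) * C) / (1 + norm w)" if "Im w \<ge> 0" for w
  proof -
    let ?u = "w + \<i> * complex_of_real e"
    have "norm w \<le> norm ?u + e"
      using norm_triangle_ineq4[of ?u "\<i> * complex_of_real e"] e by (simp add: norm_mult)
    moreover have "0 \<le> e * norm ?u" using e by simp
    ultimately have "1 + norm w \<le> (1 + e) * (1 + norm ?u)" unfolding distrib_left distrib_right by linarith
    then have "C * (1 + norm w) \<le> C * ((1 + e) * (1 + norm ?u))" using C by (intro mult_left_mono)
    moreover have "0 < 1 + norm ?u" "0 < 1 + norm w" by (simp_all add: add_pos_nonneg)
    ultimately have "C / (1 + norm ?u) \<le> ((1 + e) * C) / (1 + norm w)"
      by (simp add: divide_simps mult.commute mult.left_commute)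
    then show ?thesis using bnd[of ?u] that by (simp add: f_def)
  qed
  have H: "integrable lborel (\<lambda>x. complex_of_real (p x) / (z - complex_of_real x))"
    "(\<integral>x. complex_of_real (p x) / (z - complex_of_real x) \<partial>lborel) = f z" if "Im z > 0" for z
    unfolding p_def using half_plane_cauchy_formula[OF fh e fb that] by auto
  have pnn: "p x \<ge> 0" for x unfolding p_def f_def using neg[of "complex_of_real x + \<i> * complex_of_real e"] e
    by (simp add: divide_nonpos_pos)
  have contf: "continuous_on {w. Im w > - e} f" by (rule holomorphic_on_imp_continuous_on[OF fh])
  have "continuous_on UNIV (\<lambda>x. f (complex_of_real x))"
    by (rule continuous_on_compose2[OF contf]) (use e in \<open>auto intro!: continuous_intros\<close>)
  then have "continuous_on UNIV p" unfolding p_def by (intro continuous_intros) auto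
  then have pm[measurable]: "p \<in> borel_measurable borel" by (rule borel_measurable_continuous_onI)
  have re: "Re (\<i> * complex_of_real y * (complex_of_real (p x) / (\<i> * complex_of_real y - complex_of_real x)))
      = p x * (y\<^sup>2 / (y\<^sup>2 + x\<^sup>2))" if "y > 0" for x y
    by (simp add: Re_divide Im_divide power2_eq_square algebra_simps)
  have mi: "integrable lborel (\<lambda>x. p x * (y\<^sup>2 / (y\<^sup>2 + x\<^sup>2)))"
    "(\<integral>x. p x * (y\<^sup>2 / (y\<^sup>2 + x\<^sup>2)) \<partial>lborel) = Re (\<i> * complex_of_real y * f (\<i> * complex_of_real y))"
    if y: "y > 0" for y
  proof -
    have i: "integrable lborel (\<lambda>x. \<i> * complex_of_real y * (complex_of_real (p x) / (\<i> * complex_of_real y - complex_of_real x)))"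
      using y by (intro integrable_mult_right H) auto
    show "integrable lborel (\<lambda>x. p x * (y\<^sup>2 / (y\<^sup>2 + x\<^sup>2)))" using integrable_Re[OF i] unfolding re[OF y] .
    have "(\<integral>x. p x * (y\<^sup>2 / (y\<^sup>2 + x\<^sup>2)) \<partial>lborel)
        = Re (\<integral>x. \<i> * complex_of_real y * (complex_of_real (p x) / (\<i> * complex_of_real y - complex_of_real x)) \<partial>lborel)"
      using integral_Re[OF i] unfolding re[OF y] .
    also have "\<dots> = Re (\<i> * complex_of_real y * f (\<i> * complex_of_real y))"
      unfolding integral_mult_right_zero using H(2)[of "\<i> * complex_of_real y"] y by simp
    finally show "(\<integral>x. p x * (y\<^sup>2 / (y\<^sup>2 + x\<^sup>2)) \<partial>lborel) = Re (\<i> * complex_of_real y * f (\<i> * complex_of_real y))" .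
  qed
  have flim: "((\<lambda>y. \<i> * complex_of_real y * f (\<i> * complex_of_real y)) \<longlongrightarrow> 1) at_top"
  proof -
    have "((\<lambda>y. \<i> * complex_of_real (y + e) * g (\<i> * complex_of_real (y + e))) \<longlongrightarrow> 1) at_top"
      by (rule filterlim_compose[OF lim]) real_asymp
    moreover have "((\<lambda>y. complex_of_real (y / (y + e))) \<longlongrightarrow> complex_of_real 1) at_top"
      using e by (intro tendsto_of_real) real_asymp
    ultimately have "((\<lambda>y. complex_of_real (y / (y + e)) * (\<i> * complex_of_real (y + e) * g (\<i> * complex_of_real (y + e)))) \<longlongrightarrow> complex_of_real 1 * 1) at_top"
      by (intro tendsto_mult)
    moreover have "\<forall>\<^sub>F y in at_top. complex_of_real (y / (y + e)) * (\<i> * complex_of_real (y + e) * g (\<i> * complex_of_real (y + e)))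
        = \<i> * complex_of_real y * f (\<i> * complex_of_real y)"
      using eventually_gt_at_top[of 0]
    proof eventually_elim
      fix y :: real assume "0 < y"
      then have "complex_of_real (y / (y + e)) * complex_of_real (y + e) = complex_of_real y"
        using e by (metis add_pos_pos less_irrefl nonzero_eq_divide_eq of_real_mult)
      moreover have "f (\<i> * complex_of_real y) = g (\<i> * complex_of_real (y + e))" by (simp add: f_def ring_distribs)
      ultimately show "complex_of_real (y / (y + e)) * (\<i> * complex_of_real (y + e) * g (\<i> * complex_of_real (y + e)))
        = \<i> * complex_of_real y * f (\<i> * complex_of_real y)" by (metis (no_types, lifting) mult.assoc mult.commute)
    qed
    ultimately show ?thesis by (simp add: tendsto_cong)
  qed
  have ps: "integrable lborel p" "(\<integral>x. p x \<partial>lborel) = 1"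
  proof -
    let ?q = "\<lambda>n x. p x * ((real (Suc n))\<^sup>2 / ((real (Suc n))\<^sup>2 + x\<^sup>2))"
    have A: "\<And>n. integrable lborel (?q n)" by (intro mi) simp
    have B: "AE x in lborel. mono (\<lambda>n. ?q n x)"
    proof (rule AE_I2, rule monoI)
      fix x :: real and m n :: nat assume "m \<le> n"
      then have "(real (Suc m))\<^sup>2 \<le> (real (Suc n))\<^sup>2" by (intro power_mono) auto
      moreover have "0 < (real (Suc m))\<^sup>2" "0 < (real (Suc n))\<^sup>2" by simp_all
      moreover have "a / (a + x\<^sup>2) \<le> b / (b + x\<^sup>2)" if "a \<le> b" "0 < a" "0 < b" for a b :: real
      proof -
        have "0 < a + x\<^sup>2" "0 < b + x\<^sup>2" using that by (simp_all add: add_pos_nonneg)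
        moreover have "a * x\<^sup>2 \<le> b * x\<^sup>2" using that by (intro mult_right_mono) auto
        ultimately show ?thesis by (simp add: divide_simps algebra_simps)
      qed
      ultimately show "?q m x \<le> ?q n x" using pnn[of x] by (intro mult_left_mono) auto
    qed
    have Cc: "AE x in lborel. (\<lambda>n. ?q n x) \<longlonglongrightarrow> p x"
    proof (rule AE_I2)
      fix x :: real
      have "(\<lambda>n. (real (Suc n))\<^sup>2 / ((real (Suc n))\<^sup>2 + x\<^sup>2)) \<longlonglongrightarrow> 1" by real_asymp
      then have "(\<lambda>n. ?q n x) \<longlonglongrightarrow> p x * 1" by (intro tendsto_mult tendsto_const)
      then show "(\<lambda>n. ?q n x) \<longlonglongrightarrow> p x" by simp
    qed
    have "(\<lambda>n. Re (\<i> * complex_of_real (real (Suc n)) * f (\<i> * complex_of_real (real (Suc n))))) \<longlonglongrightarrow> Re 1"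
      by (intro tendsto_Re filterlim_compose[OF flim]) (rule filterlim_compose[OF filterlim_real_sequentially filterlim_Suc])
    then have D: "(\<lambda>n. integral\<^sup>L lborel (?q n)) \<longlonglongrightarrow> 1"
      unfolding mi(2)[OF of_nat_0_less_iff[THEN iffD2, OF zero_less_Suc]] by simp
    show "integrable lborel p" "(\<integral>x. p x \<partial>lborel) = 1"
      using integrable_monotone_convergence[OF A B Cc D] integral_monotone_convergence[OF A B Cc D] by auto
  qed
  define M where "M = density lborel p"
  have "emeasure M (space M) = 1"
  proof -
    have "emeasure M (space M) = (\<integral>\<^sup>+x. p x \<partial>lborel)" by (simp add: M_def emeasure_density)
    also have "\<dots> = ennreal 1" using ps pnn by (subst nn_integral_eq_integral) auto
    finally show ?thesis by simp
  qed
  then have "prob_space M" by (rule prob_spaceI)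
  then have "real_distribution M"
    unfolding real_distribution_def real_distribution_axioms_def by (simp add: M_def)
  moreover have "cauchy_transform M z = g (z + \<i> * complex_of_real e)" if z: "Im z > 0" for z
  proof -
    have "continuous_on UNIV (\<lambda>x. 1 / (z - complex_of_real x))"
      using isCont_cauchy_kernel[OF z] by (simp add: continuous_at_imp_continuous_on)
    then have "(\<lambda>x. 1 / (z - complex_of_real x)) \<in> borel_measurable borel" by (rule borel_measurable_continuous_onI)
    then have "cauchy_transform M z = (\<integral>x. p x *\<^sub>R (1 / (z - complex_of_real x)) \<partial>lborel)"
      unfolding cauchy_transform_def M_def using pnn by (intro integral_density) auto
    also have "\<dots> = f z" using H(2)[OF z] by (simp add: scaleR_conv_of_real)
    finally show ?thesis by (simp add: f_def)
  qed
  ultimately show thesis by (rule that)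
qed

text \<open>The measures belonging to the shifts \<open>e n\<close> are tight because the limit
  along the imaginary axis bounds their tails uniformly. A weak limit of a subsequence has Cauchy
  transform \<open>g\<close>, since the kernel is bounded and continuous in x and the shifts tend to
  0.\<close>

theorem nevanlinna:
  fixes g :: "complex \<Rightarrow> complex"
  assumes hol: "g holomorphic_on {z. Im z > 0}" and neg: "\<And>z. Im z > 0 \<Longrightarrow> Im (g z) \<le> 0"
    and bnd: "\<And>e. e > 0 \<Longrightarrow> \<exists>C. \<forall>z. Im z \<ge> e \<longrightarrow> norm (g z) \<le> C / (1 + norm z)"
    and lim: "((\<lambda>y. \<i> * complex_of_real y * g (\<i> * complex_of_real y)) \<longlongrightarrow> 1) at_top"
  obtains M where "real_distribution M" "\<And>z. Im z > 0 \<Longrightarrow> cauchy_transform M z = g z"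
proof -
  define e where "e n = 1 / real (Suc n)" for n
  have e: "e n > 0" "e n \<le> 1" for n by (simp_all add: e_def)
  have elim: "e \<longlonglongrightarrow> 0" unfolding e_def by real_asymp
  have "\<exists>M. real_distribution M \<and> (\<forall>z. Im z > 0 \<longrightarrow> cauchy_transform M z = g (z + \<i> * complex_of_real (e n)))" for n
  proof -
    obtain C where C: "\<And>z. Im z \<ge> e n \<Longrightarrow> norm (g z) \<le> C / (1 + norm z)" using bnd[OF e(1)[of n]] by auto
    show ?thesis using nevanlinna_shifted[OF hol neg C lim e(1)] by metis
  qed
  then obtain N where N: "\<And>n. real_distribution (N n)"
    "\<And>n z. Im z > 0 \<Longrightarrow> cauchy_transform (N n) z = g (z + \<i> * complex_of_real (e n))" by metis
  \<comment> \<open>The function \<open>x\<^sup>2 / (x\<^sup>2 + y\<^sup>2)\<close> is at least 1/2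
    where |x| is at least \<open>y\<close>, and its integral is the real part of 1 - i y G(i y).
    This controls the tail by values of the Cauchy transform.\<close>
  have tail: "measure (N n) (- {-y<..y}) \<le> 2 * (1 - Re (\<i> * complex_of_real y * g (\<i> * complex_of_real (y + e n))))"
    if y: "y > 0" for n y
  proof -
    interpret real_distribution "N n" by (rule N)
    have i: "integrable (N n) (\<lambda>x. 1 - \<i> * complex_of_real y * (1 / (\<i> * complex_of_real y - complex_of_real x)))"
      using y by (intro Bochner_Integration.integrable_diff integrable_mult_right integrable_cauchy_kernel) auto
    have re: "Re (1 - \<i> * complex_of_real y * (1 / (\<i> * complex_of_real y - complex_of_real x))) = x\<^sup>2 / (x\<^sup>2 + y\<^sup>2)" for x
    proof -
      have "x\<^sup>2 + y\<^sup>2 \<noteq> 0" using y by (simp add: sum_power2_eq_zero_iff)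
      then show ?thesis by (simp add: Re_divide Im_divide divide_simps) (simp add: power2_eq_square algebra_simps)
    qed
    have "(\<integral>x. x\<^sup>2 / (x\<^sup>2 + y\<^sup>2) \<partial>N n) = Re (\<integral>x. 1 - \<i> * complex_of_real y * (1 / (\<i> * complex_of_real y - complex_of_real x)) \<partial>N n)"
      using integral_Re[OF i] unfolding re .
    also have "(\<integral>x. 1 - \<i> * complex_of_real y * (1 / (\<i> * complex_of_real y - complex_of_real x)) \<partial>N n)
        = 1 - \<i> * complex_of_real y * cauchy_transform (N n) (\<i> * complex_of_real y)"
    proof -
      have ik: "integrable (N n) (\<lambda>x. \<i> * complex_of_real y * (1 / (\<i> * complex_of_real y - complex_of_real x)))"
        using y by (intro integrable_mult_right integrable_cauchy_kernel) auto
      show ?thesis unfolding cauchy_transform_def integral_mult_right_zero[symmetric]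
        by (subst Bochner_Integration.integral_diff[OF _ ik]) (use prob_space in simp_all)
    qed
    also have "cauchy_transform (N n) (\<i> * complex_of_real y) = g (\<i> * complex_of_real (y + e n))"
      using N(2)[of "\<i> * complex_of_real y" n] y by (simp add: ring_distribs)
    finally have eq: "(\<integral>x. x\<^sup>2 / (x\<^sup>2 + y\<^sup>2) \<partial>N n) = 1 - Re (\<i> * complex_of_real y * g (\<i> * complex_of_real (y + e n)))" by simp
    have ii: "integrable (N n) (\<lambda>x. x\<^sup>2 / (x\<^sup>2 + y\<^sup>2))" using integrable_Re[OF i] unfolding re .
    have "measure (N n) (- {-y<..y}) = (\<integral>x. indicator (- {-y<..y}) x \<partial>N n)" by simp
    also have "\<dots> \<le> (\<integral>x. 2 * (x\<^sup>2 / (x\<^sup>2 + y\<^sup>2)) \<partial>N n)"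
    proof (intro integral_mono integrable_mult_right ii)
      fix x :: real
      have p: "0 < x\<^sup>2 + y\<^sup>2" using y by (simp add: add_nonneg_pos)
      show "indicator (- {-y<..y}) x \<le> 2 * (x\<^sup>2 / (x\<^sup>2 + y\<^sup>2))"
      proof (cases "x \<in> {-y<..y}")
        case False
        then have "y \<le> \<bar>x\<bar>" by auto
        then have "y\<^sup>2 \<le> x\<^sup>2" using y by (simp add: abs_le_square_iff[symmetric])
        then show ?thesis using False p by (simp add: field_simps)
      qed (use p in simp)
      show "integrable (N n) (indicator (- {-y<..y}) :: real \<Rightarrow> real)"
        by (rule integrable_real_indicator) (auto simp: less_top[symmetric])
    qed
    also have "\<dots> = 2 * (1 - Re (\<i> * complex_of_real y * g (\<i> * complex_of_real (y + e n))))"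
      by (simp only: integral_mult_right_zero eq)
    finally show ?thesis .
  qed
  have tight: "tight N"
    unfolding tight_def
  proof (intro conjI allI impI N)
    fix \<epsilon> :: real assume \<epsilon>: "\<epsilon> > 0"
    \<comment> \<open>The final tail bound is 4 \<eta>, hence the 8. The 1/2 keeps 1 - \<eta>
      nonnegative when two lower bounds are multiplied. Taking \<open>y\<close> at least 1/\<eta>,
      with all shifts at most 1, makes \<open>y / (y + e n)\<close> at least 1 - \<eta> for every
      \<open>n\<close> at once.\<close>
    define \<eta> where "\<eta> = min (\<epsilon> / 8) (1 / 2)"
    have \<eta>: "0 < \<eta>" "\<eta> \<le> \<epsilon> / 8" "\<eta> \<le> 1 / 2" using \<epsilon> by (auto simp: \<eta>_def)
    have "\<forall>\<^sub>F y in at_top. dist (\<i> * complex_of_real y * g (\<i> * complex_of_real y)) 1 < \<eta>"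
      using lim \<eta>(1) by (rule tendstoD)
    then obtain Y where Y: "\<And>y. y \<ge> Y \<Longrightarrow> dist (\<i> * complex_of_real y * g (\<i> * complex_of_real y)) 1 < \<eta>"
      by (auto simp: eventually_at_top_linorder)
    define y where "y = max Y (1 / \<eta>)"
    have y: "y \<ge> Y" "y \<ge> 1 / \<eta>" "y > 0" using \<eta>(1) by (auto simp: y_def less_max_iff_disj)
    have "measure (N n) {-y<..y} > 1 - \<epsilon>" for n
    proof -
      interpret real_distribution "N n" by (rule N)
      let ?w = "\<i> * complex_of_real (y + e n) * g (\<i> * complex_of_real (y + e n))"
      have "dist ?w 1 < \<eta>" using Y[of "y + e n"] y e(1)[of n] by simp
      then have "\<bar>Re (?w - 1)\<bar> < \<eta>" using abs_Re_le_cmod[of "?w - 1"] by (simp add: dist_norm)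
      then have w: "Re ?w > 1 - \<eta>" by simp
      have yy: "y / (y + e n) \<ge> 1 - \<eta>"
      proof -
        have "1 \<le> \<eta> * y" using y(2) \<eta>(1) by (simp add: field_simps)
        moreover have "\<eta> * y \<le> \<eta> * (y + e n)" using e(1)[of n] \<eta>(1) by (intro mult_left_mono) auto
        ultimately have "e n \<le> \<eta> * (y + e n)" using e(2)[of n] by linarith
        then show ?thesis using y(3) e(1)[of n] by (simp add: field_simps)
      qed
      have "\<i> * complex_of_real y * g (\<i> * complex_of_real (y + e n)) = complex_of_real (y / (y + e n)) * ?w"
      proof -
        have "complex_of_real (y / (y + e n)) * complex_of_real (y + e n) = complex_of_real y"
          using y(3) e(1)[of n] by (metis add_pos_pos less_irrefl nonzero_eq_divide_eq of_real_mult)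
        then show ?thesis by (metis (no_types, lifting) mult.assoc mult.commute)
      qed
      moreover have "Re (complex_of_real r * w) = r * Re w" for r w by simp
      ultimately have "Re (\<i> * complex_of_real y * g (\<i> * complex_of_real (y + e n))) = y / (y + e n) * Re ?w"
        by (simp only:)
      also have "\<dots> \<ge> (1 - \<eta>) * (1 - \<eta>)" using yy w \<eta> by (intro mult_mono) auto
      finally have "1 - Re (\<i> * complex_of_real y * g (\<i> * complex_of_real (y + e n))) \<le> 1 - (1 - \<eta>) * (1 - \<eta>)" by simp
      also have "\<dots> \<le> 2 * \<eta>" by (simp add: algebra_simps)
      finally have "2 * (1 - Re (\<i> * complex_of_real y * g (\<i> * complex_of_real (y + e n)))) \<le> 2 * (2 * \<eta>)"
        by (rule mult_left_mono) simp
      then have "measure (N n) (- {-y<..y}) \<le> 2 * (2 * \<eta>)" by (rule order_trans[OF tail[OF y(3), of n]])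
      then have "measure (N n) (- {-y<..y}) < \<epsilon>" using \<eta> \<epsilon> by linarith
      then show ?thesis using prob_compl[of "{-y<..y}"] by (simp add: Compl_eq_Diff_UNIV)
    qed
    then show "\<exists>a b. a < b \<and> (\<forall>n. measure (N n) {a<..b} > 1 - \<epsilon>)" using y(3) by (intro exI[of _ "-y"] exI[of _ y]) auto
  qed
  obtain r M where r: "strict_mono r" and M: "real_distribution M" and wc: "weak_conv_m (N \<circ> id \<circ> r) M"
    using tight_imp_convergent_subsubsequence[OF tight, of id] by (auto simp: strict_mono_id)
  have "cauchy_transform M z = g z" if z: "Im z > 0" for z
  proof -
    have "(\<lambda>n. cauchy_transform ((N \<circ> id \<circ> r) n) z) \<longlonglongrightarrow> cauchy_transform M z"
      unfolding cauchy_transform_def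
    proof (rule weak_conv_imp_integral_bdd_continuous_conv)
      show "real_distribution ((N \<circ> id \<circ> r) n)" for n by (simp add: N(1))
      show "isCont (\<lambda>x. 1 / (z - complex_of_real x)) x" for x by (rule isCont_cauchy_kernel[OF z])
      show "norm (1 / (z - complex_of_real x)) \<le> 1 / Im z" for x by (rule norm_cauchy_kernel_le[OF z])
    qed (fact M wc)+
    then have "(\<lambda>n. g (z + \<i> * complex_of_real (e (r n)))) \<longlonglongrightarrow> cauchy_transform M z"
      using N(2)[OF z] by simp
    moreover have "(\<lambda>n. g (z + \<i> * complex_of_real (e (r n)))) \<longlonglongrightarrow> g z"
    proof (rule isCont_tendsto_compose[of z g])
      have "open {z. Im z > 0}" by (rule open_halfspace_Im_gt)
      then show "isCont g z" using holomorphic_on_imp_continuous_on[OF hol] z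
        by (auto simp: continuous_on_eq_continuous_at)
      have "(\<lambda>n. e (r n)) \<longlonglongrightarrow> 0" using LIMSEQ_subseq_LIMSEQ[OF elim r] by (simp add: o_def)
      then have "(\<lambda>n. z + \<i> * complex_of_real (e (r n))) \<longlonglongrightarrow> z + \<i> * complex_of_real 0"
        by (intro tendsto_intros)
      then show "(\<lambda>n. z + \<i> * complex_of_real (e (r n))) \<longlonglongrightarrow> z" by simp
    qed
    ultimately show ?thesis by (rule LIMSEQ_unique)
  qed
  then show thesis using that M by blast
qed

section \<open>Semicircular perturbation by subordination\<close>

context real_distribution
begin

lemma integrable_cauchy_kernel_mult:
  assumes "Im w > 0" "Im z > 0"
  shows "integrable M (\<lambda>x. (1 / (w - complex_of_real x)) * (1 / (z - complex_of_real x)))"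
proof -
  have "norm ((1 / (w - complex_of_real x)) * (1 / (z - complex_of_real x))) \<le> 1 / Im w * (1 / Im z)" for x
    unfolding norm_mult using assms by (intro mult_mono norm_cauchy_kernel_le) auto
  then show ?thesis
    by (intro integrable_const_bound[where B = "1 / Im w * (1 / Im z)"] borel_measurable_continuous
        isCont_mult isCont_cauchy_kernel assms) auto
qed

text \<open>The resolvent identity under the integral. Differentiability, injectivity of the shifted
  identity and injectivity high up all start from it.\<close>

lemma cauchy_transform_diff:
  assumes w: "Im w > 0" and z: "Im z > 0"
  shows "cauchy_transform M w - cauchy_transform M z
    = - ((w - z) * (\<integral>x. (1 / (w - complex_of_real x)) * (1 / (z - complex_of_real x)) \<partial>M))"
proof -
  have k: "1 / (w - complex_of_real x) - 1 / (z - complex_of_real x)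
      = - (w - z) * ((1 / (w - complex_of_real x)) * (1 / (z - complex_of_real x)))" for x
    using cauchy_kernel_nonzero[OF w, of x] cauchy_kernel_nonzero[OF z, of x] by (simp add: field_simps)
  have "cauchy_transform M w - cauchy_transform M z
      = (\<integral>x. 1 / (w - complex_of_real x) - 1 / (z - complex_of_real x) \<partial>M)"
    unfolding cauchy_transform_def
    by (rule Bochner_Integration.integral_diff[symmetric]) (intro integrable_cauchy_kernel w z)+
  also have "\<dots> = - (w - z) * (\<integral>x. (1 / (w - complex_of_real x)) * (1 / (z - complex_of_real x)) \<partial>M)"
    unfolding k by (rule integral_mult_right_zero)
  finally show ?thesis by (simp only: mult_minus_left)
qed

text \<open>By the resolvent identity the difference quotient is \<open>- J w\<close>, and a second
  use of the identity bounds \<open>J w - J z\<close> linearly in the distance while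
  \<open>Im w\<close> exceeds half of \<open>Im z\<close>.\<close>

lemma cauchy_transform_has_field_derivative:
  assumes z: "Im z > 0"
  shows "(cauchy_transform M has_field_derivative
    - (\<integral>x. (1 / (z - complex_of_real x)) * (1 / (z - complex_of_real x)) \<partial>M)) (at z)"
proof -
  define J where "J w = (\<integral>x. (1 / (w - complex_of_real x)) * (1 / (z - complex_of_real x)) \<partial>M)" for w
  have near: "\<forall>\<^sub>F w in at z. Im w > Im z / 2"
  proof -
    have "open {w. Im w > Im z / 2}" by (rule open_halfspace_Im_gt)
    then show ?thesis using z eventually_at_in_open'[of "{w. Im w > Im z / 2}" z] by simp
  qed
  have Jd: "norm (J w - J z) \<le> norm (w - z) * (2 / Im z ^ 3)" if w: "Im w > Im z / 2" for w
  proof -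
    have w0: "Im w > 0" using w z by simp
    have k: "(1 / (w - complex_of_real x)) * (1 / (z - complex_of_real x)) - (1 / (z - complex_of_real x)) * (1 / (z - complex_of_real x))
      = - (w - z) * ((1 / (w - complex_of_real x)) * (1 / (z - complex_of_real x)) * (1 / (z - complex_of_real x)))" for x
    proof -
      have "1 / a * (1 / b) - 1 / b * (1 / b) = - (a - b) * (1 / a * (1 / b) * (1 / b))"
        if "a \<noteq> 0" "b \<noteq> 0" for a b :: complex
        using that by (simp add: divide_simps)
      from this[OF cauchy_kernel_nonzero[OF w0, of x] cauchy_kernel_nonzero[OF z, of x]]
      show ?thesis by simp
    qed
    have n: "norm (- (w - z) * ((1 / (w - complex_of_real x)) * (1 / (z - complex_of_real x)) * (1 / (z - complex_of_real x))))
        \<le> norm (w - z) * (2 / Im z ^ 3)" for x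
    proof -
      have "norm (1 / (w - complex_of_real x)) \<le> 2 / Im z"
      proof (rule order_trans[OF norm_cauchy_kernel_le[OF w0]])
        have "1 / Im w \<le> 1 / (Im z / 2)" using w z by (intro frac_le) auto
        then show "1 / Im w \<le> 2 / Im z" by simp
      qed
      then have "norm ((1 / (w - complex_of_real x)) * (1 / (z - complex_of_real x)) * (1 / (z - complex_of_real x)))
          \<le> 2 / Im z * (1 / Im z) * (1 / Im z)"
        unfolding norm_mult using z by (intro mult_mono norm_cauchy_kernel_le) auto
      then show ?thesis unfolding norm_mult[of "- (w - z)"] norm_minus_cancel
        by (intro mult_left_mono) (auto simp: power3_eq_cube)
    qed
    have i: "integrable M (\<lambda>x. (- (w - z) * ((1 / (w - complex_of_real x)) * (1 / (z - complex_of_real x)) * (1 / (z - complex_of_real x)))))"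
      unfolding k[symmetric] by (intro Bochner_Integration.integrable_diff integrable_cauchy_kernel_mult w0 z)
    have "J w - J z = (\<integral>x. (- (w - z) * ((1 / (w - complex_of_real x)) * (1 / (z - complex_of_real x)) * (1 / (z - complex_of_real x)))) \<partial>M)"
      unfolding J_def k[symmetric]
      by (rule Bochner_Integration.integral_diff[symmetric]) (intro integrable_cauchy_kernel_mult w0 z)+
    then have "norm (J w - J z) \<le> (\<integral>x. norm (- (w - z) * ((1 / (w - complex_of_real x)) * (1 / (z - complex_of_real x)) * (1 / (z - complex_of_real x)))) \<partial>M)"
      by (simp only: integral_norm_bound)
    also have "\<dots> \<le> (\<integral>x. norm (w - z) * (2 / Im z ^ 3) \<partial>M)"
      by (intro integral_mono integrable_norm i n) auto
    finally show ?thesis using prob_space by simp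
  qed
  have "((\<lambda>w. J w - J z) \<longlongrightarrow> 0) (at z)"
  proof (rule Lim_null_comparison)
    show "\<forall>\<^sub>F w in at z. norm (J w - J z) \<le> norm (w - z) * (2 / Im z ^ 3)"
      using near by eventually_elim (rule Jd)
    have "((\<lambda>w. norm (w - z) * (2 / Im z ^ 3)) \<longlongrightarrow> norm (z - z) * (2 / Im z ^ 3)) (at z)"
      by (intro tendsto_intros)
    then show "((\<lambda>w. norm (w - z) * (2 / Im z ^ 3)) \<longlongrightarrow> 0) (at z)" by simp
  qed
  then have "(J \<longlongrightarrow> J z) (at z)" by (rule LIM_zero_cancel)
  then have "((\<lambda>w. - J w) \<longlongrightarrow> - J z) (at z)" by (rule tendsto_minus)
  moreover have "\<forall>\<^sub>F w in at z. - J w = (cauchy_transform M w - cauchy_transform M z) / (w - z)"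
    using near eventually_neq_at_within[of z z UNIV]
  proof eventually_elim
    fix w assume "Im z / 2 < Im w" "w \<noteq> z"
    then show "- J w = (cauchy_transform M w - cauchy_transform M z) / (w - z)"
      using cauchy_transform_diff[of w z] z by (simp add: J_def)
  qed
  ultimately have "((\<lambda>w. (cauchy_transform M w - cauchy_transform M z) / (w - z)) \<longlongrightarrow> - J z) (at z)"
    by (rule Lim_transform_eventually)
  then show ?thesis unfolding has_field_derivative_iff J_def .
qed

lemma holomorphic_cauchy_transform: "cauchy_transform M holomorphic_on {z. Im z > 0}"
  unfolding holomorphic_on_def field_differentiable_def
  using cauchy_transform_has_field_derivative has_field_derivative_at_within by blast

lemma Im_cauchy_transform_nonpos: "Im z > 0 \<Longrightarrow> Im (cauchy_transform M z) \<le> 0"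
  by (subst Im_cauchy_transform(1)) (auto intro!: integral_nonneg_AE AE_I2 simp: add_nonneg_nonneg)

lemma norm_cauchy_kernel_sq:
  "norm (1 / (w - complex_of_real x)) ^ 2 = 1 / ((Re w - x)\<^sup>2 + (Im w)\<^sup>2)"
  by (simp add: norm_divide power_divide cmod_power2)

text \<open>Since Im G(w) is - Im w times the integral of the squared kernel, positivity of the
  shifted imaginary part says precisely that \<open>s\<close> times this integral is below
  1.\<close>

lemma semicircle_shift_bound:
  assumes w: "Im w > 0" and H: "Im (w + of_real s * cauchy_transform M w) > 0"
  shows "integrable M (\<lambda>x. norm (1 / (w - complex_of_real x)) ^ 2)"
    and "s * (\<integral>x. norm (1 / (w - complex_of_real x)) ^ 2 \<partial>M) < 1"
proof -
  have k: "Im w / ((Re w - x)\<^sup>2 + (Im w)\<^sup>2) = Im w * norm (1 / (w - complex_of_real x)) ^ 2" for x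
    unfolding norm_cauchy_kernel_sq by simp
  have "integrable M (\<lambda>x. Im w * norm (1 / (w - complex_of_real x)) ^ 2)"
    using Im_cauchy_transform(2)[OF w] unfolding k .
  then show "integrable M (\<lambda>x. norm (1 / (w - complex_of_real x)) ^ 2)"
    using integrable_mult_left_iff[of M "Im w"] w by simp
  have "Im (cauchy_transform M w) = - (Im w * (\<integral>x. norm (1 / (w - complex_of_real x)) ^ 2 \<partial>M))"
    unfolding Im_cauchy_transform(1)[OF w] k integral_mult_right_zero ..
  then have "0 < Im w * (1 - s * (\<integral>x. norm (1 / (w - complex_of_real x)) ^ 2 \<partial>M))"
    using H by (simp add: algebra_simps)
  then show "s * (\<integral>x. norm (1 / (w - complex_of_real x)) ^ 2 \<partial>M) < 1"
    using w by (simp add: zero_less_mult_iff)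
qed

text \<open>Two different preimages of one point would give s J = 1 for the mixed integral J of the
  two kernels. The inequality between geometric and arithmetic means bounds |J| by the average of
  the two squared integrals, and by \<open>semicircle_shift_bound\<close> this makes s |J| <
  1.\<close>

lemma semicircle_shift_inject:
  assumes s: "s \<ge> 0" and w: "Im w > 0" "Im (w + of_real s * cauchy_transform M w) > 0"
    and v: "Im v > 0" "Im (v + of_real s * cauchy_transform M v) > 0"
    and eq: "w + of_real s * cauchy_transform M w = v + of_real s * cauchy_transform M v"
  shows "w = v"
proof (rule ccontr)
  assume ne: "w \<noteq> v"
  let ?J = "\<integral>x. (1 / (w - complex_of_real x)) * (1 / (v - complex_of_real x)) \<partial>M"
  let ?K = "\<lambda>w. \<integral>x. norm (1 / (w - complex_of_real x)) ^ 2 \<partial>M"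
  have "w - v = - (of_real s * (cauchy_transform M w - cauchy_transform M v))"
    using eq by (simp add: algebra_simps)
  also have "\<dots> = (w - v) * (of_real s * ?J)" unfolding cauchy_transform_diff[OF w(1) v(1)] by simp
  finally have "of_real s * ?J = 1" using ne by simp
  then have sJ: "s * norm ?J = 1" using s by (metis norm_mult norm_of_real norm_one abs_of_nonneg)
  note i = semicircle_shift_bound(1)[OF w] semicircle_shift_bound(1)[OF v]
  have "norm ?J \<le> (\<integral>x. norm ((1 / (w - complex_of_real x)) * (1 / (v - complex_of_real x))) \<partial>M)"
    by (rule integral_norm_bound)
  also have "\<dots> \<le> (\<integral>x. (norm (1 / (w - complex_of_real x)) ^ 2 + norm (1 / (v - complex_of_real x)) ^ 2) / 2 \<partial>M)"
  proof (intro integral_mono integrable_norm integrable_cauchy_kernel_mult w v integrable_divide_zero Bochner_Integration.integrable_add i)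
    fix x
    show "norm ((1 / (w - complex_of_real x)) * (1 / (v - complex_of_real x)))
      \<le> (norm (1 / (w - complex_of_real x)) ^ 2 + norm (1 / (v - complex_of_real x)) ^ 2) / 2"
      unfolding norm_mult
      using sum_squares_bound[of "norm (1 / (w - complex_of_real x))" "norm (1 / (v - complex_of_real x))"] by simp
  qed
  also have "\<dots> = (?K w + ?K v) / 2"
    unfolding integral_divide_zero Bochner_Integration.integral_add[OF i] ..
  finally have "s * norm ?J \<le> s * ((?K w + ?K v) / 2)" using s by (rule mult_left_mono)
  also have "\<dots> < 1"
    using semicircle_shift_bound(2)[OF w] semicircle_shift_bound(2)[OF v] by (simp add: ring_distribs)
  finally show False using sJ by simp
qed

text \<open>A preimage of \<open>z\<close> is a fixed point of w -> z - s G(w). This map preserves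
  the half plane above \<open>z\<close> because Im G is not positive, and the ball of radius
  \<open>s / Im z\<close> because |G| is at most 1 / Im z there; Brouwer applies to the
  intersection.\<close>

lemma semicircle_shift_surj:
  assumes s: "s \<ge> 0" and z: "Im z > 0"
  obtains w where "Im w \<ge> Im z" "w + of_real s * cauchy_transform M w = z"
proof -
  let ?S = "cball z (s / Im z) \<inter> {w. Im w \<ge> Im z}"
  obtain w where w: "w \<in> ?S" "z - of_real s * cauchy_transform M w = w"
  proof (rule brouwer[of ?S "\<lambda>w. z - of_real s * cauchy_transform M w"])
    show "compact ?S" by (intro compact_Int_closed compact_cball closed_halfspace_Im_ge)
    show "convex ?S" by (intro convex_Int convex_cball convex_halfspace_Im_ge)
    have "z \<in> ?S" using s z by simp
    then show "?S \<noteq> {}" by blast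
    have "continuous_on {z. Im z > 0} (cauchy_transform M)"
      by (rule holomorphic_on_imp_continuous_on[OF holomorphic_cauchy_transform])
    then have "continuous_on ?S (cauchy_transform M)"
      by (rule continuous_on_subset) (use z in auto)
    then show "continuous_on ?S (\<lambda>w. z - of_real s * cauchy_transform M w)"
      by (intro continuous_intros)
    show "(\<lambda>w. z - of_real s * cauchy_transform M w) \<in> ?S \<rightarrow> ?S"
    proof
      fix w assume "w \<in> ?S"
      then have w: "Im w \<ge> Im z" "Im w > 0" using z by auto
      have "norm (cauchy_transform M w) \<le> 1 / Im z"
        by (rule order_trans[OF norm_cauchy_transform_le[OF w(2)]]) (use w z in \<open>intro frac_le, auto\<close>)
      then have "s * norm (cauchy_transform M w) \<le> s * (1 / Im z)" using s by (rule mult_left_mono)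
      moreover have "0 \<le> s * (- Im (cauchy_transform M w))"
        using s Im_cauchy_transform_nonpos[OF w(2)] by (intro mult_nonneg_nonneg) auto
      ultimately show "z - of_real s * cauchy_transform M w \<in> ?S"
        using s by (simp add: dist_norm norm_mult)
    qed
  qed
  have "w + of_real s * cauchy_transform M w = z" using w(2) by (metis diff_add_cancel)
  moreover have "Im w \<ge> Im z" using w(1) by simp
  ultimately show thesis using that by blast
qed

text \<open>On the part \<Omega> of the half plane that H sends into the upper half plane, H is
  injective, and it maps \<Omega> onto the whole upper half plane. The inverse of an injective
  holomorphic map is holomorphic.\<close>

lemma subordination:
  assumes s: "s \<ge> 0"
  obtains \<omega> where "\<omega> holomorphic_on {z. Im z > 0}" "\<And>z. Im z > 0 \<Longrightarrow> Im (\<omega> z) \<ge> Im z"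
    "\<And>z. Im z > 0 \<Longrightarrow> \<omega> z + of_real s * cauchy_transform M (\<omega> z) = z"
    "\<And>w. Im w > 0 \<Longrightarrow> Im (w + of_real s * cauchy_transform M w) > 0 \<Longrightarrow> \<omega> (w + of_real s * cauchy_transform M w) = w"
proof -
  define H where "H w = w + of_real s * cauchy_transform M w" for w
  define \<Omega> where "\<Omega> = {w. Im w > 0} \<inter> H -` {z. Im z > 0}"
  have hH: "H holomorphic_on {w. Im w > 0}"
    unfolding H_def by (intro holomorphic_intros holomorphic_cauchy_transform)
  have op: "open \<Omega>" unfolding \<Omega>_def
    by (rule continuous_open_preimage[OF holomorphic_on_imp_continuous_on[OF hH]]) (rule open_halfspace_Im_gt)+
  have inj: "inj_on H \<Omega>"
    using semicircle_shift_inject[OF s] by (intro inj_onI) (auto simp: \<Omega>_def H_def)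
  have im: "H ` \<Omega> = {z. Im z > 0}"
  proof
    show "{z. Im z > 0} \<subseteq> H ` \<Omega>"
    proof
      fix z assume z: "z \<in> {z. Im z > 0}"
      obtain w where "Im w \<ge> Im z" "w + of_real s * cauchy_transform M w = z"
        using semicircle_shift_surj[OF s, of z] z by auto
      then have "H w = z" "w \<in> \<Omega>" using z by (auto simp: \<Omega>_def H_def)
      then show "z \<in> H ` \<Omega>" by auto
    qed
  qed (auto simp: \<Omega>_def)
  have "H holomorphic_on \<Omega>" by (rule holomorphic_on_subset[OF hH]) (auto simp: \<Omega>_def)
  then obtain \<omega> where \<omega>: "\<omega> holomorphic_on (H ` \<Omega>)" "\<And>w. w \<in> \<Omega> \<Longrightarrow> \<omega> (H w) = w"
    using holomorphic_has_inverse[OF _ op inj] by metis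
  show thesis
  proof (rule that)
    show "\<omega> holomorphic_on {z. Im z > 0}" using \<omega>(1) unfolding im .
    fix z assume z: "Im z > 0"
    obtain w where w: "Im w \<ge> Im z" "H w = z"
      using semicircle_shift_surj[OF s z] unfolding H_def by metis
    then have "w \<in> \<Omega>" using z by (auto simp: \<Omega>_def)
    then have "\<omega> z = w" using \<omega>(2) w by auto
    then show "Im (\<omega> z) \<ge> Im z" "\<omega> z + of_real s * cauchy_transform M (\<omega> z) = z"
      using w by (simp_all add: H_def)
  next
    fix w assume "Im w > 0" "Im (w + of_real s * cauchy_transform M w) > 0"
    then show "\<omega> (w + of_real s * cauchy_transform M w) = w" using \<omega>(2)[of w] by (simp add: \<Omega>_def H_def)
  qed
qed

section \<open>The perturbed law from the subordination function\<close>

lemma mult_cauchy_transform: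
  assumes i: "integrable M (\<lambda>x. x)" and w: "Im w > 0"
  shows "norm (w * cauchy_transform M w - 1) \<le> (\<integral>x. \<bar>x\<bar> \<partial>M) / Im w"
    and "integrable M (\<lambda>x. complex_of_real x / (w - complex_of_real x))"
    and "w * cauchy_transform M w - 1 = (\<integral>x. complex_of_real x / (w - complex_of_real x) \<partial>M)"
proof -
  have k: "w * (1 / (w - complex_of_real x)) - 1 = complex_of_real x / (w - complex_of_real x)" for x
    using cauchy_kernel_nonzero[OF w, of x] by (simp add: field_simps)
  have ik: "integrable M (\<lambda>x. w * (1 / (w - complex_of_real x)))"
    by (intro integrable_mult_right integrable_cauchy_kernel w)
  show ii: "integrable M (\<lambda>x. complex_of_real x / (w - complex_of_real x))"
    unfolding k[symmetric] by (intro Bochner_Integration.integrable_diff ik) simp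
  show eq: "w * cauchy_transform M w - 1 = (\<integral>x. complex_of_real x / (w - complex_of_real x) \<partial>M)"
    unfolding k[symmetric] cauchy_transform_def integral_mult_right_zero[symmetric]
    by (subst Bochner_Integration.integral_diff[OF ik]) (use prob_space in simp_all)
  have "norm (\<integral>x. complex_of_real x / (w - complex_of_real x) \<partial>M)
      \<le> (\<integral>x. norm (complex_of_real x / (w - complex_of_real x)) \<partial>M)" by (rule integral_norm_bound)
  also have "\<dots> \<le> (\<integral>x. \<bar>x\<bar> / Im w \<partial>M)"
  proof (intro integral_mono integrable_norm ii integrable_divide_zero integrable_abs i)
    fix x
    have "norm (complex_of_real x / (w - complex_of_real x)) = \<bar>x\<bar> * norm (1 / (w - complex_of_real x))"
      by (simp add: norm_divide)
    also have "\<dots> \<le> \<bar>x\<bar> * (1 / Im w)" by (intro mult_left_mono norm_cauchy_kernel_le w) simp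
    finally show "norm (complex_of_real x / (w - complex_of_real x)) \<le> \<bar>x\<bar> / Im w" by simp
  qed
  also have "\<dots> = (\<integral>x. \<bar>x\<bar> \<partial>M) / Im w" by (rule integral_divide_zero)
  finally show "norm (w * cauchy_transform M w - 1) \<le> (\<integral>x. \<bar>x\<bar> \<partial>M) / Im w" unfolding eq .
qed

text \<open>The composite of G and \<omega> meets the hypotheses of \<open>nevanlinna\<close>:
  \<omega> raises imaginary parts and moves \<open>z\<close> by at most \<open>s / Im z\<close>. So
  the decay of G, known to first order from the first absolute moment, carries over to the
  composite.\<close>

theorem semicircular_perturbation:
  assumes s: "s \<ge> 0" and i: "integrable M (\<lambda>x. x)"
  obtains \<rho> where "real_distribution \<rho>"
    "\<And>w. Im w > 0 \<Longrightarrow> Im (w + of_real s * cauchy_transform M w) > 0 \<Longrightarrow>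
       cauchy_transform \<rho> (w + of_real s * cauchy_transform M w) = cauchy_transform M w"
proof -
  obtain \<omega> where \<omega>: "\<omega> holomorphic_on {z. Im z > 0}" "\<And>z. Im z > 0 \<Longrightarrow> Im (\<omega> z) \<ge> Im z"
    "\<And>z. Im z > 0 \<Longrightarrow> \<omega> z + of_real s * cauchy_transform M (\<omega> z) = z"
    "\<And>w. Im w > 0 \<Longrightarrow> Im (w + of_real s * cauchy_transform M w) > 0 \<Longrightarrow> \<omega> (w + of_real s * cauchy_transform M w) = w"
    using subordination[OF s] by metis
  define g where "g z = cauchy_transform M (\<omega> z)" for z
  define A where "A = (\<integral>x. \<bar>x\<bar> \<partial>M)"
  have A: "A \<ge> 0" by (simp add: A_def)
  have pos: "Im (\<omega> z) > 0" if "Im z > 0" for z using \<omega>(2)[OF that] that by simp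
  have gn: "norm (g z) \<le> 1 / Im z" if "Im z > 0" for z
    unfolding g_def
    by (rule order_trans[OF norm_cauchy_transform_le[OF pos[OF that]]]) (use \<omega>(2)[OF that] that in \<open>intro frac_le, auto\<close>)
  have \<omega>z: "norm (z - \<omega> z) \<le> s / Im z" if "Im z > 0" for z
  proof -
    have "z - \<omega> z = of_real s * g z" using \<omega>(3)[OF that] by (simp add: g_def algebra_simps)
    then have "norm (z - \<omega> z) = s * norm (g z)" using s by (simp add: norm_mult)
    also have "\<dots> \<le> s * (1 / Im z)" by (rule mult_left_mono[OF gn[OF that] s])
    finally show ?thesis by simp
  qed
  have \<omega>g: "norm (\<omega> z * g z - 1) \<le> A / Im z" if "Im z > 0" for z
  proof -
    have "norm (\<omega> z * g z - 1) \<le> A / Im (\<omega> z)" unfolding g_def A_def by (rule mult_cauchy_transform(1)[OF i pos[OF that]])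
    also have "\<dots> \<le> A / Im z" using \<omega>(2)[OF that] that A by (intro divide_left_mono) auto
    finally show ?thesis .
  qed
  obtain \<rho> where \<rho>: "real_distribution \<rho>" "\<And>z. Im z > 0 \<Longrightarrow> cauchy_transform \<rho> z = g z"
  proof (rule nevanlinna[of g])
    show "g holomorphic_on {z. Im z > 0}"
    proof -
      have "cauchy_transform M \<circ> \<omega> holomorphic_on {z. Im z > 0}"
        by (rule holomorphic_on_compose_gen[OF \<omega>(1) holomorphic_cauchy_transform]) (use pos in auto)
      then show ?thesis by (simp add: g_def[abs_def] o_def)
    qed
    show "Im (g z) \<le> 0" if "Im z > 0" for z unfolding g_def by (rule Im_cauchy_transform_nonpos[OF pos[OF that]])
    show "\<exists>C. \<forall>z. Im z \<ge> e \<longrightarrow> norm (g z) \<le> C / (1 + norm z)" if e: "e > 0" for e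
    proof (intro exI allI impI)
      fix z assume ze: "Im z \<ge> e"
      then have z: "Im z > 0" using e by simp
      have ge: "norm (g z) \<le> 1 / e"
        by (rule order_trans[OF gn[OF z]]) (use ze e in \<open>intro frac_le, auto\<close>)
      have "norm (z - \<omega> z) \<le> s / e"
        by (rule order_trans[OF \<omega>z[OF z]]) (use ze e s in \<open>intro divide_left_mono mult_pos_pos, auto\<close>)
      then have "norm z \<le> s / e + norm (\<omega> z)" using norm_triangle_ineq2[of z "\<omega> z"] by linarith
      then have "(1 + norm z) * norm (g z) \<le> (1 + s / e + norm (\<omega> z)) * norm (g z)"
        by (intro mult_right_mono) auto
      also have "\<dots> = (1 + s / e) * norm (g z) + norm (\<omega> z * g z)" by (simp add: norm_mult algebra_simps)
      also have "\<dots> \<le> (1 + s / e) * (1 / e) + (1 + A / e)"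
      proof (intro add_mono mult_left_mono)
        show "norm (g z) \<le> 1 / e" by (rule ge)
        have "norm (\<omega> z * g z - 1) \<le> A / e"
          by (rule order_trans[OF \<omega>g[OF z]]) (use ze e A in \<open>intro divide_left_mono mult_pos_pos, auto\<close>)
        then show "norm (\<omega> z * g z) \<le> 1 + A / e" using norm_triangle_ineq2[of "\<omega> z * g z" 1] by simp
      qed (use s e in auto)
      finally show "norm (g z) \<le> ((1 + s / e) * (1 / e) + (1 + A / e)) / (1 + norm z)"
        by (simp add: pos_le_divide_eq add_pos_nonneg mult.commute)
    qed
    have "((\<lambda>y. \<i> * complex_of_real y * g (\<i> * complex_of_real y) - 1) \<longlongrightarrow> 0) at_top"
    proof (rule Lim_null_comparison)
      show "\<forall>\<^sub>F y in at_top. norm (\<i> * complex_of_real y * g (\<i> * complex_of_real y) - 1) \<le> A / y + s / y * (1 / y)"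
        using eventually_gt_at_top[of 0]
      proof eventually_elim
        fix y :: real assume y: "y > 0"
        let ?z = "\<i> * complex_of_real y"
        have z: "Im ?z > 0" "Im ?z = y" using y by auto
        have "?z * g ?z - 1 = (\<omega> ?z * g ?z - 1) + (?z - \<omega> ?z) * g ?z" by (simp add: algebra_simps)
        also have "norm \<dots> \<le> norm (\<omega> ?z * g ?z - 1) + norm ((?z - \<omega> ?z) * g ?z)" by (rule norm_triangle_ineq)
        also have "\<dots> \<le> A / y + s / y * (1 / y)"
          unfolding norm_mult[of "?z - \<omega> ?z"]
          using \<omega>g[OF z(1)] \<omega>z[OF z(1)] gn[OF z(1)] s y unfolding z(2) by (intro add_mono mult_mono) auto
        finally show "norm (?z * g ?z - 1) \<le> A / y + s / y * (1 / y)" .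
      qed
      show "((\<lambda>y. A / y + s / y * (1 / y)) \<longlongrightarrow> 0) at_top" by real_asymp
    qed
    then show "((\<lambda>y. \<i> * complex_of_real y * g (\<i> * complex_of_real y)) \<longlongrightarrow> 1) at_top"
      by (rule LIM_zero_cancel)
  qed blast
  show thesis
    by (rule that[OF \<rho>(1)]) (simp add: \<rho>(2) \<omega>(4) g_def)
qed

end

section \<open>Voiculescu transforms and uniqueness of the convolution\<close>

context real_distribution
begin

section \<open>Inverting the reciprocal Cauchy transform near infinity\<close>

lemma integrable_square_imp_integrable:
  assumes "integrable M (\<lambda>x. x\<^sup>2)"
  shows "integrable M (\<lambda>x. x)"
proof (rule Bochner_Integration.integrable_bound)
  show "integrable M (\<lambda>x. 1 + x\<^sup>2)" using assms by simp
  show "AE x in M. norm x \<le> norm (1 + x\<^sup>2)"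
  proof (rule AE_I2)
    fix x :: real
    have "0 \<le> (\<bar>x\<bar> - 1)\<^sup>2" by simp
    then have "2 * \<bar>x\<bar> \<le> 1 + x\<^sup>2" by (simp add: power2_diff)
    then show "norm x \<le> norm (1 + x\<^sup>2)" by simp
  qed
qed (simp add: borel_measurable_continuous)

text \<open>If G(w) = G(v) with distinct points, the integral of the product k of the kernels
  vanishes. But w v k - 1 equals a + b + a b with a = x / (w - x) and b = x / (v - x), whose
  integral is small high up, so the integral of w v k could not be 0.\<close>

lemma cauchy_transform_inject_far:
  assumes sq: "integrable M (\<lambda>x. x\<^sup>2)"
    and w: "Im w > 2 * (1 + (\<integral>x. \<bar>x\<bar> \<partial>M) + (\<integral>x. x\<^sup>2 \<partial>M))"
    and v: "Im v > 2 * (1 + (\<integral>x. \<bar>x\<bar> \<partial>M) + (\<integral>x. x\<^sup>2 \<partial>M))"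
    and eq: "cauchy_transform M w = cauchy_transform M v"
  shows "w = v"
proof (rule ccontr)
  assume ne: "w \<noteq> v"
  define A where "A = (\<integral>x. \<bar>x\<bar> \<partial>M)"
  define V where "V = (\<integral>x. x\<^sup>2 \<partial>M)"
  note i = integrable_square_imp_integrable[OF sq]
  have AV: "A \<ge> 0" "V \<ge> 0" by (simp_all add: A_def V_def)
  have w2: "Im w > 2 * (1 + A + V)" and v2: "Im v > 2 * (1 + A + V)"
    using w v by (simp_all add: A_def V_def)
  then have w0: "Im w > 0" "Im w > 2 * (1 + A + V)" and v0: "Im v > 0" "Im v > 2 * (1 + A + V)"
    using AV by auto
  let ?k = "\<lambda>x. (1 / (w - complex_of_real x)) * (1 / (v - complex_of_real x))"
  have "(w - v) * (\<integral>x. ?k x \<partial>M) = 0" using cauchy_transform_diff[OF w0(1) v0(1)] eq by simp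
  then have J: "(\<integral>x. ?k x \<partial>M) = 0" using ne by simp
  have ik: "integrable M (\<lambda>x. w * v * ?k x)" by (intro integrable_mult_right integrable_cauchy_kernel_mult w0 v0)
  have id: "integrable M (\<lambda>x. w * v * ?k x - 1)" by (intro Bochner_Integration.integrable_diff ik) simp
  have "(\<integral>x. w * v * ?k x - 1 \<partial>M) = w * v * (\<integral>x. ?k x \<partial>M) - (\<integral>x. 1 \<partial>M)"
    by (subst Bochner_Integration.integral_diff[OF ik]) (simp_all only: integral_mult_right_zero integrable_const)
  then have "(\<integral>x. w * v * ?k x - 1 \<partial>M) = -1" using J prob_space by simp
  then have "1 = norm (\<integral>x. w * v * ?k x - 1 \<partial>M)" by simp
  also have "\<dots> \<le> (\<integral>x. norm (w * v * ?k x - 1) \<partial>M)" by (rule integral_norm_bound)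
  also have "\<dots> \<le> (\<integral>x. \<bar>x\<bar> * (1 / Im w) + \<bar>x\<bar> * (1 / Im v) + x\<^sup>2 * (1 / Im w * (1 / Im v)) \<partial>M)"
  proof (intro integral_mono integrable_norm id Bochner_Integration.integrable_add integrable_mult_left integrable_abs i sq)
    fix x
    let ?a = "complex_of_real x * (1 / (w - complex_of_real x))" and ?b = "complex_of_real x * (1 / (v - complex_of_real x))"
    have na: "norm ?a \<le> \<bar>x\<bar> * (1 / Im w)" "norm ?b \<le> \<bar>x\<bar> * (1 / Im v)"
      unfolding norm_mult norm_of_real by (intro mult_left_mono norm_cauchy_kernel_le w0 v0, simp)+
    have "w * (1 / (w - complex_of_real x)) = 1 + ?a" "v * (1 / (v - complex_of_real x)) = 1 + ?b"
      using cauchy_kernel_nonzero[OF w0(1), of x] cauchy_kernel_nonzero[OF v0(1), of x] by (simp_all add: field_simps)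
    moreover have "w * v * ?k x = (w * (1 / (w - complex_of_real x))) * (v * (1 / (v - complex_of_real x)))"
      by (simp only: mult_ac)
    ultimately have "w * v * ?k x - 1 = ?a + ?b + ?a * ?b" by (simp only:) (simp only: ring_distribs mult_1 mult_1_right add_diff_cancel_left' add.assoc)
    moreover have "norm (a + b + a * b) \<le> norm a + norm b + norm a * norm b" for a b :: complex
      using norm_triangle_ineq[of "a + b" "a * b"] norm_triangle_ineq[of a b] by (simp add: norm_mult)
    ultimately have "norm (w * v * ?k x - 1) \<le> norm ?a + norm ?b + norm ?a * norm ?b" by (simp only:)
    also have "\<dots> \<le> \<bar>x\<bar> * (1 / Im w) + \<bar>x\<bar> * (1 / Im v) + \<bar>x\<bar> * (1 / Im w) * (\<bar>x\<bar> * (1 / Im v))"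
      using w0 v0 by (intro add_mono mult_mono na) auto
    also have "\<bar>x\<bar> * (1 / Im w) * (\<bar>x\<bar> * (1 / Im v)) = x\<^sup>2 * (1 / Im w * (1 / Im v))"
      by (simp add: power2_eq_square)
    finally show "norm (w * v * ?k x - 1) \<le> \<bar>x\<bar> * (1 / Im w) + \<bar>x\<bar> * (1 / Im v) + x\<^sup>2 * (1 / Im w * (1 / Im v))" .
  qed
  also have "\<dots> = A * (1 / Im w) + A * (1 / Im v) + V * (1 / Im w * (1 / Im v))"
    unfolding A_def V_def
    by (subst Bochner_Integration.integral_add, (intro Bochner_Integration.integrable_add integrable_mult_left integrable_abs i sq)+)+
      (simp only: integral_mult_left_zero)
  also have "\<dots> < 1"
  proof -
    \<comment> \<open>The reciprocal of the assumed height. The estimate becomes (2 A + V) / (2 (1 +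
      A + V)), which is below 1.\<close>
    define c where "c = 1 / (2 * (1 + A + V))"
    have c: "1 / Im w \<le> c" "1 / Im v \<le> c" "1 / Im v \<le> 1" "c \<ge> 0"
      using w0 v0 AV by (auto intro!: frac_le simp: c_def divide_le_eq)
    have "1 / Im w * (1 / Im v) \<le> c * 1" using c w0 v0 by (intro mult_mono) auto
    then have "V * (1 / Im w * (1 / Im v)) \<le> V * (c * 1)" by (rule mult_left_mono[OF _ AV(2)])
    moreover have "A * (1 / Im w) \<le> A * c" by (rule mult_left_mono[OF c(1) AV(1)])
    moreover have "A * (1 / Im v) \<le> A * c" by (rule mult_left_mono[OF c(2) AV(1)])
    moreover have "2 * (A * c) + V * c < 1"
    proof -
      have "2 * (A * c) + V * c = (2 * A + V) / (2 * (1 + A + V))" by (simp add: c_def add_divide_distrib)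
      also have "\<dots> < 1" using AV by (subst divide_less_eq_1_pos) auto
      finally show ?thesis .
    qed
    ultimately show ?thesis unfolding mult_1_right by linarith
  qed
  finally show False by simp
qed

text \<open>For F = 1/G one has w - F w = w (w G - 1) / (w G). With mean zero the numerator is the
  integral of x^2 / (w - x), at most 1/2 high up, and the denominator is at least 1/2 in modulus; so
  F moves points by at most 1. Brouwer on the unit ball around \<open>z\<close>, for w -> z + (w - F
  w), solves F w = z, and injectivity makes the solution holomorphic in \<open>z\<close>.\<close>

lemma far_inverse:
  assumes sq: "integrable M (\<lambda>x. x\<^sup>2)" and mean: "(\<integral>x. x \<partial>M) = 0"
  obtains \<beta> \<phi> where "\<beta> > 0" "\<phi> holomorphic_on {z. Im z > \<beta>}"
    "\<And>z. Im z > \<beta> \<Longrightarrow> Im (z + \<phi> z) > 0" "\<And>z. Im z > \<beta> \<Longrightarrow> 1 / cauchy_transform M (z + \<phi> z) = z"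
    "\<And>z. Im z > \<beta> \<Longrightarrow> norm (\<phi> z) \<le> 1"
proof -
  define A where "A = (\<integral>x. \<bar>x\<bar> \<partial>M)"
  define V where "V = (\<integral>x. x\<^sup>2 \<partial>M)"
  define c where "c = 2 * (1 + A + V)"
  note i = integrable_square_imp_integrable[OF sq]
  have AV: "A \<ge> 0" "V \<ge> 0" by (simp_all add: A_def V_def)
  have c: "c \<ge> 2 * A" "c \<ge> 2 * V" "c > 1" using AV by (auto simp: c_def)
  define U where "U = {w. Im w > c}"
  define F where "F w = 1 / cauchy_transform M w" for w
  have w0: "Im w > 0" if "w \<in> U" for w using that c by (simp add: U_def)
  have half: "norm (w * cauchy_transform M w) \<ge> 1 / 2" if w: "w \<in> U" for w
  proof -
    have "norm (w * cauchy_transform M w - 1) \<le> A / Im w"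
      unfolding A_def by (rule mult_cauchy_transform(1)[OF i w0[OF w]])
    also have "\<dots> \<le> 1 / 2" using w c w0[OF w] by (simp add: U_def divide_le_eq)
    finally show ?thesis using norm_triangle_ineq3[of "w * cauchy_transform M w" 1] by simp
  qed
  have G0: "cauchy_transform M w \<noteq> 0" if "w \<in> U" for w using half[OF that] by auto
  have near: "norm (w - F w) \<le> 1" if w: "w \<in> U" for w
  proof -
    have k: "w * (complex_of_real x / (w - complex_of_real x)) = complex_of_real x + complex_of_real (x\<^sup>2) * (1 / (w - complex_of_real x))" for x
      using cauchy_kernel_nonzero[OF w0[OF w], of x] by (simp add: field_simps power2_eq_square)
    have i1: "integrable M (\<lambda>x. w * (complex_of_real x / (w - complex_of_real x)))"
      by (intro integrable_mult_right mult_cauchy_transform(2) i w0 w)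
    have i0: "integrable M (\<lambda>x. complex_of_real x)" by (intro integrable_of_real i)
    have i2: "integrable M (\<lambda>x. complex_of_real (x\<^sup>2) * (1 / (w - complex_of_real x)))"
      using Bochner_Integration.integrable_diff[OF i1 i0] unfolding k by simp
    have "w * (w * cauchy_transform M w - 1) = (\<integral>x. w * (complex_of_real x / (w - complex_of_real x)) \<partial>M)"
      unfolding mult_cauchy_transform(3)[OF i w0[OF w]] by (rule integral_mult_right_zero[symmetric])
    also have "\<dots> = (\<integral>x. complex_of_real x \<partial>M) + (\<integral>x. complex_of_real (x\<^sup>2) * (1 / (w - complex_of_real x)) \<partial>M)"
      unfolding k by (rule Bochner_Integration.integral_add[OF i0 i2])
    also have "(\<integral>x. complex_of_real x \<partial>M) = 0" unfolding integral_complex_of_real mean by simp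
    finally have e: "w * (w * cauchy_transform M w - 1) = (\<integral>x. complex_of_real (x\<^sup>2) * (1 / (w - complex_of_real x)) \<partial>M)" by simp
    have "norm (w * (w * cauchy_transform M w - 1)) \<le> (\<integral>x. norm (complex_of_real (x\<^sup>2) * (1 / (w - complex_of_real x))) \<partial>M)"
      unfolding e by (rule integral_norm_bound)
    also have "\<dots> \<le> (\<integral>x. x\<^sup>2 * (1 / Im w) \<partial>M)"
    proof (intro integral_mono integrable_norm i2 integrable_mult_left sq)
      fix x show "norm (complex_of_real (x\<^sup>2) * (1 / (w - complex_of_real x))) \<le> x\<^sup>2 * (1 / Im w)"
        unfolding norm_mult norm_of_real abs_power2 by (intro mult_left_mono norm_cauchy_kernel_le w0 w) simp
    qed
    also have "\<dots> = V * (1 / Im w)" unfolding V_def by (rule integral_mult_left_zero)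
    also have "\<dots> \<le> 1 / 2" using w c w0[OF w] by (simp add: U_def divide_le_eq)
    finally have n: "norm (w * (w * cauchy_transform M w - 1)) \<le> 1 / 2" .
    have "w \<noteq> 0" using w0[OF w] by auto
    then have "w - F w = w * (w * cauchy_transform M w - 1) / (w * cauchy_transform M w)"
      using G0[OF w] by (simp add: F_def field_simps)
    then have "norm (w - F w) = norm (w * (w * cauchy_transform M w - 1)) / norm (w * cauchy_transform M w)"
      by (simp only: norm_divide)
    also have "\<dots> \<le> (1 / 2) / (1 / 2)" by (rule frac_le[OF _ n _ half[OF w]]) auto
    finally show ?thesis by simp
  qed
  have "open U" unfolding U_def by (rule open_halfspace_Im_gt)
  have holF: "F holomorphic_on U" unfolding F_def
    by (intro holomorphic_intros holomorphic_on_subset[OF holomorphic_cauchy_transform]) (use w0 G0 in auto)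
  have injF: "inj_on F U"
    using cauchy_transform_inject_far[OF sq] G0
    by (intro inj_onI) (auto simp: F_def U_def c_def A_def V_def)
  obtain \<kappa> where \<kappa>: "\<kappa> holomorphic_on (F ` U)" "\<And>w. w \<in> U \<Longrightarrow> \<kappa> (F w) = w"
    using holomorphic_has_inverse[OF holF \<open>open U\<close> injF] by metis
  have surj: "\<exists>w\<in>U. F w = z" if z: "Im z > c + 1" for z
  proof -
    have sub: "cball z 1 \<subseteq> U"
    proof
      fix w assume "w \<in> cball z 1"
      then have "norm (z - w) \<le> 1" by (simp add: dist_norm)
      then have "\<bar>Im (z - w)\<bar> \<le> 1" using abs_Im_le_cmod[of "z - w"] by linarith
      then show "w \<in> U" using z by (simp add: U_def)
    qed
    obtain w where "w \<in> cball z 1" "z + (w - F w) = w"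
    proof (rule brouwer_ball[of 1 z "\<lambda>w. z + (w - F w)"])
      show "continuous_on (cball z 1) (\<lambda>w. z + (w - F w))"
        by (intro continuous_intros holomorphic_on_imp_continuous_on holomorphic_on_subset[OF holF sub])
      show "(\<lambda>w. z + (w - F w)) \<in> cball z 1 \<rightarrow> cball z 1"
        using near sub by (auto simp: dist_norm norm_minus_commute)
    qed auto
    then show ?thesis using sub by (intro bexI[of _ w]) auto
  qed
  have K: "\<kappa> z \<in> U" "F (\<kappa> z) = z" if "Im z > c + 1" for z using surj[OF that] \<kappa>(2) by auto
  show thesis
  proof (rule that[of "c + 1" "\<lambda>z. \<kappa> z - z"])
    show "c + 1 > 0" using c by simp
    have "{z. Im z > c + 1} \<subseteq> F ` U" using surj by force
    then show "(\<lambda>z. \<kappa> z - z) holomorphic_on {z. Im z > c + 1}"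
      by (intro holomorphic_intros holomorphic_on_subset[OF \<kappa>(1)])
    fix z assume z: "Im z > c + 1"
    show "Im (z + (\<kappa> z - z)) > 0" using w0[OF K(1)[OF z]] by simp
    show "1 / cauchy_transform M (z + (\<kappa> z - z)) = z" using K(2)[OF z] by (simp add: F_def)
    show "norm (\<kappa> z - z) \<le> 1" using near[OF K(1)[OF z]] K(2)[OF z] by simp
  qed
qed

end

section \<open>Transforms on truncated cones and the identity theorem\<close>

lemma norm_le_truncated_cone:
  assumes "z \<in> truncated_cone \<alpha> \<beta>" "\<beta> > 0"
  shows "norm z \<le> (\<alpha> + 1) * Im z"
proof -
  have "norm z \<le> \<bar>Re z\<bar> + \<bar>Im z\<bar>" by (rule cmod_le)
  also have "\<dots> \<le> (\<alpha> + 1) * Im z" using assms by (simp add: truncated_cone_def algebra_simps)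
  finally show ?thesis .
qed

text \<open>The normalization at infinity bounds the displacement relative to |z|. Inside a cone |z|
  is at most (\<alpha> + 1) Im z, so the relative error \<open>\<delta>\<close> becomes half of the
  imaginary part.\<close>

lemma has_voiculescu_transform_far:
  assumes h: "has_voiculescu_transform \<nu> \<phi> (truncated_cone \<alpha> \<beta>)" and \<alpha>: "\<alpha> > 0" and \<beta>: "\<beta> > 0"
  obtains R where "\<And>z. z \<in> truncated_cone \<alpha> \<beta> \<Longrightarrow> Im z > R \<Longrightarrow> Im (z + \<phi> z) \<ge> Im z / 2"
proof -
  define \<delta> where "\<delta> = 1 / (2 * (\<alpha> + 1))"
  have \<delta>: "\<delta> > 0" using \<alpha> by (simp add: \<delta>_def)
  have "((\<lambda>z. (z + \<phi> z) / z) \<longlongrightarrow> 1) (inf at_infinity (principal (truncated_cone \<alpha> \<beta>)))"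
    using h by (simp add: has_voiculescu_transform_def)
  then have "\<forall>\<^sub>F z in inf at_infinity (principal (truncated_cone \<alpha> \<beta>)). dist ((z + \<phi> z) / z) 1 < \<delta>"
    using \<delta> by (rule tendstoD)
  then have "\<forall>\<^sub>F z in at_infinity. z \<in> truncated_cone \<alpha> \<beta> \<longrightarrow> dist ((z + \<phi> z) / z) 1 < \<delta>"
    by (simp add: eventually_inf_principal)
  then obtain R where R: "\<And>z. norm z \<ge> R \<Longrightarrow> z \<in> truncated_cone \<alpha> \<beta> \<Longrightarrow> dist ((z + \<phi> z) / z) 1 < \<delta>"
    by (auto simp: eventually_at_infinity)
  show thesis
  proof (rule that[of "max R 0"])
    fix z assume z: "z \<in> truncated_cone \<alpha> \<beta>" "Im z > max R 0"
    have "norm z \<ge> R" using z(2) abs_Im_le_cmod[of z] by linarith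
    then have "dist ((z + \<phi> z) / z) 1 < \<delta>" using R z by simp
    moreover have "z \<noteq> 0" using z by auto
    ultimately have "norm (\<phi> z / z) < \<delta>" by (simp add: dist_norm add_divide_distrib)
    then have "norm (\<phi> z) < \<delta> * norm z" using \<open>z \<noteq> 0\<close> by (simp add: norm_divide divide_less_eq)
    also have "\<dots> \<le> \<delta> * ((\<alpha> + 1) * Im z)" using norm_le_truncated_cone[OF z(1) \<beta>] \<delta> by (intro mult_left_mono) auto
    also have "\<dots> = Im z / 2" using \<alpha> by (simp add: \<delta>_def field_simps)
    finally have "\<bar>Im (\<phi> z)\<bar> < Im z / 2" using abs_Im_le_cmod[of "\<phi> z"] by linarith
    then show "Im (z + \<phi> z) \<ge> Im z / 2" by simp
  qed
qed

text \<open>Both values solve G(z + phi z) = 1/z, and both points lie so high that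
  \<open>cauchy_transform_inject_far\<close> identifies them.\<close>

lemma has_voiculescu_transform_unique:
  assumes rd: "real_distribution \<nu>" and sq: "integrable \<nu> (\<lambda>x. x\<^sup>2)"
    and h1: "has_voiculescu_transform \<nu> \<phi>1 (truncated_cone \<alpha>1 \<beta>1)" "\<alpha>1 > 0" "\<beta>1 > 0"
    and h2: "has_voiculescu_transform \<nu> \<phi>2 (truncated_cone \<alpha>2 \<beta>2)" "\<alpha>2 > 0" "\<beta>2 > 0"
  obtains R where "\<And>z. z \<in> truncated_cone \<alpha>1 \<beta>1 \<Longrightarrow> z \<in> truncated_cone \<alpha>2 \<beta>2 \<Longrightarrow> Im z > R \<Longrightarrow> \<phi>1 z = \<phi>2 z"
proof -
  interpret real_distribution \<nu> by (rule rd)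
  define c where "c = 2 * (1 + (\<integral>x. \<bar>x\<bar> \<partial>\<nu>) + (\<integral>x. x\<^sup>2 \<partial>\<nu>))"
  obtain R1 where R1: "\<And>z. z \<in> truncated_cone \<alpha>1 \<beta>1 \<Longrightarrow> Im z > R1 \<Longrightarrow> Im (z + \<phi>1 z) \<ge> Im z / 2"
    using has_voiculescu_transform_far[OF h1] by metis
  obtain R2 where R2: "\<And>z. z \<in> truncated_cone \<alpha>2 \<beta>2 \<Longrightarrow> Im z > R2 \<Longrightarrow> Im (z + \<phi>2 z) \<ge> Im z / 2"
    using has_voiculescu_transform_far[OF h2] by metis
  show thesis
  proof (rule that[of "max (2 * c) (max R1 R2)"])
    fix z assume z: "z \<in> truncated_cone \<alpha>1 \<beta>1" "z \<in> truncated_cone \<alpha>2 \<beta>2" "Im z > max (2 * c) (max R1 R2)"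
    have e: "1 / cauchy_transform \<nu> (z + \<phi>1 z) = z" "1 / cauchy_transform \<nu> (z + \<phi>2 z) = z"
      using h1 h2 z by (auto simp: has_voiculescu_transform_def)
    then have ce: "cauchy_transform \<nu> (z + \<phi>1 z) = cauchy_transform \<nu> (z + \<phi>2 z)"
      by (metis inverse_inverse_eq inverse_eq_divide)
    have ci: "Im (z + \<phi>1 z) > c" "Im (z + \<phi>2 z) > c" using R1[of z] R2[of z] z by auto
    have "z + \<phi>1 z = z + \<phi>2 z"
      by (rule cauchy_transform_inject_far[OF sq ci[unfolded c_def] ce])
    then show "\<phi>1 z = \<phi>2 z" by simp
  qed
qed

text \<open>The equation \<open>1 / G (K z) = z\<close> makes \<open>K\<close> injective on
  \<open>D\<close>, so by continuity the image of \<open>D\<close> accumulates at one of its points.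
  The two Cauchy transforms agree on that image, hence on the connected half plane.\<close>

lemma cauchy_transform_eqI:
  assumes \<rho>: "real_distribution \<rho>1" "real_distribution \<rho>2" and D: "open D" "D \<noteq> {}"
    and K: "continuous_on D K" "\<And>z. z \<in> D \<Longrightarrow> Im (K z) > 0"
    and e1: "\<And>z. z \<in> D \<Longrightarrow> 1 / cauchy_transform \<rho>1 (K z) = z"
    and e2: "\<And>z. z \<in> D \<Longrightarrow> 1 / cauchy_transform \<rho>2 (K z) = z"
  shows "\<rho>1 = \<rho>2"
proof (rule cauchy_transform_inject[OF \<rho>])
  fix \<zeta> :: complex assume \<zeta>: "Im \<zeta> > 0"
  obtain z0 where z0: "z0 \<in> D" using D by auto
  have "K z0 islimpt K ` D"
  proof -
    have "z0 islimpt D" using z0 D(1) by (simp add: interior_open interior_limit_point)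
    then obtain f where f: "\<And>n. f n \<in> D - {z0}" "f \<longlonglongrightarrow> z0" by (auto simp: islimpt_sequential)
    have "(\<lambda>n. K (f n)) \<longlonglongrightarrow> K z0"
      by (rule continuous_on_tendsto_compose[OF K(1) f(2) z0]) (use f in auto)
    moreover have "K (f n) \<in> K ` D - {K z0}" for n
      using f(1)[of n] e1[of "f n"] e1[of z0] z0 by auto
    ultimately show ?thesis
      unfolding islimpt_sequential by (intro exI[of _ "\<lambda>n. K (f n)"] conjI allI)
  qed
  have "cauchy_transform \<rho>1 \<zeta> - cauchy_transform \<rho>2 \<zeta> = 0"
  proof (rule analytic_continuation[where f = "\<lambda>\<zeta>. cauchy_transform \<rho>1 \<zeta> - cauchy_transform \<rho>2 \<zeta>"])
    show "(\<lambda>\<zeta>. cauchy_transform \<rho>1 \<zeta> - cauchy_transform \<rho>2 \<zeta>) holomorphic_on {z. Im z > 0}"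
      by (intro holomorphic_intros real_distribution.holomorphic_cauchy_transform \<rho>)
    show "open {z. Im z > 0}" by (rule open_halfspace_Im_gt)
    show "connected {z. Im z > 0}" by (intro convex_connected convex_halfspace_Im_gt)
    show "K ` D \<subseteq> {z. Im z > 0}" using K(2) by auto
    show "K z0 \<in> {z. Im z > 0}" using K(2) z0 by auto
    show "K z0 islimpt K ` D" by fact
    fix w assume "w \<in> K ` D"
    then obtain z where z: "z \<in> D" "w = K z" by auto
    have "cauchy_transform \<rho>1 w = cauchy_transform \<rho>2 w"
      using e1[OF z(1)] e2[OF z(1)] z(2)
      by (metis inverse_inverse_eq inverse_eq_divide)
    then show "cauchy_transform \<rho>1 w - cauchy_transform \<rho>2 w = 0" by simp
  qed (use \<zeta> in simp)
  then show "cauchy_transform \<rho>1 \<zeta> = cauchy_transform \<rho>2 \<zeta>" by simp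
qed

lemma truncated_cone_Int:
  "truncated_cone \<alpha>1 \<beta>1 \<inter> truncated_cone \<alpha>2 \<beta>2 \<inter> {z. Im z > R} \<noteq> {}" if "\<alpha>1 > 0" "\<alpha>2 > 0"
proof -
  define y where "y = 1 + \<bar>\<beta>1\<bar> + \<bar>\<beta>2\<bar> + \<bar>R\<bar>"
  have y: "y > \<beta>1" "y > \<beta>2" "y > R" "y > 0" by (auto simp: y_def)
  then have "\<i> * complex_of_real y \<in> truncated_cone \<alpha>1 \<beta>1 \<inter> truncated_cone \<alpha>2 \<beta>2 \<inter> {z. Im z > R}"
    using that by (simp add: truncated_cone_def)
  then show ?thesis by blast
qed

lemma open_truncated_cone: "open (truncated_cone \<alpha> \<beta>)"
proof -
  have "truncated_cone \<alpha> \<beta> = {z. Im z > \<beta>} \<inter> {z. \<bar>Re z\<bar> < \<alpha> * Im z}"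
    by (auto simp: truncated_cone_def)
  moreover have "open {z. \<bar>Re z\<bar> < \<alpha> * Im z}" by (intro open_Collect_less continuous_intros)
  ultimately show ?thesis using open_halfspace_Im_gt[of \<beta>] by auto
qed

text \<open>The second moments fix the transforms of the two factors high in the common cone. Their
  sums then agree and provide one map K for both candidates.\<close>

theorem free_convolution_unique:
  assumes \<mu>: "real_distribution \<mu>" "integrable \<mu> (\<lambda>x. x\<^sup>2)"
    and \<nu>: "real_distribution \<nu>" "integrable \<nu> (\<lambda>x. x\<^sup>2)"
    and 1: "is_free_convolution \<mu> \<nu> \<rho>1" and 2: "is_free_convolution \<mu> \<nu> \<rho>2"
  shows "\<rho>1 = \<rho>2"
proof -
  obtain \<alpha>1 \<beta>1 \<phi>1 \<psi>1 where a1: "\<alpha>1 > 0" "\<beta>1 > 0" "has_voiculescu_transform \<mu> \<phi>1 (truncated_cone \<alpha>1 \<beta>1)"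
    "has_voiculescu_transform \<nu> \<psi>1 (truncated_cone \<alpha>1 \<beta>1)"
    "has_voiculescu_transform \<rho>1 (\<lambda>z. \<phi>1 z + \<psi>1 z) (truncated_cone \<alpha>1 \<beta>1)" "real_distribution \<rho>1"
    using 1 unfolding is_free_convolution_def by blast
  obtain \<alpha>2 \<beta>2 \<phi>2 \<psi>2 where a2: "\<alpha>2 > 0" "\<beta>2 > 0" "has_voiculescu_transform \<mu> \<phi>2 (truncated_cone \<alpha>2 \<beta>2)"
    "has_voiculescu_transform \<nu> \<psi>2 (truncated_cone \<alpha>2 \<beta>2)"
    "has_voiculescu_transform \<rho>2 (\<lambda>z. \<phi>2 z + \<psi>2 z) (truncated_cone \<alpha>2 \<beta>2)" "real_distribution \<rho>2"
    using 2 unfolding is_free_convolution_def by blast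
  obtain R where R: "\<And>z. z \<in> truncated_cone \<alpha>1 \<beta>1 \<Longrightarrow> z \<in> truncated_cone \<alpha>2 \<beta>2 \<Longrightarrow> Im z > R \<Longrightarrow> \<phi>1 z = \<phi>2 z"
    using has_voiculescu_transform_unique[OF \<mu> a1(3,1,2) a2(3,1,2)] by blast
  obtain R' where R': "\<And>z. z \<in> truncated_cone \<alpha>1 \<beta>1 \<Longrightarrow> z \<in> truncated_cone \<alpha>2 \<beta>2 \<Longrightarrow> Im z > R' \<Longrightarrow> \<psi>1 z = \<psi>2 z"
    using has_voiculescu_transform_unique[OF \<nu> a1(4,1,2) a2(4,1,2)] by blast
  define D where "D = truncated_cone \<alpha>1 \<beta>1 \<inter> truncated_cone \<alpha>2 \<beta>2 \<inter> {z. Im z > max R R'}"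
  have D: "z \<in> truncated_cone \<alpha>1 \<beta>1" "z \<in> truncated_cone \<alpha>2 \<beta>2" "\<phi>1 z + \<psi>1 z = \<phi>2 z + \<psi>2 z" if "z \<in> D" for z
    using that R R' by (auto simp: D_def)
  show ?thesis
  proof (rule cauchy_transform_eqI[OF a1(6) a2(6), of D "\<lambda>z. z + (\<phi>1 z + \<psi>1 z)"])
    show "open D" unfolding D_def by (intro open_Int open_truncated_cone open_halfspace_Im_gt)
    show "D \<noteq> {}" unfolding D_def by (rule truncated_cone_Int[OF a1(1) a2(1)])
    have "(\<lambda>z. \<phi>1 z + \<psi>1 z) holomorphic_on truncated_cone \<alpha>1 \<beta>1" using a1(5) by (simp add: has_voiculescu_transform_def)
    then show "continuous_on D (\<lambda>z. z + (\<phi>1 z + \<psi>1 z))"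
      by (intro continuous_on_add continuous_on_id holomorphic_on_imp_continuous_on)
        (rule holomorphic_on_subset, auto simp: D_def)
    fix z assume z: "z \<in> D"
    show "Im (z + (\<phi>1 z + \<psi>1 z)) > 0" "1 / cauchy_transform \<rho>1 (z + (\<phi>1 z + \<psi>1 z)) = z"
      using a1(5) D(1)[OF z] by (auto simp: has_voiculescu_transform_def)
    show "1 / cauchy_transform \<rho>2 (z + (\<phi>1 z + \<psi>1 z)) = z"
      unfolding D(3)[OF z] using a2(5) D(2)[OF z] by (auto simp: has_voiculescu_transform_def)
  qed
qed

lemma has_voiculescu_transformI:
  assumes "\<phi> holomorphic_on truncated_cone \<alpha> \<beta>" "\<beta> > 0"
    "\<And>z. z \<in> truncated_cone \<alpha> \<beta> \<Longrightarrow> Im (z + \<phi> z) > 0"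
    "\<And>z. z \<in> truncated_cone \<alpha> \<beta> \<Longrightarrow> 1 / cauchy_transform \<nu> (z + \<phi> z) = z"
    and bnd: "\<And>z. z \<in> truncated_cone \<alpha> \<beta> \<Longrightarrow> norm (\<phi> z) \<le> C"
  shows "has_voiculescu_transform \<nu> \<phi> (truncated_cone \<alpha> \<beta>)"
proof -
  let ?F = "inf at_infinity (principal (truncated_cone \<alpha> \<beta>))"
  have "((\<lambda>z. (z + \<phi> z) / z - 1) \<longlongrightarrow> 0) ?F"
  proof (rule Lim_null_comparison)
    have nz: "z \<noteq> 0" if "z \<in> truncated_cone \<alpha> \<beta>" for z using that \<open>\<beta> > 0\<close> by (auto simp: truncated_cone_def)
    show "\<forall>\<^sub>F z in ?F. norm ((z + \<phi> z) / z - 1) \<le> C * norm (1 / z)"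
      unfolding eventually_inf_principal
    proof (intro always_eventually allI impI)
      fix z assume z: "z \<in> truncated_cone \<alpha> \<beta>"
      have "(z + \<phi> z) / z - 1 = \<phi> z * (1 / z)" using nz[OF z] by (simp add: field_simps)
      then show "norm ((z + \<phi> z) / z - 1) \<le> C * norm (1 / z)"
        using mult_right_mono[OF bnd[OF z], of "norm (1 / z)"] by (simp only: norm_mult norm_ge_zero)
    qed
    have "((\<lambda>z::complex. C * norm (1 / z)) \<longlongrightarrow> C * norm (0::complex)) at_infinity"
      unfolding inverse_eq_divide[symmetric] by (intro tendsto_intros tendsto_inverse_0)
    then show "((\<lambda>z. C * norm (1 / z)) \<longlongrightarrow> 0) ?F"
      by (simp add: filterlim_inf tendsto_mono[OF inf_le1])
  qed
  then have "((\<lambda>z. (z + \<phi> z) / z) \<longlongrightarrow> 1) ?F" by (rule LIM_zero_cancel)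
  then show ?thesis using assms by (simp add: has_voiculescu_transform_def)
qed

text \<open>At the point w = z + phi z the Cauchy transform of \<mu> is 1/z, so w + s G(w) = z + phi
  z + s/z. The relation defining \<open>\<rho>\<close> thus states that its transform is the sum of
  phi and s/z.\<close>

theorem is_free_convolution_semicircular:
  assumes \<mu>: "real_distribution \<mu>" "integrable \<mu> (\<lambda>x. x\<^sup>2)" "(\<integral>x. x \<partial>\<mu>) = 0" and s: "s \<ge> 0"
    and \<nu>: "\<And>z. Im z > \<beta>0 \<Longrightarrow> 1 / cauchy_transform \<nu> (z + of_real s / z) = z"
    and \<rho>: "real_distribution \<rho>"
      "\<And>w. Im w > 0 \<Longrightarrow> Im (w + of_real s * cauchy_transform \<mu> w) > 0 \<Longrightarrow>
         cauchy_transform \<rho> (w + of_real s * cauchy_transform \<mu> w) = cauchy_transform \<mu> w"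
  shows "is_free_convolution \<mu> \<nu> \<rho>"
proof -
  interpret real_distribution \<mu> by (rule \<mu>)
  obtain \<beta>1 \<phi> where \<phi>: "\<beta>1 > 0" "\<phi> holomorphic_on {z. Im z > \<beta>1}"
    "\<And>z. Im z > \<beta>1 \<Longrightarrow> Im (z + \<phi> z) > 0" "\<And>z. Im z > \<beta>1 \<Longrightarrow> 1 / cauchy_transform \<mu> (z + \<phi> z) = z"
    "\<And>z. Im z > \<beta>1 \<Longrightarrow> norm (\<phi> z) \<le> 1"
    using far_inverse[OF \<mu>(2,3)] by metis
  \<comment> \<open>Above height 2 + s the term s/z has norm at most 1, and a displacement of norm
    at most 2, as for the sum of both transforms, stays in the upper half plane.\<close>
  define \<beta> where "\<beta> = 2 + s + \<bar>\<beta>0\<bar> + \<beta>1"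
  have \<beta>: "\<beta> > 0" "\<beta> \<ge> 2 + s" "\<beta> > \<beta>0" "\<beta> > \<beta>1" using s \<phi>(1) by (auto simp: \<beta>_def)
  let ?D = "truncated_cone 1 \<beta>"
  have Dg: "Im z > \<beta>" if "z \<in> ?D" for z using that by (simp add: truncated_cone_def)
  have sub: "?D \<subseteq> {z. Im z > \<beta>1}" using Dg \<beta> by force
  have D0: "z \<noteq> 0" "Im z > 0" if "z \<in> ?D" for z using Dg[OF that] \<beta>(1) by auto
  have sz: "norm (of_real s / z) \<le> 1" if "z \<in> ?D" for z
  proof -
    have "s \<le> norm z" using abs_Im_le_cmod[of z] Dg[OF that] \<beta>(2) by linarith
    then show ?thesis using s D0[OF that] by (simp add: norm_divide divide_le_eq)
  qed
  have big: "Im (z + u) > 0" if "z \<in> ?D" "norm u \<le> 2" for z u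
    using abs_Im_le_cmod[of u] Dg[OF that(1)] \<beta>(2) s that(2) by simp
  have h1: "has_voiculescu_transform \<mu> \<phi> ?D"
    using \<phi> Dg \<beta> sub by (intro has_voiculescu_transformI[where C = 1] holomorphic_on_subset[OF \<phi>(2)]) force+
  have h2: "has_voiculescu_transform \<nu> (\<lambda>z. of_real s / z) ?D"
  proof (rule has_voiculescu_transformI[where C = 1])
    show "(\<lambda>z. of_real s / z) holomorphic_on ?D" using D0 by (intro holomorphic_intros) auto
    fix z assume z: "z \<in> ?D"
    show "Im (z + of_real s / z) > 0" using sz[OF z] by (intro big[OF z]) simp
    show "1 / cauchy_transform \<nu> (z + of_real s / z) = z" using Dg[OF z] \<beta> by (intro \<nu>) simp
  qed (use \<beta> sz in auto)
  have h3: "has_voiculescu_transform \<rho> (\<lambda>z. \<phi> z + of_real s / z) ?D"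
  proof (rule has_voiculescu_transformI[where C = 2])
    show "(\<lambda>z. \<phi> z + of_real s / z) holomorphic_on ?D"
      using D0 by (intro holomorphic_intros holomorphic_on_subset[OF \<phi>(2) sub]) auto
    fix z assume z: "z \<in> ?D"
    have zb: "Im z > \<beta>1" using z sub by auto
    show n: "norm (\<phi> z + of_real s / z) \<le> 2"
      using norm_triangle_ineq[of "\<phi> z" "of_real s / z"] \<phi>(5)[OF zb] sz[OF z] by linarith
    show p: "Im (z + (\<phi> z + of_real s / z)) > 0" by (rule big[OF z n])
    have G: "cauchy_transform \<mu> (z + \<phi> z) = 1 / z"
      using \<phi>(4)[OF zb] by (metis inverse_inverse_eq inverse_eq_divide)
    have e: "(z + \<phi> z) + of_real s * (1 / z) = z + (\<phi> z + of_real s / z)" by simp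
    have "cauchy_transform \<rho> (z + (\<phi> z + of_real s / z)) = 1 / z"
      using \<rho>(2)[OF \<phi>(3)[OF zb]] p unfolding G e by simp
    then show "1 / cauchy_transform \<rho> (z + (\<phi> z + of_real s / z)) = z" by simp
  qed (use \<beta> in auto)
  show ?thesis
    unfolding is_free_convolution_def
    using \<rho>(1) h1 h2 h3 \<beta>(1) zero_less_one by blast
qed

section \<open>The semicircle law and dilations\<close>

lemma semicircle_density_nonneg: "0 \<le> indicator {-2..2} x * (1 / (2 * pi) * sqrt (4 - x\<^sup>2))"
proof (cases "x \<in> {-2..2}")
  case True
  then have "x\<^sup>2 \<le> 4" using abs_le_square_iff[of x 2] by auto
  then show ?thesis by (intro mult_nonneg_nonneg) auto
qed simp

text \<open>The substitution x = - 2 cos \<theta>, increasing on \<open>{0..pi}\<close>, turns the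
  semicircle law into (2 / pi) sin^2 \<theta> d\<theta>, for which Fourier orthogonality is
  available.\<close>

lemma integral_semicircle:
  fixes f :: "real \<Rightarrow> 'b::euclidean_space"
  assumes f: "continuous_on UNIV f"
  shows "integrable semicircle f"
    and "((\<lambda>\<theta>. ((sin \<theta>)\<^sup>2 * (2 / pi)) *\<^sub>R f (- 2 * cos \<theta>)) has_integral (\<integral>x. f x \<partial>semicircle)) {0..pi}"
proof -
  let ?w = "\<lambda>x::real. 1 / (2 * pi) * sqrt (4 - x\<^sup>2)"
  have fm[measurable]: "f \<in> borel_measurable borel" by (rule borel_measurable_continuous_onI[OF f])
  have cw: "continuous_on {-2..2} (\<lambda>x. ?w x *\<^sub>R f x)"
    by (intro continuous_intros continuous_on_subset[OF f]) auto
  have si: "set_integrable lborel {-2..2} (\<lambda>x. ?w x *\<^sub>R f x)"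
    by (rule borel_integrable_atLeastAtMost'[OF cw])
  have eq: "(indicator {-2..2} x * ?w x) *\<^sub>R f x = indicator {-2..2} x *\<^sub>R (?w x *\<^sub>R f x)" for x by simp
  have nn: "AE x in lborel. 0 \<le> indicator {-2..2} x * ?w x" by (rule AE_I2) (rule semicircle_density_nonneg)
  have "integrable lborel (\<lambda>x. (indicator {-2..2} x * ?w x) *\<^sub>R f x)"
    using si unfolding set_integrable_def by (simp only: eq)
  then show "integrable semicircle f"
    unfolding semicircle_def by (intro integrable_density[THEN iffD2, OF _ _ nn]) measurable
  have "(\<integral>x. f x \<partial>semicircle) = (\<integral>x. (indicator {-2..2} x * ?w x) *\<^sub>R f x \<partial>lborel)"
    unfolding semicircle_def using nn by (intro integral_density) auto
  also have "\<dots> = integral {-2..2} (\<lambda>x. ?w x *\<^sub>R f x)"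
    unfolding eq using set_borel_integral_eq_integral(2)[OF si] by (simp only: set_lebesgue_integral_def)
  finally have I: "(\<integral>x. f x \<partial>semicircle) = integral {-2..2} (\<lambda>x. ?w x *\<^sub>R f x)" .
  have "((\<lambda>\<theta>. (2 * sin \<theta>) *\<^sub>R (?w (- 2 * cos \<theta>) *\<^sub>R f (- 2 * cos \<theta>))) has_integral
      integral {(- 2 * cos 0)..(- 2 * cos pi)} (\<lambda>x. ?w x *\<^sub>R f x)) {0..pi}"
  proof (rule has_integral_substitution[where c = "-2" and d = 2])
    show "(\<lambda>\<theta>. - 2 * cos \<theta>) ` {0..pi} \<subseteq> {- 2..2}"
      by (auto simp: minus_le_iff intro: order_trans[OF _ cos_ge_minus_one])
    show "((\<lambda>\<theta>. - 2 * cos \<theta>) has_real_derivative 2 * sin x) (at x within {0..pi})" for x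
      by (auto intro!: derivative_eq_intros)
  qed (use cw in auto)
  note sub = this
  have "(2 * sin \<theta>) *\<^sub>R (?w (- 2 * cos \<theta>) *\<^sub>R f (- 2 * cos \<theta>)) = ((sin \<theta>)\<^sup>2 * (2 / pi)) *\<^sub>R f (- 2 * cos \<theta>)"
    if "\<theta> \<in> {0..pi}" for \<theta>
  proof -
    have "4 - (- 2 * cos \<theta>)\<^sup>2 = (2 * sin \<theta>)\<^sup>2" by (simp add: power_mult_distrib cos_squared_eq)
    moreover have "sin \<theta> \<ge> 0" using that by (intro sin_ge_zero) auto
    ultimately have "sqrt (4 - (- 2 * cos \<theta>)\<^sup>2) = 2 * sin \<theta>" by (simp only: real_sqrt_abs abs_of_nonneg mult_nonneg_nonneg zero_le_numeral)
    then show ?thesis by (simp only:) (simp add: power2_eq_square)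
  qed
  from has_integral_eq[OF this sub] have "((\<lambda>\<theta>. ((sin \<theta>)\<^sup>2 * (2 / pi)) *\<^sub>R f (- 2 * cos \<theta>)) has_integral
      integral {(- 2 * cos 0)..(- 2 * cos pi)} (\<lambda>x. ?w x *\<^sub>R f x)) {0..pi}" .
  then show "((\<lambda>\<theta>. ((sin \<theta>)\<^sup>2 * (2 / pi)) *\<^sub>R f (- 2 * cos \<theta>)) has_integral (\<integral>x. f x \<partial>semicircle)) {0..pi}"
    unfolding I by simp
qed

lemma has_integral_sin_sin:
  "((\<lambda>\<theta>. sin \<theta> * sin (real (Suc n) * \<theta>)) has_integral (if n = 0 then pi / 2 else 0)) {0..pi}"
proof (cases "n = 0")
  case True
  have "((\<lambda>\<theta>. sin \<theta> * sin \<theta>) has_integral (pi / 2 - sin (2 * pi) / 4) - (0 / 2 - sin (2 * 0) / 4)) {0..pi}"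
  proof (rule fundamental_theorem_of_calculus)
    fix x :: real
    have "sin x * sin x = 1 / 2 - cos (2 * x) / 2" using cos_double_sin[of x] by (simp add: power2_eq_square field_simps)
    then show "((\<lambda>x. x / 2 - sin (2 * x) / 4) has_vector_derivative sin x * sin x) (at x within {0..pi})"
      by (auto intro!: derivative_eq_intros simp: has_real_derivative_iff_has_vector_derivative[symmetric])
  qed simp
  then show ?thesis using True by simp
next
  case False
  let ?F = "\<lambda>\<theta>. (sin (real n * \<theta>) / real n - sin (real (n + 2) * \<theta>) / real (n + 2)) / 2"
  have "((\<lambda>\<theta>. sin \<theta> * sin (real (Suc n) * \<theta>)) has_integral ?F pi - ?F 0) {0..pi}"
  proof (rule fundamental_theorem_of_calculus)
    fix x :: real
    have "sin x * sin (real (Suc n) * x) = (cos (real n * x) - cos (real (n + 2) * x)) / 2"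
      unfolding sin_times_sin using cos_minus[of "real n * x"] by (simp add: algebra_simps)
    then show "(?F has_vector_derivative sin x * sin (real (Suc n) * x)) (at x within {0..pi})"
      using False by (auto intro!: derivative_eq_intros simp: has_real_derivative_iff_has_vector_derivative[symmetric])
  qed simp
  moreover have "sin (real n * pi) = 0" "sin (real (n + 2) * pi) = 0" by (rule sin_npi)+
  ultimately show ?thesis using False by simp
qed

text \<open>Partial sums of \<open>\<Sum>n. b\<^sup>n sin ((n + 1) \<theta>) = sin \<theta> / (1 - 2 b cos \<theta> + b\<^sup>2)\<close> with explicit remainder.\<close>

lemma conjugate_poisson_partial_sum:
  fixes b :: complex and \<theta> :: real
  shows "(1 - 2 * b * of_real (cos \<theta>) + b\<^sup>2) * (\<Sum>n<N. b ^ n * of_real (sin (real (Suc n) * \<theta>)))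
    = of_real (sin \<theta>) - b ^ N * (of_real (sin (real (Suc N) * \<theta>)) - b * of_real (sin (real N * \<theta>)))"
proof (induction N)
  case (Suc N)
  have "sin (real (Suc (Suc N)) * \<theta>) + sin (real N * \<theta>) = 2 * cos \<theta> * sin (real (Suc N) * \<theta>)"
    using sin_add[of "real (Suc N) * \<theta>" \<theta>] sin_diff[of "real (Suc N) * \<theta>" \<theta>] by (simp add: algebra_simps)
  from arg_cong[OF this, of complex_of_real]
  have s: "complex_of_real (sin (real (Suc (Suc N)) * \<theta>))
      = 2 * of_real (cos \<theta>) * of_real (sin (real (Suc N) * \<theta>)) - of_real (sin (real N * \<theta>))"
    by (simp only: eq_diff_eq of_real_add of_real_mult of_real_numeral)
  show ?case unfolding sum.lessThan_Suc distrib_left Suc.IH s by (simp add: algebra_simps power2_eq_square)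
qed simp

text \<open>The denominator factors as the product of 1 - b e^(i \<theta>) and 1 - b e^(- i
  \<theta>), each of modulus at least 1 - |b|.\<close>

lemma norm_poisson_denominator:
  fixes b :: complex
  assumes "norm b < 1"
  shows "(1 - norm b)\<^sup>2 \<le> norm (1 - 2 * b * of_real (cos \<theta>) + b\<^sup>2)"
proof -
  have f: "1 - 2 * b * of_real (cos \<theta>) + b\<^sup>2 = (1 - b * cis \<theta>) * (1 - b * cis (- \<theta>))"
  proof -
    have "cis \<theta> + cis (- \<theta>) = 2 * of_real (cos \<theta>)" by (simp add: complex_eq_iff)
    moreover have "cis \<theta> * cis (- \<theta>) = 1" by (simp add: cis_mult)
    moreover have "(1 - b * cis \<theta>) * (1 - b * cis (- \<theta>)) = 1 - b * (cis \<theta> + cis (- \<theta>)) + b\<^sup>2 * (cis \<theta> * cis (- \<theta>))"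
      by (simp add: algebra_simps power2_eq_square)
    ultimately show ?thesis by (simp add: algebra_simps)
  qed
  have "1 - norm b \<le> norm (1 - b * cis t)" for t
    using norm_triangle_ineq2[of 1 "b * cis t"] by (simp add: norm_mult)
  then show ?thesis unfolding f norm_mult power2_eq_square[of "1 - norm b"] using assms by (intro mult_mono) auto
qed

text \<open>Multiplied by sin \<theta>, the series for sin \<theta> / (1 - 2 b cos \<theta> + b^2)
  can be integrated termwise, and orthogonality leaves only the term n = 0. The remainder is bounded
  by a geometric sequence uniformly in \<theta>.\<close>

lemma has_integral_sin_squared_poisson:
  fixes b :: complex
  assumes b: "norm b < 1"
  shows "((\<lambda>\<theta>. of_real ((sin \<theta>)\<^sup>2) / (1 - 2 * b * of_real (cos \<theta>) + b\<^sup>2)) has_integral of_real (pi / 2)) {0..pi}"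
proof -
  let ?D = "\<lambda>\<theta>. 1 - 2 * b * complex_of_real (cos \<theta>) + b\<^sup>2"
  let ?f = "\<lambda>\<theta>. of_real ((sin \<theta>)\<^sup>2) / ?D \<theta>"
  have c0: "0 < (1 - norm b)\<^sup>2" using b by simp
  have D0: "?D \<theta> \<noteq> 0" for \<theta> using norm_poisson_denominator[OF b, of \<theta>] c0 by auto
  have int: "?f integrable_on {0..pi}"
    by (intro integrable_continuous_real continuous_intros) (use D0 in auto)
  define S where "S N \<theta> = (\<Sum>n<N. b ^ n * complex_of_real (sin \<theta> * sin (real (Suc n) * \<theta>)))" for N \<theta>
  have SI: "(S (Suc N) has_integral of_real (pi / 2)) {0..pi}" for N
  proof -
    have "((\<lambda>\<theta>. b ^ n * complex_of_real (sin \<theta> * sin (real (Suc n) * \<theta>))) has_integral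
        b ^ n * of_real (if n = 0 then pi / 2 else 0)) {0..pi}" for n
      by (intro has_integral_mult_right has_integral_of_real has_integral_sin_sin)
    then have "(S (Suc N) has_integral (\<Sum>n<Suc N. b ^ n * of_real (if n = 0 then pi / 2 else 0))) {0..pi}"
      unfolding S_def[abs_def] by (intro has_integral_sum) auto
    moreover have "(\<Sum>n<Suc N. b ^ n * complex_of_real (if n = 0 then pi / 2 else 0)) = of_real (pi / 2)"
      by (subst sum.lessThan_Suc_shift) simp
    ultimately show ?thesis by (simp only:)
  qed
  have bound: "norm (?f \<theta> - S N \<theta>) \<le> norm b ^ N * (2 / (1 - norm b)\<^sup>2)" for N \<theta>
  proof -
    let ?R = "of_real (sin (real (Suc N) * \<theta>)) - b * of_real (sin (real N * \<theta>))"
    have "S N \<theta> = of_real (sin \<theta>) * (\<Sum>n<N. b ^ n * of_real (sin (real (Suc n) * \<theta>)))"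
      unfolding S_def sum_distrib_left by (intro sum.cong) (simp_all add: mult_ac)
    then have "?D \<theta> * S N \<theta> = of_real (sin \<theta>) * (of_real (sin \<theta>) - b ^ N * ?R)"
      unfolding conjugate_poisson_partial_sum[symmetric] by (simp only: mult_ac)
    then have "?D \<theta> * (?f \<theta> - S N \<theta>) = b ^ N * (of_real (sin \<theta>) * ?R)"
      using D0[of \<theta>] by (simp add: right_diff_distrib power2_eq_square)
    then have "?f \<theta> - S N \<theta> = b ^ N * (of_real (sin \<theta>) * ?R) / ?D \<theta>"
      using D0[of \<theta>] by (metis nonzero_mult_div_cancel_left)
    then have "norm (?f \<theta> - S N \<theta>) = norm b ^ N * (\<bar>sin \<theta>\<bar> * norm ?R) / norm (?D \<theta>)"
      by (simp only: norm_divide norm_mult norm_power norm_of_real)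
    also have "\<dots> \<le> norm b ^ N * (1 * 2) / (1 - norm b)\<^sup>2"
    proof (intro frac_le mult_left_mono mult_mono norm_poisson_denominator b c0)
      have "norm ?R \<le> \<bar>sin (real (Suc N) * \<theta>)\<bar> + norm b * \<bar>sin (real N * \<theta>)\<bar>"
        using norm_triangle_ineq4[of "complex_of_real (sin (real (Suc N) * \<theta>))" "b * of_real (sin (real N * \<theta>))"]
        by (simp only: norm_mult norm_of_real)
      also have "\<dots> \<le> 1 + 1 * 1" using b by (intro add_mono mult_mono abs_sin_le_one) auto
      finally show "norm ?R \<le> 2" by simp
    qed (auto simp: abs_sin_le_one)
    finally show ?thesis by simp
  qed
  have "norm (integral {0..pi} ?f - of_real (pi / 2)) \<le> norm b ^ Suc N * (2 / (1 - norm b)\<^sup>2) * pi" for N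
  proof -
    have "integral {0..pi} ?f - of_real (pi / 2) = integral {0..pi} (\<lambda>\<theta>. ?f \<theta> - S (Suc N) \<theta>)"
      using SI[of N] by (subst integral_diff[OF int]) (auto simp: integral_unique has_integral_integrable)
    moreover have "norm (integral {0..pi} (\<lambda>\<theta>. ?f \<theta> - S (Suc N) \<theta>)) \<le> norm b ^ Suc N * (2 / (1 - norm b)\<^sup>2) * (pi - 0)"
    proof (rule integral_bound)
      show "continuous_on {0..pi} (\<lambda>\<theta>. ?f \<theta> - S (Suc N) \<theta>)"
        unfolding S_def by (intro continuous_intros D0 ballI)
      show "norm (?f \<theta> - S (Suc N) \<theta>) \<le> norm b ^ Suc N * (2 / (1 - norm b)\<^sup>2)" for \<theta> by (rule bound)
    qed simp
    ultimately show ?thesis by simp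
  qed
  moreover have "(\<lambda>N. norm b ^ Suc N * (2 / (1 - norm b)\<^sup>2) * pi) \<longlonglongrightarrow> 0"
  proof -
    have "(\<lambda>N. norm b ^ Suc N) \<longlonglongrightarrow> 0" using b by (intro LIMSEQ_Suc LIMSEQ_power_zero) simp
    then have "(\<lambda>N. norm b ^ Suc N * (2 / (1 - norm b)\<^sup>2) * pi) \<longlonglongrightarrow> 0 * (2 / (1 - norm b)\<^sup>2) * pi"
      by (intro tendsto_intros)
    then show ?thesis by simp
  qed
  ultimately have "norm (integral {0..pi} ?f - of_real (pi / 2)) \<le> 0"
    by (intro LIMSEQ_le_const) auto
  then have "integral {0..pi} ?f = of_real (pi / 2)" by (simp only: norm_le_zero_iff right_minus_eq)
  then show ?thesis using integrable_integral[OF int] by (simp only:)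
qed

lemma real_distribution_semicircle: "real_distribution semicircle"
proof -
  have "((\<lambda>\<theta>. ((sin \<theta>)\<^sup>2 * (2 / pi)) *\<^sub>R (1::real)) has_integral (\<integral>x. 1 \<partial>semicircle)) {0..pi}"
    by (intro integral_semicircle continuous_intros)
  moreover have "((\<lambda>\<theta>. ((sin \<theta>)\<^sup>2 * (2 / pi)) *\<^sub>R (1::real)) has_integral (pi / 2 * (2 / pi))) {0..pi}"
    using has_integral_mult_left[OF has_integral_sin_sin[of 0], of "2 / pi"] by (simp add: power2_eq_square)
  ultimately have one: "(\<integral>x. 1 \<partial>semicircle) = (1::real)" by (simp add: has_integral_unique)
  have "integrable semicircle (\<lambda>x. 1::real)" by (intro integral_semicircle continuous_intros)
  then have "emeasure semicircle (space semicircle) < \<infinity>" by (simp add: integrable_iff_bounded)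
  then have "finite_measure semicircle" by (intro finite_measureI) auto
  then have "emeasure semicircle (space semicircle) = 1"
    using one by (simp add: finite_measure.emeasure_eq_measure)
  then have "prob_space semicircle" by (rule prob_spaceI)
  then show ?thesis
    unfolding real_distribution_def real_distribution_axioms_def by (simp add: semicircle_def)
qed

text \<open>With x = - 2 cos \<theta> the kernel at z + 1/z has denominator z (1 - 2 b cos \<theta>
  + b^2) for b = - 1/z, which is the preceding integral. Parametrizing by z + 1/z avoids the choice
  of a square root.\<close>

lemma cauchy_transform_semicircle:
  assumes z: "norm z > 1" "Im (z + 1 / z) > 0"
  shows "cauchy_transform semicircle (z + 1 / z) = 1 / z"
proof -
  let ?f = "\<lambda>x. 1 / (z + 1 / z - complex_of_real x)"
  have z0: "z \<noteq> 0" using z by auto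
  have "continuous_on UNIV ?f" using isCont_cauchy_kernel[OF z(2)] by (simp add: continuous_at_imp_continuous_on)
  then have 1: "((\<lambda>\<theta>. ((sin \<theta>)\<^sup>2 * (2 / pi)) *\<^sub>R ?f (- 2 * cos \<theta>)) has_integral (\<integral>x. ?f x \<partial>semicircle)) {0..pi}"
    by (rule integral_semicircle)
  have 2: "((\<lambda>\<theta>. (2 / (of_real pi * z)) * (of_real ((sin \<theta>)\<^sup>2) / (1 - 2 * (- 1 / z) * of_real (cos \<theta>) + (- 1 / z)\<^sup>2))) has_integral
      (2 / (of_real pi * z)) * of_real (pi / 2)) {0..pi}"
    using z by (intro has_integral_mult_right has_integral_sin_squared_poisson) (auto simp: norm_divide divide_less_eq)
  have "((sin \<theta>)\<^sup>2 * (2 / pi)) *\<^sub>R ?f (- 2 * cos \<theta>)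
      = (2 / (of_real pi * z)) * (of_real ((sin \<theta>)\<^sup>2) / (1 - 2 * (- 1 / z) * of_real (cos \<theta>) + (- 1 / z)\<^sup>2))" for \<theta>
  proof -
    have "z * (1 - 2 * (- 1 / z) * of_real (cos \<theta>) + (- 1 / z)\<^sup>2) = z + 1 / z - complex_of_real (- 2 * cos \<theta>)"
      using z0 by (simp add: field_simps power2_eq_square)
    then have "?f (- 2 * cos \<theta>) = 1 / z * (1 / (1 - 2 * (- 1 / z) * of_real (cos \<theta>) + (- 1 / z)\<^sup>2))"
      by (metis mult_1 times_divide_times_eq)
    then show ?thesis by (simp only:) (simp add: scaleR_conv_of_real mult_ac)
  qed
  from has_integral_unique[OF has_integral_eq[OF this 1] 2]
  have "(\<integral>x. ?f x \<partial>semicircle) = (2 / (of_real pi * z)) * of_real (pi / 2)" .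
  then show ?thesis by (simp add: cauchy_transform_def)
qed

section \<open>Dilations and the semicircle law of arbitrary variance\<close>

lemma real_distribution_dilate: "real_distribution \<nu> \<Longrightarrow> real_distribution (dilate c \<nu>)"
proof -
  assume \<nu>: "real_distribution \<nu>"
  then interpret real_distribution \<nu> .
  have "prob_space (dilate c \<nu>)" unfolding dilate_def by (rule prob_space_distr) simp
  then show ?thesis unfolding real_distribution_def real_distribution_axioms_def by (simp add: dilate_def)
qed

lemma integral_dilate:
  fixes f :: "real \<Rightarrow> 'b::{banach, second_countable_topology}"
  assumes "real_distribution \<nu>" "f \<in> borel_measurable borel"
  shows "(\<integral>x. f x \<partial>dilate c \<nu>) = (\<integral>x. f (c * x) \<partial>\<nu>)"
    and "integrable (dilate c \<nu>) f \<longleftrightarrow> integrable \<nu> (\<lambda>x. f (c * x))"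
proof -
  interpret real_distribution \<nu> by fact
  show "(\<integral>x. f x \<partial>dilate c \<nu>) = (\<integral>x. f (c * x) \<partial>\<nu>)"
    unfolding dilate_def using assms(2) by (intro integral_distr) auto
  show "integrable (dilate c \<nu>) f \<longleftrightarrow> integrable \<nu> (\<lambda>x. f (c * x))"
    unfolding dilate_def using assms(2) by (intro integrable_distr_eq) auto
qed

lemma cauchy_transform_dilate:
  assumes \<nu>: "real_distribution \<nu>" and z: "Im z > 0"
  shows "cauchy_transform (dilate c \<nu>) z = (\<integral>x. 1 / (z - complex_of_real (c * x)) \<partial>\<nu>)"
proof -
  have "continuous_on UNIV (\<lambda>x. 1 / (z - complex_of_real x))"
    using isCont_cauchy_kernel[OF z] by (simp add: continuous_at_imp_continuous_on)
  then show ?thesis unfolding cauchy_transform_def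
    by (intro integral_dilate(1) \<nu> borel_measurable_continuous_onI)
qed

text \<open>The transform of the dilated law is \<open>c\<^sup>2 / z\<close>. For positive
  \<open>c\<close> the variable u = z / c reduces to the standard law, whose argument becomes u +
  1/u; for c = 0 the law is the unit mass at 0 and the claim reads 1 / (1/z) = z.\<close>

lemma cauchy_transform_dilate_semicircle:
  assumes c: "c \<ge> 0" and z: "Im z > c + 1"
  shows "1 / cauchy_transform (dilate c semicircle) (z + of_real (c\<^sup>2) / z) = z"
proof -
  have nz: "norm z > c + 1" using z abs_Im_le_cmod[of z] by linarith
  have z0: "z \<noteq> 0" using z c by auto
  have "norm (of_real (c\<^sup>2) / z) \<le> c"
  proof -
    have "c * c \<le> c * norm z" using nz c by (intro mult_left_mono) auto
    then show ?thesis using z0 c by (simp add: norm_divide norm_mult divide_le_eq power2_eq_square)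
  qed
  then have pos: "Im (z + of_real (c\<^sup>2) / z) > 0"
    using abs_Im_le_cmod[of "of_real (c\<^sup>2) / z"] z by simp
  show ?thesis
  proof (cases "c = 0")
    case True
    interpret real_distribution semicircle by (rule real_distribution_semicircle)
    show ?thesis
      unfolding cauchy_transform_dilate[OF real_distribution_semicircle pos] using prob_space by (simp add: True)
  next
    case False
    then have c0: "c > 0" using c by simp
    let ?u = "z / of_real c"
    have e: "z + of_real (c\<^sup>2) / z = of_real c * (?u + 1 / ?u)"
      using c0 z0 by (simp add: field_simps power2_eq_square)
    then have "Im (of_real c * (?u + 1 / ?u)) > 0" using pos by simp
    then have u: "Im (?u + 1 / ?u) > 0" using c0 by (simp add: zero_less_mult_iff)
    have un: "norm ?u > 1" using nz c0 by (simp add: norm_divide less_divide_eq)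
    have "cauchy_transform (dilate c semicircle) (z + of_real (c\<^sup>2) / z)
        = (\<integral>x. 1 / (z + of_real (c\<^sup>2) / z - complex_of_real (c * x)) \<partial>semicircle)"
      by (rule cauchy_transform_dilate[OF real_distribution_semicircle pos])
    also have "\<dots> = (\<integral>x. (1 / of_real c) * (1 / (?u + 1 / ?u - complex_of_real x)) \<partial>semicircle)"
      unfolding e
    proof (intro Bochner_Integration.integral_cong refl)
      fix x
      have "of_real c * (?u + 1 / ?u) - complex_of_real (c * x) = of_real c * (?u + 1 / ?u - complex_of_real x)"
        by (simp add: algebra_simps)
      then show "1 / (of_real c * (?u + 1 / ?u) - complex_of_real (c * x)) = (1 / of_real c) * (1 / (?u + 1 / ?u - complex_of_real x))"
        by (metis mult_1 times_divide_times_eq)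
    qed
    also have "\<dots> = (1 / of_real c) * cauchy_transform semicircle (?u + 1 / ?u)"
      unfolding cauchy_transform_def by (rule integral_mult_right_zero)
    also have "\<dots> = 1 / z" unfolding cauchy_transform_semicircle[OF un u] using c0 by simp
    finally show ?thesis by simp
  qed
qed

section \<open>Asymptotic expansions along the imaginary axis\<close>

text \<open>The values of 1/w at the sample points w = i j of the imaginary axis. At j = 0 division
  by zero gives 0, which does no harm to estimates for large j.\<close>

definition recip_im :: "nat \<Rightarrow> complex" where
  "recip_im j = 1 / (\<i> * of_nat j)"

text \<open>An asymptotic expansion in the sense of Poincare, truncated at order \<open>N\<close>.
  The coefficients sit in a formal power series, so that products, inverses and compositions can be
  computed formally although the moment series may diverge.\<close>

definition expands_upto :: "nat \<Rightarrow> (nat \<Rightarrow> complex) \<Rightarrow> complex fps \<Rightarrow> bool" where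
  "expands_upto N f A \<longleftrightarrow> (\<lambda>j. f j - (\<Sum>k<N. fps_nth A k * recip_im j ^ k)) \<in> O(\<lambda>j. recip_im j ^ N)"

lemma recip_im_power_bigo: "M \<le> N \<Longrightarrow> (\<lambda>j. recip_im j ^ N) \<in> O(\<lambda>j. recip_im j ^ M)"
proof (rule bigoI[of _ 1], rule always_eventually, rule allI)
  fix j assume "M \<le> N"
  have "norm (recip_im j) \<le> 1" by (cases j) (auto simp: recip_im_def norm_divide norm_mult divide_le_eq simp del: of_nat_Suc)
  then show "norm (recip_im j ^ N) \<le> 1 * norm (recip_im j ^ M)"
    using \<open>M \<le> N\<close> unfolding norm_power mult_1 by (intro power_decreasing) auto
qed

lemma recip_im_tendsto_0: "recip_im \<longlonglongrightarrow> 0"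
proof (rule Lim_null_comparison)
  show "\<forall>\<^sub>F j in sequentially. norm (recip_im j) \<le> 1 / real j"
    by (rule always_eventually) (simp add: recip_im_def norm_divide norm_mult)
  show "(\<lambda>j. 1 / real j) \<longlonglongrightarrow> 0" by (rule lim_const_over_n)
qed

lemma expands_upto_diff:
  assumes "expands_upto N f A" "(\<lambda>j. g j - f j) \<in> O(\<lambda>j. recip_im j ^ N)"
  shows "expands_upto N g A"
proof -
  have "(\<lambda>j. (g j - f j) + (f j - (\<Sum>k<N. fps_nth A k * recip_im j ^ k))) \<in> O(\<lambda>j. recip_im j ^ N)"
    using assms unfolding expands_upto_def by (rule sum_in_bigo(1)[rotated])
  then show ?thesis unfolding expands_upto_def by simp
qed

lemma expands_upto_eventually_cong:
  assumes "expands_upto N f A" "\<forall>\<^sub>F j in sequentially. g j = f j"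
  shows "expands_upto N g A"
proof (rule expands_upto_diff[OF assms(1)])
  have "\<forall>\<^sub>F j in sequentially. norm (g j - f j) \<le> 1 * norm (recip_im j ^ N)"
    using assms(2) by eventually_elim simp
  then show "(\<lambda>j. g j - f j) \<in> O(\<lambda>j. recip_im j ^ N)" by (rule bigoI)
qed

lemma expands_upto_cong: "expands_upto N f A \<Longrightarrow> (\<And>k. k < N \<Longrightarrow> fps_nth A k = fps_nth B k) \<Longrightarrow> expands_upto N f B"
  unfolding expands_upto_def by simp

lemma expands_upto_le:
  assumes "expands_upto N f A" "M \<le> N"
  shows "expands_upto M f A"
  using assms(2,1)
proof (induction rule: inc_induct)
  case (step n)
  then have e: "expands_upto (Suc n) f A" by simp
  have "(\<lambda>j. (f j - (\<Sum>k<Suc n. fps_nth A k * recip_im j ^ k)) + fps_nth A n * recip_im j ^ n) \<in> O(\<lambda>j. recip_im j ^ n)"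
  proof (rule sum_in_bigo(1))
    show "(\<lambda>j. f j - (\<Sum>k<Suc n. fps_nth A k * recip_im j ^ k)) \<in> O(\<lambda>j. recip_im j ^ n)"
      using e recip_im_power_bigo[of n "Suc n"] unfolding expands_upto_def by (auto intro: landau_o.big_trans)
    show "(\<lambda>j. fps_nth A n * recip_im j ^ n) \<in> O(\<lambda>j. recip_im j ^ n)" by simp
  qed
  then show ?case unfolding expands_upto_def by simp
qed

lemma expands_upto_bigo_1:
  assumes "expands_upto N f A" shows "f \<in> O(\<lambda>_. 1)"
  using expands_upto_le[OF assms, of 0] by (simp add: expands_upto_def)

lemma expands_upto_add:
  assumes "expands_upto N f A" "expands_upto N g B"
  shows "expands_upto N (\<lambda>j. f j + g j) (A + B)"
proof -
  have "(\<lambda>j. (f j - (\<Sum>k<N. fps_nth A k * recip_im j ^ k)) + (g j - (\<Sum>k<N. fps_nth B k * recip_im j ^ k))) \<in> O(\<lambda>j. recip_im j ^ N)"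
    using assms unfolding expands_upto_def by (rule sum_in_bigo(1))
  then show ?thesis unfolding expands_upto_def by (simp add: ring_distribs sum.distrib add_diff_add)
qed

lemma expands_upto_cmult:
  assumes "expands_upto N f A"
  shows "expands_upto N (\<lambda>j. c * f j) (fps_const c * A)"
proof -
  have "(\<lambda>j. c * (f j - (\<Sum>k<N. fps_nth A k * recip_im j ^ k))) \<in> O(\<lambda>j. recip_im j ^ N)"
    using assms unfolding expands_upto_def by simp
  then show ?thesis unfolding expands_upto_def by (simp add: right_diff_distrib sum_distrib_left mult.assoc)
qed

lemma expands_upto_const: "expands_upto N (\<lambda>_. c) (fps_const c)"
proof (cases N)
  case (Suc n)
  then show ?thesis unfolding expands_upto_def by (simp add: sum.lessThan_Suc_shift del: sum.lessThan_Suc)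
qed (simp add: expands_upto_def)

lemma expands_upto_sum:
  assumes "finite I" "\<And>i. i \<in> I \<Longrightarrow> expands_upto N (f i) (A i)"
  shows "expands_upto N (\<lambda>j. \<Sum>i\<in>I. f i j) (\<Sum>i\<in>I. A i)"
  using assms
proof (induction I rule: finite_induct)
  case empty
  then show ?case using expands_upto_const[of N 0] by simp
qed (simp add: expands_upto_add)

lemma expands_upto_shift:
  assumes "expands_upto N f A"
  shows "expands_upto (Suc N) (\<lambda>j. recip_im j * f j) (fps_X * A)"
proof -
  have "(\<lambda>j. recip_im j * (f j - (\<Sum>k<N. fps_nth A k * recip_im j ^ k))) \<in> O(\<lambda>j. recip_im j * recip_im j ^ N)"
    using assms unfolding expands_upto_def by (intro landau_o.big.mult) auto
  then show ?thesis unfolding expands_upto_def sum.lessThan_Suc_shift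
    by (simp add: right_diff_distrib sum_distrib_left mult.left_commute)
qed

lemma expands_upto_power_shift:
  assumes "expands_upto N f A"
  shows "expands_upto N (\<lambda>j. recip_im j ^ i * f j) (fps_X ^ i * A)"
proof (induction i)
  case (Suc i)
  from expands_upto_le[OF expands_upto_shift[OF Suc]] show ?case by (simp add: mult.assoc)
qed (use assms in simp)

text \<open>Replacing \<open>f\<close> by its truncation costs an error of order \<open>N\<close>
  because \<open>g\<close> is bounded; what remains is a finite combination of shifts of
  \<open>g\<close>.\<close>

lemma expands_upto_mult:
  assumes f: "expands_upto N f A" and g: "expands_upto N g B"
  shows "expands_upto N (\<lambda>j. f j * g j) (A * B)"
proof (rule expands_upto_cong, rule expands_upto_diff)
  show "expands_upto N (\<lambda>j. \<Sum>i<N. fps_nth A i * (recip_im j ^ i * g j)) (\<Sum>i<N. fps_const (fps_nth A i) * (fps_X ^ i * B))"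
    by (intro expands_upto_sum expands_upto_cmult expands_upto_power_shift g) simp
  have "(\<lambda>j. (f j - (\<Sum>k<N. fps_nth A k * recip_im j ^ k)) * g j) \<in> O(\<lambda>j. recip_im j ^ N * 1)"
    using f unfolding expands_upto_def by (intro landau_o.big.mult expands_upto_bigo_1[OF g]) auto
  then show "(\<lambda>j. f j * g j - (\<Sum>i<N. fps_nth A i * (recip_im j ^ i * g j))) \<in> O(\<lambda>j. recip_im j ^ N)"
    by (simp add: left_diff_distrib sum_distrib_right mult.assoc)
  fix k assume k: "k < N"
  have c: "fps_nth (\<Sum>i<N. fps_const (fps_nth A i) * fps_X ^ i) m = (if m < N then fps_nth A m else 0)" for m
    by (simp add: fps_sum_nth fps_X_power_nth if_distrib cong: if_cong)
  have "fps_nth (\<Sum>i<N. fps_const (fps_nth A i) * (fps_X ^ i * B)) k = fps_nth ((\<Sum>i<N. fps_const (fps_nth A i) * fps_X ^ i) * B) k"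
    by (simp only: sum_distrib_right mult.assoc)
  also have "\<dots> = fps_nth (A * B) k"
    unfolding fps_mult_nth c using k by (intro sum.cong) auto
  finally show "fps_nth (\<Sum>i<N. fps_const (fps_nth A i) * (fps_X ^ i * B)) k = fps_nth (A * B) k" .
qed

lemma expands_upto_power:
  assumes "expands_upto N f A" shows "expands_upto N (\<lambda>j. f j ^ n) (A ^ n)"
proof (induction n)
  case 0
  then show ?case using expands_upto_const[of N 1] by simp
qed (simp add: expands_upto_mult[OF assms])

text \<open>Let S be the truncation of the formal inverse. The product rule makes f S - 1 of order
  \<open>N\<close>, and dividing by \<open>f\<close>, which is bounded away from 0 eventually,
  preserves this.\<close>

lemma expands_upto_inverse:
  assumes f: "expands_upto N f A" and N: "N \<ge> 1" and A: "fps_nth A 0 \<noteq> 0"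
  shows "expands_upto N (\<lambda>j. 1 / f j) (inverse A)"
proof -
  have "(\<lambda>j. f j - fps_nth A 0) \<in> O(recip_im)" using expands_upto_le[OF f N] by (simp add: expands_upto_def)
  then obtain C where C: "\<forall>\<^sub>F j in sequentially. norm (f j - fps_nth A 0) \<le> C * norm (recip_im j)"
    by (rule landau_o.bigE)
  have "(\<lambda>j. C * norm (recip_im j)) \<longlonglongrightarrow> C * norm (0::complex)" by (intro tendsto_intros recip_im_tendsto_0)
  then have "(\<lambda>j. f j - fps_nth A 0) \<longlonglongrightarrow> 0" using C by (intro Lim_null_comparison[OF C]) simp
  then have "f \<longlonglongrightarrow> fps_nth A 0" by (rule LIM_zero_cancel)
  then have "(\<lambda>j. norm (f j)) \<longlonglongrightarrow> norm (fps_nth A 0)" by (rule tendsto_norm)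
  then have ev: "\<forall>\<^sub>F j in sequentially. norm (f j) > norm (fps_nth A 0) / 2"
    by (rule order_tendstoD(1)) (use A in simp)
  have b: "(\<lambda>j. 1 / f j) \<in> O(\<lambda>_. 1)"
  proof (rule bigoI[of _ "2 / norm (fps_nth A 0)"])
    show "\<forall>\<^sub>F j in sequentially. norm (1 / f j) \<le> 2 / norm (fps_nth A 0) * norm (1::complex)"
      using ev
    proof eventually_elim
      fix j assume j: "norm (fps_nth A 0) / 2 < norm (f j)"
      have "1 / norm (f j) \<le> 1 / (norm (fps_nth A 0) / 2)" using j A by (intro frac_le) auto
      then show "norm (1 / f j) \<le> 2 / norm (fps_nth A 0) * norm (1::complex)" by (simp add: norm_divide)
    qed
  qed
  define S where "S j = (\<Sum>k<N. fps_nth (inverse A) k * recip_im j ^ k)" for j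
  have S: "expands_upto N S (inverse A)" unfolding expands_upto_def S_def by simp
  have "expands_upto N (\<lambda>j. f j * S j) (A * inverse A)" by (rule expands_upto_mult[OF f S])
  moreover have "A * inverse A = fps_const 1" using inverse_mult_eq_1[OF A] by (simp add: mult.commute)
  ultimately have "expands_upto N (\<lambda>j. f j * S j) (fps_const 1)" by (simp only:)
  moreover have "(\<Sum>k<N. fps_nth (fps_const 1) k * recip_im j ^ k) = 1" for j
    using N by (cases N) (simp_all add: sum.lessThan_Suc_shift del: sum.lessThan_Suc)
  ultimately have "(\<lambda>j. f j * S j - 1) \<in> O(\<lambda>j. recip_im j ^ N)"
    unfolding expands_upto_def by (simp only:)
  then have "(\<lambda>j. - (f j * S j - 1) * (1 / f j)) \<in> O(\<lambda>j. recip_im j ^ N * 1)"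
    by (intro landau_o.big.mult b) (simp only: landau_o.big.uminus_in_iff)
  moreover have "\<forall>\<^sub>F j in sequentially. - (f j * S j - 1) * (1 / f j) = 1 / f j - S j"
    using ev
  proof eventually_elim
    fix j assume "norm (fps_nth A 0) / 2 < norm (f j)"
    then have "f j \<noteq> 0" using A by auto
    then show "- (f j * S j - 1) * (1 / f j) = 1 / f j - S j" by (simp add: field_simps)
  qed
  ultimately have "(\<lambda>j. 1 / f j - S j) \<in> O(\<lambda>j. recip_im j ^ N)"
    by (simp add: landau_o.big.in_cong)
  then show ?thesis unfolding expands_upto_def S_def .
qed

section \<open>Moments as coefficients of the Cauchy transform\<close>

lemma cauchy_kernel_expansion:
  fixes w x :: complex
  assumes "w \<noteq> 0" "w \<noteq> x"
  shows "1 / (w - x) = (\<Sum>k<N. x ^ k * (1 / w) ^ Suc k) + (1 / w) ^ N * (x ^ N * (1 / (w - x)))"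
proof (induction N)
  case (Suc N)
  have "(1 / w) ^ N * (x ^ N * (1 / (w - x))) = x ^ N * (1 / w) ^ Suc N + (1 / w) ^ Suc N * (x ^ Suc N * (1 / (w - x)))"
  proof -
    have "1 / (w - x) = 1 / w + 1 / w * (x * (1 / (w - x)))"
      using assms by (simp add: divide_simps)
    from arg_cong[OF this, of "\<lambda>t. (1 / w) ^ N * (x ^ N * t)"] show ?thesis by (simp add: algebra_simps)
  qed
  then show ?case by (subst Suc.IH) (simp only: sum.lessThan_Suc add.assoc)
qed simp

lemma abs_power_le: "k \<le> m \<Longrightarrow> \<bar>x::real\<bar> ^ k \<le> 1 + \<bar>x\<bar> ^ m"
proof (cases "\<bar>x\<bar> \<le> 1")
  case True
  then have "\<bar>x\<bar> ^ k \<le> 1" by (intro power_le_one) auto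
  moreover have "0 \<le> \<bar>x\<bar> ^ m" by simp
  ultimately show ?thesis by linarith
next
  case False
  assume "k \<le> m"
  then have "\<bar>x\<bar> ^ k \<le> \<bar>x\<bar> ^ m" using False by (intro power_increasing) auto
  then show ?thesis by simp
qed

context real_distribution
begin

lemma integrable_power_le:
  assumes "integrable M (\<lambda>x. x ^ m)" "k \<le> m"
  shows "integrable M (\<lambda>x. x ^ k)"
proof (rule Bochner_Integration.integrable_bound)
  show "integrable M (\<lambda>x. 1 + \<bar>x ^ m\<bar>)" by (intro Bochner_Integration.integrable_add integrable_abs assms) simp
  show "AE x in M. norm (x ^ k) \<le> norm (1 + \<bar>x ^ m\<bar>)"
    using abs_power_le[OF assms(2)] by (intro AE_I2) (simp add: power_abs)
qed (simp add: borel_measurable_continuous)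

lemma cauchy_transform_expansion:
  assumes N: "integrable M (\<lambda>x. x ^ N)" and w: "Im w > 0"
  shows "integrable M (\<lambda>x. complex_of_real (x ^ N) * (1 / (w - complex_of_real x)))"
    and "cauchy_transform M w = (\<Sum>k<N. complex_of_real (\<integral>x. x ^ k \<partial>M) * (1 / w) ^ Suc k)
      + (1 / w) ^ N * (\<integral>x. complex_of_real (x ^ N) * (1 / (w - complex_of_real x)) \<partial>M)"
proof -
  have w0: "w \<noteq> 0" using w by auto
  note nz = cauchy_kernel_nonzero[OF w]
  show i: "integrable M (\<lambda>x. complex_of_real (x ^ N) * (1 / (w - complex_of_real x)))"
  proof (rule Bochner_Integration.integrable_bound)
    show "integrable M (\<lambda>x. \<bar>x ^ N\<bar> * (1 / Im w))" by (intro integrable_mult_left integrable_abs N)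
    show "(\<lambda>x. complex_of_real (x ^ N) * (1 / (w - complex_of_real x))) \<in> borel_measurable M"
      by (intro borel_measurable_continuous isCont_mult isCont_cauchy_kernel w continuous_intros)
    show "AE x in M. norm (complex_of_real (x ^ N) * (1 / (w - complex_of_real x))) \<le> norm (\<bar>x ^ N\<bar> * (1 / Im w))"
    proof (rule AE_I2)
      fix x
      have "norm (complex_of_real (x ^ N) * (1 / (w - complex_of_real x))) \<le> \<bar>x ^ N\<bar> * (1 / Im w)"
        unfolding norm_mult norm_of_real by (intro mult_left_mono norm_cauchy_kernel_le w) simp
      then show "norm (complex_of_real (x ^ N) * (1 / (w - complex_of_real x))) \<le> norm (\<bar>x ^ N\<bar> * (1 / Im w))"
        unfolding real_norm_def by linarith
    qed
  qed
  have ik: "integrable M (\<lambda>x. complex_of_real (x ^ k) * (1 / w) ^ Suc k)" if "k < N" for k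
    using that by (intro integrable_mult_left integrable_of_real integrable_power_le[OF N]) simp
  have "cauchy_transform M w = (\<integral>x. (\<Sum>k<N. complex_of_real (x ^ k) * (1 / w) ^ Suc k)
      + (1 / w) ^ N * (complex_of_real (x ^ N) * (1 / (w - complex_of_real x))) \<partial>M)"
    unfolding cauchy_transform_def
  proof (intro Bochner_Integration.integral_cong refl)
    fix x
    have "w \<noteq> complex_of_real x" using nz[of x] by auto
    from cauchy_kernel_expansion[OF w0 this, of N]
    show "1 / (w - complex_of_real x) = (\<Sum>k<N. complex_of_real (x ^ k) * (1 / w) ^ Suc k)
      + (1 / w) ^ N * (complex_of_real (x ^ N) * (1 / (w - complex_of_real x)))" by (simp only: of_real_power)
  qed
  also have "\<dots> = (\<integral>x. (\<Sum>k<N. complex_of_real (x ^ k) * (1 / w) ^ Suc k) \<partial>M)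
      + (\<integral>x. (1 / w) ^ N * (complex_of_real (x ^ N) * (1 / (w - complex_of_real x))) \<partial>M)"
    by (intro Bochner_Integration.integral_add Bochner_Integration.integrable_sum ik integrable_mult_right i) simp
  also have "(\<integral>x. (\<Sum>k<N. complex_of_real (x ^ k) * (1 / w) ^ Suc k) \<partial>M)
      = (\<Sum>k<N. \<integral>x. complex_of_real (x ^ k) * (1 / w) ^ Suc k \<partial>M)"
    by (intro Bochner_Integration.integral_sum ik) simp
  finally show "cauchy_transform M w = (\<Sum>k<N. complex_of_real (\<integral>x. x ^ k \<partial>M) * (1 / w) ^ Suc k)
      + (1 / w) ^ N * (\<integral>x. complex_of_real (x ^ N) * (1 / (w - complex_of_real x)) \<partial>M)"
    by (simp only: integral_mult_right_zero integral_mult_left_zero integral_complex_of_real)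
qed

lemma expands_upto_cauchy_transform:
  assumes "\<And>n. integrable M (\<lambda>x. x ^ n)"
  shows "expands_upto N (\<lambda>j. cauchy_transform M (\<i> * of_nat j))
    (fps_X * Abs_fps (\<lambda>n. complex_of_real (\<integral>x. x ^ n \<partial>M)))"
proof (rule expands_upto_le[of "Suc N"])
  \<comment> \<open>The remainder integral is itself of first order in 1/w, so N terms together with
    the factor \<open>recip_im j ^ N\<close> give an expansion of order N + 1.\<close>
  let ?R = "\<lambda>j. \<integral>x. complex_of_real (x ^ N) * (1 / (\<i> * of_nat j - complex_of_real x)) \<partial>M"
  define E where "E = (\<integral>x. \<bar>x ^ N\<bar> \<partial>M)"
  have "\<forall>\<^sub>F j in sequentially. norm (recip_im j ^ N * ?R j) \<le> E * norm (recip_im j ^ Suc N)"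
    using eventually_gt_at_top[of 0]
  proof eventually_elim
    fix j :: nat assume "0 < j"
    then have w: "Im (\<i> * of_nat j) > 0" by simp
    note i = cauchy_transform_expansion(1)[OF assms w, of N]
    have "norm (?R j) \<le> (\<integral>x. norm (complex_of_real (x ^ N) * (1 / (\<i> * of_nat j - complex_of_real x))) \<partial>M)"
      by (rule integral_norm_bound)
    also have "\<dots> \<le> (\<integral>x. \<bar>x ^ N\<bar> * (1 / Im (\<i> * of_nat j)) \<partial>M)"
    proof (intro integral_mono integrable_norm i integrable_mult_left integrable_abs assms)
      fix x show "norm (complex_of_real (x ^ N) * (1 / (\<i> * of_nat j - complex_of_real x))) \<le> \<bar>x ^ N\<bar> * (1 / Im (\<i> * of_nat j))"
        unfolding norm_mult norm_of_real by (intro mult_left_mono norm_cauchy_kernel_le w) simp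
    qed
    also have "\<dots> = E * norm (recip_im j)"
      unfolding integral_mult_left_zero E_def[symmetric] by (simp add: recip_im_def norm_divide norm_mult)
    finally have "norm (recip_im j ^ N) * norm (?R j) \<le> norm (recip_im j ^ N) * (E * norm (recip_im j))"
      by (rule mult_left_mono) simp
    then show "norm (recip_im j ^ N * ?R j) \<le> E * norm (recip_im j ^ Suc N)"
      by (simp add: norm_mult norm_power mult_ac)
  qed
  then have R: "(\<lambda>j. recip_im j ^ N * ?R j) \<in> O(\<lambda>j. recip_im j ^ Suc N)" by (rule bigoI)
  show "expands_upto (Suc N) (\<lambda>j. cauchy_transform M (\<i> * of_nat j))
    (fps_X * Abs_fps (\<lambda>n. complex_of_real (\<integral>x. x ^ n \<partial>M)))"
  proof (rule expands_upto_eventually_cong)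
    show "expands_upto (Suc N) (\<lambda>j. (\<Sum>k<Suc N. fps_nth (fps_X * Abs_fps (\<lambda>n. complex_of_real (\<integral>x. x ^ n \<partial>M))) k * recip_im j ^ k) + recip_im j ^ N * ?R j)
      (fps_X * Abs_fps (\<lambda>n. complex_of_real (\<integral>x. x ^ n \<partial>M)))"
      unfolding expands_upto_def add_diff_cancel_left' by (rule R)
    show "\<forall>\<^sub>F j in sequentially. cauchy_transform M (\<i> * of_nat j) =
      (\<Sum>k<Suc N. fps_nth (fps_X * Abs_fps (\<lambda>n. complex_of_real (\<integral>x. x ^ n \<partial>M))) k * recip_im j ^ k) + recip_im j ^ N * ?R j"
      using eventually_gt_at_top[of 0]
    proof eventually_elim
      fix j :: nat assume "0 < j"
      then have w: "Im (\<i> * of_nat j) > 0" by simp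
      show "cauchy_transform M (\<i> * of_nat j) =
        (\<Sum>k<Suc N. fps_nth (fps_X * Abs_fps (\<lambda>n. complex_of_real (\<integral>x. x ^ n \<partial>M))) k * recip_im j ^ k) + recip_im j ^ N * ?R j"
        unfolding cauchy_transform_expansion(2)[OF assms w, of N] sum.lessThan_Suc_shift recip_im_def[symmetric] by simp
    qed
  qed
qed simp

text \<open>Fatou turns convergence of the integrals into integrability of \<open>f\<close>, and
  then \<open>f\<close> itself is a majorant for dominated convergence. It yields existence and
  value of a moment at once.\<close>

lemma integral_eq_of_fatou:
  fixes f :: "real \<Rightarrow> real" and F :: "nat \<Rightarrow> real \<Rightarrow> real"
  assumes [measurable]: "f \<in> borel_measurable M" and F: "\<And>j. integrable M (F j)"
    and le: "\<And>j x. 0 \<le> F j x" "\<And>j x. F j x \<le> f x"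
    and lim: "\<And>x. (\<lambda>j. F j x) \<longlonglongrightarrow> f x" and int: "(\<lambda>j. \<integral>x. F j x \<partial>M) \<longlonglongrightarrow> c"
  shows "integrable M f" "(\<integral>x. f x \<partial>M) = c"
proof -
  have [measurable]: "\<And>j. F j \<in> borel_measurable M" using F by auto
  have f0: "0 \<le> f x" for x using le order_trans by blast
  have "(\<integral>\<^sup>+x. ennreal (f x) \<partial>M) = (\<integral>\<^sup>+x. liminf (\<lambda>j. ennreal (F j x)) \<partial>M)"
  proof (intro nn_integral_cong)
    fix x
    have "(\<lambda>j. ennreal (F j x)) \<longlonglongrightarrow> ennreal (f x)" by (intro tendsto_ennrealI lim)
    then show "ennreal (f x) = liminf (\<lambda>j. ennreal (F j x))" by (intro lim_imp_Liminf[symmetric]) auto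
  qed
  also have "\<dots> \<le> liminf (\<lambda>j. \<integral>\<^sup>+x. ennreal (F j x) \<partial>M)" by (rule nn_integral_liminf) simp
  also have "(\<lambda>j. \<integral>\<^sup>+x. ennreal (F j x) \<partial>M) = (\<lambda>j. ennreal (\<integral>x. F j x \<partial>M))"
    by (intro ext nn_integral_eq_integral F) (use le in auto)
  also have "liminf (\<lambda>j. ennreal (\<integral>x. F j x \<partial>M)) = ennreal c"
    by (intro lim_imp_Liminf tendsto_ennrealI int) auto
  finally have "(\<integral>\<^sup>+x. ennreal (f x) \<partial>M) < \<infinity>" using ennreal_less_top[of c] by (simp add: le_less_trans)
  then show i: "integrable M f" using f0 by (intro integrableI_nonneg) auto
  have "(\<lambda>j. \<integral>x. F j x \<partial>M) \<longlonglongrightarrow> (\<integral>x. f x \<partial>M)"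
    by (rule integral_dominated_convergence[OF _ _ i]) (use lim le in \<open>auto simp: abs_le_iff intro: order_trans[of _ 0]\<close>)
  then show "(\<integral>x. f x \<partial>M) = c" using int LIMSEQ_unique by blast
qed

end

section \<open>Moments of the perturbed measure\<close>

context real_distribution
begin

text \<open>The Hamburger-Nevanlinna argument, two moments at a time. At z = i y the real and
  imaginary parts of the next remainder are integrals of the powers m + 1 and m against the cutoff
  \<open>y\<^sup>2 / (x\<^sup>2 + y\<^sup>2)\<close>, which rises to 1; the expansion supplies the
  limits of these integrals.\<close>

lemma moments_from_expansion:
  fixes y c :: "nat \<Rightarrow> real"
  assumes y: "filterlim y at_top sequentially" "\<And>j. y j > 0" and c0: "c 0 = 1"
    and exp: "\<And>N. (\<lambda>j. cauchy_transform M (\<i> * of_real (y j)) -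
        (\<Sum>k<N. of_real (c k) * (1 / (\<i> * of_real (y j))) ^ Suc k)) \<in> O(\<lambda>j. (1 / (\<i> * of_real (y j))) ^ Suc N)"
  shows "integrable M (\<lambda>x. x ^ n)" "(\<integral>x. x ^ n \<partial>M) = c n"
proof -
  have "integrable M (\<lambda>x. x ^ (2 * n)) \<and> (\<forall>k\<le>2 * n. (\<integral>x. x ^ k \<partial>M) = c k)" for n
  proof (induction n)
    case 0
    then show ?case using c0 prob_space by simp
  next
    case (Suc n)
    then have int: "integrable M (\<lambda>x. x ^ (2 * n))" and mom: "\<And>k. k \<le> 2 * n \<Longrightarrow> (\<integral>x. x ^ k \<partial>M) = c k" by auto
    define m where "m = Suc (2 * n)"
    define P where "P j x = (y j)\<^sup>2 / (x\<^sup>2 + (y j)\<^sup>2)" for j x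
    have den: "x\<^sup>2 + (y j)\<^sup>2 > 0" for j x using y(2)[of j] by (simp add: add_nonneg_pos)
    have P: "0 \<le> P j x" "P j x \<le> 1" for j x using den[of x j] by (auto simp: P_def)
    have Plim: "(\<lambda>j. P j x) \<longlonglongrightarrow> 1" for x
    proof -
      have "((\<lambda>t::real. t\<^sup>2 / (x\<^sup>2 + t\<^sup>2)) \<longlongrightarrow> 1) at_top" by real_asymp
      from filterlim_compose[OF this y(1)] show ?thesis by (simp add: P_def)
    qed
    define z where "z j = \<i> * complex_of_real (y j)" for j
    have zim: "Im (z j) > 0" "z j \<noteq> 0" for j using y(2)[of j] by (auto simp: z_def)
    have kern: "(z j)\<^sup>2 * (complex_of_real (x ^ m) * (1 / (z j - complex_of_real x)))
        = Complex (x ^ Suc m * P j x) (y j * (x ^ m * P j x))" for j x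
    proof -
      have nz: "z j - complex_of_real x \<noteq> 0" by (rule cauchy_kernel_nonzero[OF zim(1)])
      have d: "complex_of_real (x\<^sup>2 + (y j)\<^sup>2) \<noteq> 0" using den[of x j] by (simp only: of_real_eq_0_iff)
      have "(z j - complex_of_real x) * (- complex_of_real x - \<i> * complex_of_real (y j)) = complex_of_real (x\<^sup>2 + (y j)\<^sup>2)"
        by (simp add: z_def complex_eq_iff power2_eq_square algebra_simps)
      moreover have "1 / a = b / d" if "a * b = d" "a \<noteq> 0" "d \<noteq> 0" for a b d :: complex
        using that by (simp add: divide_eq_eq mult.commute)
      ultimately have "1 / (z j - complex_of_real x) = (- complex_of_real x - \<i> * complex_of_real (y j)) / complex_of_real (x\<^sup>2 + (y j)\<^sup>2)"
        using nz d by blast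
      then have "(z j)\<^sup>2 * (complex_of_real (x ^ m) * (1 / (z j - complex_of_real x)))
          = (z j)\<^sup>2 * (- complex_of_real x - \<i> * complex_of_real (y j)) * complex_of_real (x ^ m / (x\<^sup>2 + (y j)\<^sup>2))"
        by (simp only: of_real_divide) (simp add: mult_ac)
      also have "\<dots> = Complex (x ^ Suc m * P j x) (y j * (x ^ m * P j x))"
      proof -
        have z2: "(z j)\<^sup>2 = complex_of_real (- ((y j)\<^sup>2))" by (simp add: z_def power_mult_distrib)
        show ?thesis unfolding z2 by (simp add: complex_eq_iff P_def mult_ac)
      qed
      finally show ?thesis .
    qed
    define R where "R j = (\<integral>x. complex_of_real (x ^ m) * (1 / (z j - complex_of_real x)) \<partial>M)" for j
    \<comment> \<open>Only the power 2 n is known to be integrable here. Since \<open>z j\<close> is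
      imaginary, |x| is at most |z j - x|, which absorbs the additional factor x.\<close>
    have iR: "integrable M (\<lambda>x. complex_of_real (x ^ m) * (1 / (z j - complex_of_real x)))" for j
    proof (rule Bochner_Integration.integrable_bound)
      show "integrable M (\<lambda>x. \<bar>x ^ (2 * n)\<bar>)" by (intro integrable_abs int)
      show "(\<lambda>x. complex_of_real (x ^ m) * (1 / (z j - complex_of_real x))) \<in> borel_measurable M"
        by (intro borel_measurable_continuous isCont_mult isCont_cauchy_kernel zim continuous_intros)
      show "AE x in M. norm (complex_of_real (x ^ m) * (1 / (z j - complex_of_real x))) \<le> norm \<bar>x ^ (2 * n)\<bar>"
      proof (rule AE_I2)
        fix x
        have nz: "norm (z j - complex_of_real x) > 0" using cauchy_kernel_nonzero[OF zim(1), of j x] by simp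
        have "\<bar>x\<bar> \<le> norm (z j - complex_of_real x)" using abs_Re_le_cmod[of "z j - complex_of_real x"] by (simp add: z_def)
        then have "\<bar>x\<bar> * norm (1 / (z j - complex_of_real x)) \<le> 1" using nz by (simp add: norm_divide divide_le_eq)
        then have "\<bar>x ^ (2 * n)\<bar> * (\<bar>x\<bar> * norm (1 / (z j - complex_of_real x))) \<le> \<bar>x ^ (2 * n)\<bar> * 1" by (rule mult_left_mono) simp
        moreover have "\<bar>x ^ m\<bar> = \<bar>x ^ (2 * n)\<bar> * \<bar>x\<bar>" by (simp add: m_def abs_mult)
        ultimately show "norm (complex_of_real (x ^ m) * (1 / (z j - complex_of_real x))) \<le> norm \<bar>x ^ (2 * n)\<bar>"
          unfolding norm_mult norm_of_real by (simp only: mult.assoc mult_1_right real_norm_def abs_abs)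
      qed
    qed
    have iC: "integrable M (\<lambda>x. Complex (x ^ Suc m * P j x) (y j * (x ^ m * P j x)))" for j
      unfolding kern[symmetric] by (intro integrable_mult_right iR)
    have zR: "(z j)\<^sup>2 * R j = (\<integral>x. Complex (x ^ Suc m * P j x) (y j * (x ^ m * P j x)) \<partial>M)" for j
      unfolding kern[symmetric] R_def by (rule integral_mult_right_zero[symmetric])
    have i1: "integrable M (\<lambda>x. x ^ Suc m * P j x)" for j using integrable_Re[OF iC[of j]] by simp
    have i2: "integrable M (\<lambda>x. y j * (x ^ m * P j x))" for j using integrable_Im[OF iC[of j]] by simp
    have Re: "Re ((z j)\<^sup>2 * R j) = (\<integral>x. x ^ Suc m * P j x \<partial>M)" for j
      unfolding zR using integral_Re[OF iC[of j]] by simp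
    have Im: "Im ((z j)\<^sup>2 * R j) = y j * (\<integral>x. x ^ m * P j x \<partial>M)" for j
      unfolding zR using integral_Im[OF iC[of j]] by simp
    \<comment> \<open>One more term is split off: x^(2n) / (z - x) = x^(2n) / z + x^m / (z (z - x)).
      Both summands are integrable, although the power m by itself is not yet known to be.\<close>
    have G: "cauchy_transform M (z j) = (\<Sum>k<m. of_real (c k) * (1 / z j) ^ Suc k) + (1 / z j) ^ m * R j" for j
    proof -
      have "cauchy_transform M (z j) = (\<Sum>k<2 * n. complex_of_real (\<integral>x. x ^ k \<partial>M) * (1 / z j) ^ Suc k)
        + (1 / z j) ^ (2 * n) * (\<integral>x. complex_of_real (x ^ (2 * n)) * (1 / (z j - complex_of_real x)) \<partial>M)"
        by (rule cauchy_transform_expansion(2)[OF int zim(1)])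
      also have "(\<integral>x. complex_of_real (x ^ (2 * n)) * (1 / (z j - complex_of_real x)) \<partial>M)
          = (\<integral>x. (1 / z j) * complex_of_real (x ^ (2 * n)) + (1 / z j) * (complex_of_real (x ^ m) * (1 / (z j - complex_of_real x))) \<partial>M)"
      proof (intro Bochner_Integration.integral_cong refl)
        fix x
        have "1 / (z j - complex_of_real x) = 1 / z j + 1 / z j * (complex_of_real x * (1 / (z j - complex_of_real x)))"
          using zim(2)[of j] cauchy_kernel_nonzero[OF zim(1), of j x] by (simp add: divide_simps)
        from arg_cong[OF this, of "\<lambda>t. complex_of_real (x ^ (2 * n)) * t"]
        show "complex_of_real (x ^ (2 * n)) * (1 / (z j - complex_of_real x))
          = (1 / z j) * complex_of_real (x ^ (2 * n)) + (1 / z j) * (complex_of_real (x ^ m) * (1 / (z j - complex_of_real x)))"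
          unfolding m_def power_Suc of_real_mult distrib_left by (simp only: mult_ac)
      qed
      also have "\<dots> = (1 / z j) * complex_of_real (c (2 * n)) + (1 / z j) * R j"
        unfolding R_def mom[OF order_refl, symmetric]
        by (subst Bochner_Integration.integral_add, intro integrable_mult_right integrable_of_real int, intro integrable_mult_right iR)
          (simp only: integral_mult_right_zero integral_complex_of_real)
      finally show ?thesis using mom by (simp add: m_def ring_distribs mult_ac)
    qed
    \<comment> \<open>This is z^(m + 2) times the remainder after the coefficient of index m + 1, so
      it is O(1/y). As z is imaginary and its square real, the real part involves only that
      coefficient and the imaginary part only y times the one of index m.\<close>
    define T where "T j = (z j)\<^sup>2 * R j - of_real (c m) * z j - of_real (c (Suc m))" for j
    have T0: "T \<longlonglongrightarrow> 0"
    proof -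
      have "(\<lambda>j. cauchy_transform M (z j) - (\<Sum>k<Suc (Suc m). of_real (c k) * (1 / z j) ^ Suc k)) \<in> O(\<lambda>j. (1 / z j) ^ Suc (Suc (Suc m)))"
        using exp[of "Suc (Suc m)"] by (simp only: z_def)
      then obtain C where C: "\<forall>\<^sub>F j in sequentially. norm (cauchy_transform M (z j) - (\<Sum>k<Suc (Suc m). of_real (c k) * (1 / z j) ^ Suc k))
          \<le> C * norm ((1 / z j) ^ Suc (Suc (Suc m)))" by (rule landau_o.bigE)
      have e: "cauchy_transform M (z j) - (\<Sum>k<Suc (Suc m). of_real (c k) * (1 / z j) ^ Suc k) = (1 / z j) ^ Suc (Suc m) * T j" for j
      proof -
        have "T j * (1 / z j)\<^sup>2 = R j - of_real (c m) * (1 / z j) - of_real (c (Suc m)) * (1 / z j)\<^sup>2"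
          using zim(2)[of j] by (simp add: T_def diff_divide_distrib power2_eq_square)
        from arg_cong[OF this, of "\<lambda>t. (1 / z j) ^ m * t"]
        have "(1 / z j) ^ Suc (Suc m) * T j = (1 / z j) ^ m * (R j - of_real (c m) * (1 / z j) - of_real (c (Suc m)) * (1 / z j)\<^sup>2)"
          by (simp only: power_Suc power2_eq_square mult_ac)
        then show ?thesis unfolding G sum.lessThan_Suc
          by (simp only: power_Suc power2_eq_square right_diff_distrib) (simp add: algebra_simps)
      qed
      have "\<forall>\<^sub>F j in sequentially. norm (T j) \<le> C * (1 / y j)"
        using C
      proof eventually_elim
        fix j assume j: "norm (cauchy_transform M (z j) - (\<Sum>k<Suc (Suc m). of_real (c k) * (1 / z j) ^ Suc k))
          \<le> C * norm ((1 / z j) ^ Suc (Suc (Suc m)))"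
        have p: "0 < norm ((1 / z j) ^ Suc (Suc m))" using zim(2)[of j] by simp
        have "norm ((1 / z j) ^ Suc (Suc m)) * norm (T j) \<le> norm ((1 / z j) ^ Suc (Suc m)) * (C * norm (1 / z j))"
          using j unfolding e norm_mult power_Suc[of _ "Suc (Suc m)"] by (simp only: mult_ac)
        then have "norm (T j) \<le> C * norm (1 / z j)" using p by (rule mult_left_le_imp_le)
        also have "norm (1 / z j) = 1 / y j" using y(2)[of j] by (simp add: z_def norm_divide norm_mult)
        finally show "norm (T j) \<le> C * (1 / y j)" .
      qed
      moreover have "(\<lambda>j. C * (1 / y j)) \<longlonglongrightarrow> 0"
      proof -
        have "((\<lambda>t::real. C * (1 / t)) \<longlongrightarrow> 0) at_top" by real_asymp
        from filterlim_compose[OF this y(1)] show ?thesis .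
      qed
      ultimately show ?thesis by (rule Lim_null_comparison)
    qed
    have ReT: "Re (T j) = (\<integral>x. x ^ Suc m * P j x \<partial>M) - c (Suc m)" for j
      unfolding T_def minus_complex.sel Re by (simp add: z_def)
    have ImT: "Im (T j) = y j * ((\<integral>x. x ^ m * P j x \<partial>M) - c m)" for j
      unfolding T_def minus_complex.sel Im by (simp add: z_def algebra_simps)
    have "(\<lambda>j. Re (T j)) \<longlonglongrightarrow> Re 0" by (intro tendsto_Re T0)
    then have "(\<lambda>j. (\<integral>x. x ^ Suc m * P j x \<partial>M) - c (Suc m)) \<longlonglongrightarrow> 0"
      by (simp only: ReT zero_complex.sel)
    then have lim1: "(\<lambda>j. \<integral>x. x ^ Suc m * P j x \<partial>M) \<longlonglongrightarrow> c (Suc m)"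
      by (rule LIM_zero_cancel)
    have ev: "Suc m = 2 * Suc n" "even (Suc m)" by (simp_all add: m_def)
    have nn: "0 \<le> x ^ Suc m" for x :: real using ev(2) by (rule zero_le_even_power)
    \<comment> \<open>The even power comes first because Fatou needs a nonnegative integrand; the
      odd power below it is then dominated.\<close>
    have F: "integrable M (\<lambda>x. x ^ Suc m)" "(\<integral>x. x ^ Suc m \<partial>M) = c (Suc m)"
    proof -
      have "0 \<le> x ^ Suc m * P j x" for j x using nn P(1) by (rule mult_nonneg_nonneg)
      moreover have "x ^ Suc m * P j x \<le> x ^ Suc m" for j x using mult_left_mono[OF P(2) nn, of x j x] by simp
      moreover have "(\<lambda>j. x ^ Suc m * P j x) \<longlonglongrightarrow> x ^ Suc m" for x
        using tendsto_mult[OF tendsto_const Plim, of "x ^ Suc m" x] by simp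
      moreover have "(\<lambda>x. x ^ Suc m) \<in> borel_measurable M" by (intro borel_measurable_continuous continuous_intros)
      ultimately show "integrable M (\<lambda>x. x ^ Suc m)" "(\<integral>x. x ^ Suc m \<partial>M) = c (Suc m)"
        using integral_eq_of_fatou[of "\<lambda>x. x ^ Suc m" "\<lambda>j x. x ^ Suc m * P j x" "c (Suc m)"] i1 lim1 by blast+
    qed
    have "(\<lambda>j. \<integral>x. x ^ m * P j x \<partial>M) \<longlonglongrightarrow> (\<integral>x. x ^ m \<partial>M)"
    proof (rule integral_dominated_convergence[where w = "\<lambda>x. \<bar>x ^ m\<bar>"])
      show "integrable M (\<lambda>x. \<bar>x ^ m\<bar>)" by (intro integrable_abs integrable_power_le[OF F(1)]) simp
      show "AE x in M. (\<lambda>j. x ^ m * P j x) \<longlonglongrightarrow> x ^ m"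
        using tendsto_mult[OF tendsto_const Plim, of "x ^ m" x for x] by simp
      show "AE x in M. norm (x ^ m * P j x) \<le> \<bar>x ^ m\<bar>" for j
      proof (rule AE_I2)
        fix x show "norm (x ^ m * P j x) \<le> \<bar>x ^ m\<bar>"
          using mult_left_mono[OF P(2), of "\<bar>x ^ m\<bar>" j x] P(1)[of j x] by (simp add: abs_mult)
      qed
      show "(\<lambda>x. x ^ m) \<in> borel_measurable M" by (intro borel_measurable_continuous continuous_intros)
      show "(\<lambda>x. x ^ m * P j x) \<in> borel_measurable M" for j
      proof -
        have "integrable M (\<lambda>x. 1 / y j * (y j * (x ^ m * P j x)))" by (intro integrable_mult_right i2)
        then show ?thesis using y(2)[of j] by auto
      qed
    qed
    moreover have "(\<lambda>j. \<integral>x. x ^ m * P j x \<partial>M) \<longlonglongrightarrow> c m"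
    proof (rule LIM_zero_cancel)
      have "(\<lambda>j. Im (T j) * (1 / y j)) \<longlonglongrightarrow> Im 0 * 0"
      proof (intro tendsto_mult tendsto_Im T0)
        have "((\<lambda>t::real. 1 / t) \<longlongrightarrow> 0) at_top" by real_asymp
        from filterlim_compose[OF this y(1)] show "(\<lambda>j. 1 / y j) \<longlonglongrightarrow> 0" .
      qed
      moreover have "Im (T j) * (1 / y j) = (\<integral>x. x ^ m * P j x \<partial>M) - c m" for j
        unfolding ImT using y(2)[of j] by simp
      ultimately show "(\<lambda>j. (\<integral>x. x ^ m * P j x \<partial>M) - c m) \<longlonglongrightarrow> 0"
        by (simp only: mult_zero_right)
    qed
    ultimately have "(\<integral>x. x ^ m \<partial>M) = c m" by (rule LIMSEQ_unique)
    moreover have "k \<le> 2 * n \<or> k = m \<or> k = Suc m" if "k \<le> 2 * Suc n" for k using that by (auto simp: m_def)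
    ultimately show ?case using F mom unfolding ev(1) by metis
  qed
  from this[of n] show "integrable M (\<lambda>x. x ^ n)" "(\<integral>x. x ^ n \<partial>M) = c n"
    by (auto intro: integrable_power_le)
qed

end

section \<open>The power series identity behind the shift of the second cumulant\<close>

lemma noncrossing_sum_of_real:
  "noncrossing_sum (\<lambda>n. of_real (r n)) A = (of_real (noncrossing_sum r A) :: complex)"
  by (simp add: noncrossing_sum_def)

text \<open>As \<open>h\<close> has no constant term, the coefficient n of the right-hand side
  involves only lower coefficients of the unknown series, so the fixed point is determined
  recursively.\<close>

lemma fps_mult_compose_unique:
  fixes p g h F :: "complex fps"
  assumes h0: "fps_nth h 0 = 0" and p: "p = h * (F oo p)" and g: "g = h * (F oo g)"
  shows "p = g"
proof -
  have "fps_nth p n = fps_nth g n" for n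
  proof (induction n rule: less_induct)
    case (less n)
    have pw: "\<forall>k<n. fps_nth (p ^ i) k = fps_nth (g ^ i) k" for i
    proof (induction i)
      case (Suc i)
      then show ?case using less by (auto simp: fps_mult_nth intro!: sum.cong)
    qed simp
    have co: "fps_nth (F oo p) k = fps_nth (F oo g) k" if "k < n" for k
      using pw that by (simp add: fps_compose_nth)
    have "fps_nth (h * (F oo p)) n = fps_nth (h * (F oo g)) n"
      unfolding fps_mult_nth
    proof (intro sum.cong refl)
      fix i assume "i \<in> {0..n}"
      then show "fps_nth h i * fps_nth (F oo p) (n - i) = fps_nth h i * fps_nth (F oo g) (n - i)"
        using co[of "n - i"] h0 by (cases "i = 0") auto
    qed
    then show ?case using p g by simp
  qed
  then show ?thesis by (rule fps_ext)
qed

text \<open>Substituting \<open>h = q / (1 + s q g(q))\<close>, the expansion of \<open>1 / (w + s G(w))\<close> in \<open>q = 1 / w\<close>,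
  turns the generating series of the shifted cumulants into that of the original ones.\<close>

lemma noncrossing_fps_shift_second_cumulant:
  fixes r :: "nat \<Rightarrow> complex" and s :: complex
  defines "g \<equiv> fps_X * noncrossing_fps r"
  defines "h \<equiv> fps_X * inverse (1 + fps_const s * (fps_X * g))"
  shows "(fps_X * noncrossing_fps (\<lambda>n. r n + (if n = 2 then s else 0))) oo h = g"
proof -
  define r' where "r' = (\<lambda>n. r n + (if n = 2 then s else 0))"
  define D where "D = 1 + fps_const s * (fps_X * g)"
  have g0: "fps_nth g 0 = 0" and D0: "fps_nth D 0 = 1" by (simp_all add: g_def D_def)
  have h0: "fps_nth h 0 = 0" by (simp add: h_def)
  have hD: "h * D = fps_X" using inverse_mult_eq_1[of D] D0 by (simp add: h_def D_def mult.assoc)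
  let ?C = "cumulant_fps r" and ?C' = "cumulant_fps r'"
  have C': "?C' = ?C + fps_const s * fps_X ^ 2"
    by (rule fps_ext) (auto simp: cumulant_fps_def r'_def fps_X_power_nth)
  have gC: "g = fps_X * (?C oo g)" using noncrossing_fps_eq_compose[of r] by (simp only: g_def)
  \<comment> \<open>Adding \<open>s\<close> to the second cumulant adds s g^2 to the composition.
    Multiplied by \<open>fps_X\<close>, this is exactly the surplus of g D over g, so g solves the
    fixed-point equation for \<open>?C'\<close>.\<close>
  have "h * (?C' oo g) * D = fps_X * ((?C oo g) + fps_const s * g ^ 2)"
    unfolding C' fps_compose_add_distrib fps_compose_mult_distrib[OF g0] fps_const_compose fps_compose_power[OF g0, symmetric] fps_X_fps_compose_startby0[OF g0]
    using hD by (simp add: mult_ac)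
  also have "\<dots> = g + fps_const s * (fps_X * g ^ 2)"
    using gC by (simp add: distrib_left mult.left_commute)
  also have "\<dots> = g * D" by (simp add: D_def algebra_simps power2_eq_square)
  finally have ge: "g = h * (?C' oo g)" using D0 by (metis mult_right_cancel zero_neq_one fps_zero_nth)
  have pe: "(fps_X * noncrossing_fps r') oo h = h * (?C' oo ((fps_X * noncrossing_fps r') oo h))"
  proof -
    have "(fps_X * noncrossing_fps r') oo h = h * (noncrossing_fps r' oo h)"
      by (simp only: fps_compose_mult_distrib[OF h0] fps_X_fps_compose_startby0[OF h0])
    also have "noncrossing_fps r' oo h = (?C' oo (fps_X * noncrossing_fps r')) oo h"
      using noncrossing_fps_eq_compose[of r'] by (simp only:)
    also have "\<dots> = ?C' oo ((fps_X * noncrossing_fps r') oo h)"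
      by (rule fps_compose_assoc[OF h0, symmetric]) simp
    finally show ?thesis .
  qed
  from fps_mult_compose_unique[OF h0 pe ge] have "(fps_X * noncrossing_fps r') oo h = g" .
  then show ?thesis by (simp only: r'_def)
qed

text \<open>The sample points i j are sent to \<zeta> j = i j + s G(i j), where the Cauchy transform
  of \<rho> takes the value G(i j). By \<open>imag\<close> these points lie on the imaginary axis,
  so the known expansion at i j becomes one for \<rho> along that axis, from which the moments are
  read.\<close>

theorem semicircular_perturbation_moments:
  fixes r :: "nat \<Rightarrow> real"
  assumes M: "real_distribution M" and mom: "\<And>n. integrable M (\<lambda>x. x ^ n)"
    and imag: "\<And>v. v > 0 \<Longrightarrow> Re (cauchy_transform M (\<i> * of_real v)) = 0"
    and r: "\<And>n. (\<integral>x. x ^ n \<partial>M) = noncrossing_sum r {1..n}" and s: "s \<ge> 0"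
    and \<rho>: "real_distribution \<rho>"
      "\<And>w. Im w > 0 \<Longrightarrow> Im (w + of_real s * cauchy_transform M w) > 0 \<Longrightarrow>
         cauchy_transform \<rho> (w + of_real s * cauchy_transform M w) = cauchy_transform M w"
  shows "integrable \<rho> (\<lambda>x. x ^ n)"
    "(\<integral>x. x ^ n \<partial>\<rho>) = noncrossing_sum (\<lambda>n. r n + (if n = 2 then s else 0)) {1..n}"
proof -
  interpret M: real_distribution M by (rule M)
  interpret \<rho>: real_distribution \<rho> by (rule \<rho>)
  define r' where "r' n = r n + (if n = 2 then s else 0)" for n
  define c where "c n = noncrossing_sum r' {1..n}" for n :: nat
  define cr where "cr n = complex_of_real (r n)" for n
  define g where "g = fps_X * noncrossing_fps cr"
  define h where "h = fps_X * inverse (1 + fps_const (of_real s) * (fps_X * g))"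
  define G where "G j = cauchy_transform M (\<i> * of_nat j)" for j :: nat
  define \<zeta> where "\<zeta> j = \<i> * of_nat j + of_real s * G j" for j
  have Gn: "norm (G j) \<le> 1 / real j" if "j > 0" for j
    using M.norm_cauchy_transform_le[of "\<i> * of_nat j"] that by (simp add: G_def)
  have \<zeta>Re: "Re (\<zeta> j) = 0" if "j > 0" for j
    using imag[of "real j"] that by (simp add: \<zeta>_def G_def)
  have \<zeta>Im: "Im (\<zeta> j) \<ge> real j - s" if "j > 0" for j
  proof -
    have "s * norm (G j) \<le> s * 1" using Gn[OF that] that s by (intro mult_left_mono) (auto intro: order_trans)
    moreover have "s * (- Im (G j)) \<le> s * norm (G j)" using abs_Im_le_cmod[of "G j"] s by (intro mult_left_mono) auto
    ultimately show ?thesis by (simp add: \<zeta>_def)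
  qed
  \<comment> \<open>This exceeds \<open>s\<close>, and Im (\<zeta> j) is at least j - s. From
    \<open>J\<close> on the sample points are therefore in the upper half plane.\<close>
  define J where "J = nat \<lceil>s\<rceil> + 1"
  have J: "j > 0" "real j - s > 0" if "j \<ge> J" for j
  proof -
    have "s < real J" unfolding J_def by linarith
    then show "real j - s > 0" using that by linarith
    show "j > 0" using that by (simp add: J_def)
  qed
  define y where "y j = Im (\<zeta> (j + J))" for j
  have \<zeta>y: "\<zeta> (j + J) = \<i> * of_real (y j)" for j
    using \<zeta>Re[of "j + J"] J[of "j + J"] by (simp add: y_def complex_eq_iff)
  have ypos: "y j > 0" for j using \<zeta>Im[of "j + J"] J[of "j + J"] by (simp add: y_def)
  have ylim: "filterlim y at_top sequentially"
  proof (rule filterlim_at_top_mono)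
    show "filterlim (\<lambda>j. real j + (real J - s)) at_top sequentially" by real_asymp
    show "\<forall>\<^sub>F j in sequentially. real j + (real J - s) \<le> y j"
    proof (intro always_eventually allI)
      fix j show "real j + (real J - s) \<le> y j" using \<zeta>Im[of "j + J"] J[of "j + J"] by (simp add: y_def)
    qed
  qed
  have Gexp: "expands_upto N G g" for N
  proof -
    have "noncrossing_fps cr = Abs_fps (\<lambda>n. complex_of_real (\<integral>x. x ^ n \<partial>M))"
      by (rule fps_ext) (simp add: noncrossing_fps_def cr_def[abs_def] noncrossing_sum_of_real r)
    then show ?thesis using M.expands_upto_cauchy_transform[OF mom, of N] by (simp add: g_def G_def[abs_def])
  qed
  define D where "D j = 1 + of_real s * (recip_im j * G j)" for j
  have Dexp: "expands_upto N D (1 + fps_const (of_real s) * (fps_X * g))" for N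
    unfolding D_def fps_const_1_eq_1[symmetric]
    using expands_upto_power_shift[OF Gexp[of N], of 1]
    by (intro expands_upto_add expands_upto_const expands_upto_cmult) simp
  have hexp: "expands_upto (Suc N) (\<lambda>j. 1 / \<zeta> j) h" for N
  proof (rule expands_upto_eventually_cong)
    have "expands_upto (Suc N) (\<lambda>j. 1 / D j) (inverse (1 + fps_const (of_real s) * (fps_X * g)))"
      by (rule expands_upto_inverse[OF Dexp]) simp_all
    from expands_upto_power_shift[OF this, of 1]
    show "expands_upto (Suc N) (\<lambda>j. recip_im j * (1 / D j)) h" by (simp add: h_def)
    show "\<forall>\<^sub>F j in sequentially. 1 / \<zeta> j = recip_im j * (1 / D j)"
      using eventually_gt_at_top[of 0]
    proof eventually_elim
      fix j :: nat assume j: "0 < j"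
      have "\<zeta> j = \<i> * of_nat j * D j" using j by (simp add: \<zeta>_def D_def recip_im_def ring_distribs)
      then show "1 / \<zeta> j = recip_im j * (1 / D j)" by (simp add: recip_im_def)
    qed
  qed
  \<comment> \<open>The intended expansion of the Cauchy transform of \<rho> in powers of 1/\<zeta>.
    Substituting \<open>h\<close>, the expansion of 1/\<zeta> in powers of \<open>recip_im\<close>,
    must return the expansion \<open>g\<close> of G.\<close>
  let ?d = "fps_X * noncrossing_fps (\<lambda>n. cr n + (if n = 2 then of_real s else 0))"
  have dg: "?d oo h = g" unfolding g_def h_def by (rule noncrossing_fps_shift_second_cumulant)
  have dn: "fps_nth ?d (Suc k) = of_real (c k)" for k
  proof -
    have "(\<lambda>n. cr n + (if n = 2 then of_real s else 0)) = (\<lambda>n. complex_of_real (r' n))"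
      by (auto simp: cr_def r'_def)
    then show ?thesis by (simp only: fps_mult_fps_X_commute[symmetric]) (simp add: noncrossing_fps_def noncrossing_sum_of_real c_def fps_mult_fps_X_commute)
  qed
  have h0: "fps_nth h 0 = 0" by (simp add: h_def)
  have main: "(\<lambda>j. G j - (\<Sum>k<N. of_real (c k) * (1 / \<zeta> j) ^ Suc k)) \<in> O(\<lambda>j. (1 / \<zeta> j) ^ Suc N)" for N
  proof -
    let ?S = "\<lambda>j. \<Sum>k<Suc N. fps_nth ?d k * (1 / \<zeta> j) ^ k"
    have "expands_upto (Suc N) ?S (\<Sum>k<Suc N. fps_const (fps_nth ?d k) * h ^ k)"
      by (intro expands_upto_sum expands_upto_cmult expands_upto_power hexp) simp
    then have "expands_upto (Suc N) ?S g"
    proof (rule expands_upto_cong)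
      fix n assume n: "n < Suc N"
      have "fps_nth g n = (\<Sum>k=0..n. fps_nth ?d k * fps_nth (h ^ k) n)"
        unfolding dg[symmetric] by (rule fps_compose_nth)
      also have "\<dots> = (\<Sum>k<Suc N. fps_nth ?d k * fps_nth (h ^ k) n)"
        using startsby_zero_power_prefix[OF h0] n by (intro sum.mono_neutral_left) auto
      finally show "fps_nth (\<Sum>k<Suc N. fps_const (fps_nth ?d k) * h ^ k) n = fps_nth g n"
        by (simp add: fps_sum_nth del: sum.lessThan_Suc)
    qed
    note S = this
    have "(\<lambda>j. (G j - (\<Sum>k<Suc N. fps_nth g k * recip_im j ^ k)) - (?S j - (\<Sum>k<Suc N. fps_nth g k * recip_im j ^ k))) \<in> O(\<lambda>j. recip_im j ^ Suc N)"
      by (rule sum_in_bigo(2)[OF Gexp[of "Suc N", unfolded expands_upto_def] S[unfolded expands_upto_def]])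
    moreover have "?S j = (\<Sum>k<N. of_real (c k) * (1 / \<zeta> j) ^ Suc k)" for j
      unfolding sum.lessThan_Suc_shift dn by simp
    moreover have "(a - b) - (c - b) = a - c" for a b c :: complex by simp
    ultimately have A: "(\<lambda>j. G j - (\<Sum>k<N. of_real (c k) * (1 / \<zeta> j) ^ Suc k)) \<in> O(\<lambda>j. recip_im j ^ Suc N)"
      by (simp only:)
    \<comment> \<open>The error was measured in powers of \<open>recip_im j\<close>. This equals
      \<open>D j / \<zeta> j\<close> eventually and \<open>D\<close> is bounded, so it may be
      measured in powers of 1/\<zeta>.\<close>
    have "(\<lambda>j. recip_im j ^ Suc N) \<in> O(\<lambda>j. (1 / \<zeta> j) ^ Suc N)"
    proof (rule landau_o.big_power)
      have "(\<lambda>j. D j * (1 / \<zeta> j)) \<in> O(\<lambda>j. 1 * (1 / \<zeta> j))"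
        by (intro landau_o.big.mult expands_upto_bigo_1[OF Dexp[of 0]]) simp
      moreover have "\<forall>\<^sub>F j in sequentially. D j * (1 / \<zeta> j) = recip_im j"
        using eventually_ge_at_top[of J]
      proof eventually_elim
        fix j assume j: "J \<le> j"
        have "\<zeta> j = \<i> * of_nat j * D j" using J[OF j] by (simp add: \<zeta>_def D_def recip_im_def ring_distribs)
        moreover have "\<zeta> j \<noteq> 0" using \<zeta>Im[OF J(1)[OF j]] J(2)[OF j] by auto
        ultimately show "D j * (1 / \<zeta> j) = recip_im j" by (auto simp: recip_im_def)
      qed
      ultimately show "recip_im \<in> O(\<lambda>j. 1 / \<zeta> j)" by (simp add: landau_o.big.in_cong)
    qed
    with A show ?thesis by (rule landau_o.big_trans)
  qed
  have "(\<lambda>j. cauchy_transform \<rho> (\<i> * of_real (y j)) - (\<Sum>k<N. of_real (c k) * (1 / (\<i> * of_real (y j))) ^ Suc k))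
      \<in> O(\<lambda>j. (1 / (\<i> * of_real (y j))) ^ Suc N)" for N
  proof -
    have "filterlim (\<lambda>j. j + J) sequentially sequentially" by (rule filterlim_add_const_nat_at_top)
    from landau_o.big.compose[OF main[of N] this]
    have "(\<lambda>j. G (j + J) - (\<Sum>k<N. of_real (c k) * (1 / \<zeta> (j + J)) ^ Suc k)) \<in> O(\<lambda>j. (1 / \<zeta> (j + J)) ^ Suc N)" .
    moreover have "cauchy_transform \<rho> (\<zeta> (j + J)) = G (j + J)" for j
    proof -
      have "Im (\<zeta> (j + J)) > 0" using ypos[of j] by (simp add: y_def)
      moreover have "Im (\<i> * of_nat (j + J)) > 0" using J(1)[of "j + J"] by (simp flip: of_nat_add)
      ultimately show ?thesis using \<rho>(2)[of "\<i> * of_nat (j + J)"] unfolding \<zeta>_def G_def by blast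
    qed
    ultimately show ?thesis unfolding \<zeta>y by simp
  qed
  from \<rho>.moments_from_expansion[OF ylim ypos _ this, of n]
  have "integrable \<rho> (\<lambda>x. x ^ n)" "(\<integral>x. x ^ n \<partial>\<rho>) = c n" by (simp_all add: c_def)
  then show "integrable \<rho> (\<lambda>x. x ^ n)"
    "(\<integral>x. x ^ n \<partial>\<rho>) = noncrossing_sum (\<lambda>n. r n + (if n = 2 then s else 0)) {1..n}"
    by (simp_all add: c_def r'_def[abs_def])
qed

section \<open>Moments and free cumulants of the semicircular mixture\<close>

lemma sum_card_partition_on:
  assumes "partition_on A P" "finite A"
  shows "(\<Sum>B\<in>P. card B) = card A"
proof -
  have "card (\<Union>P) = (\<Sum>B\<in>P. card B)"
    using assms by (intro card_Union_disjoint)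
      (auto simp: partition_on_def disjoint_def pairwise_def disjnt_def intro: finite_subset)
  then show ?thesis using assms(1) by (simp add: partition_on_def)
qed

lemma noncrossing_sum_scale:
  assumes "finite A"
  shows "noncrossing_sum (\<lambda>n. a ^ n * r n) A = a ^ card A * noncrossing_sum r A"
  unfolding noncrossing_sum_def sum_distrib_left
proof (intro sum.cong refl)
  fix \<pi> assume "\<pi> \<in> noncrossing_partitions A"
  note p = noncrossing_partitionsD(1)[OF this]
  show "(\<Prod>B\<in>\<pi>. a ^ card B * r (card B)) = a ^ card A * (\<Prod>B\<in>\<pi>. r (card B))"
    unfolding prod.distrib power_sum[symmetric] sum_card_partition_on[OF p assms] ..
qed

lemma free_cumulant_eqI:
  assumes "r 0 = 0" and r: "\<And>n. n \<ge> 1 \<Longrightarrow> moment \<nu> n = noncrossing_sum r {1..n}"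
  shows "free_cumulant \<nu> = r"
  unfolding free_cumulant_def
proof (rule the_equality)
  show "r 0 = 0 \<and> (\<forall>n\<ge>1. moment \<nu> n = (\<Sum>\<pi>\<in>noncrossing_partitions {1..n}. \<Prod>B\<in>\<pi>. r (card B)))"
    using assms by (simp add: noncrossing_sum_def)
  fix q assume q: "q 0 = 0 \<and> (\<forall>n\<ge>1. moment \<nu> n = (\<Sum>\<pi>\<in>noncrossing_partitions {1..n}. \<Prod>B\<in>\<pi>. q (card B)))"
  have "q n = r n" if "n \<ge> 1" for n
  proof (rule noncrossing_cumulants_unique[OF _ that])
    fix m :: nat assume "m \<ge> 1"
    then show "noncrossing_sum q {1..m} = noncrossing_sum r {1..m}"
      using q r[of m] by (simp add: noncrossing_sum_def)
  qed
  then show "q = r" using q assms(1) by (intro ext) (metis One_nat_def Suc_leI not_gr_zero)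
qed

section \<open>Special values of the connected sums\<close>

lemma pair_partitions_odd:
  fixes n :: nat
  assumes "odd n" shows "pair_partitions {1..n} = {}"
proof -
  have "even n" if V: "V \<in> pair_partitions {1..n}" for V
  proof -
    have "(\<Sum>B\<in>V. card B) = n"
      using sum_card_partition_on[of "{1..n}" V] V by (simp add: pair_partitions_def)
    moreover have "(\<Sum>B\<in>V. card B) = (\<Sum>B\<in>V. 2)" using V by (intro sum.cong) (auto simp: pair_partitions_def)
    ultimately show ?thesis by (metis dvd_triv_right sum_constant)
  qed
  then show ?thesis using assms by blast
qed

lemma connected_sum_odd: "odd n \<Longrightarrow> connected_sum t n = 0"
  using pair_partitions_odd[of n] by (simp add: connected_sum_def connected_pairings_def)

text \<open>The empty family is not connected, which gives the value that
  \<open>free_cumulant\<close> prescribes at index 0.\<close>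

lemma connected_sum_0: "connected_sum t 0 = 0"
proof -
  have "connected_pairings {1..0::nat} = {}"
  proof (rule ccontr)
    assume "connected_pairings {1..0::nat} \<noteq> {}"
    then obtain K where K: "K \<in> connected_pairings {1..0::nat}" by blast
    have "\<Union>K = {}" "{} \<notin> K" "K \<noteq> {}"
      using connected_pairingsD[OF K] by (auto simp: partition_on_def crossing_connected_def)
    then show False by auto
  qed
  then show ?thesis by (simp add: connected_sum_def)
qed

text \<open>Normalization enters here: the second cumulant is 1, so that a variance 1 - b can
  compensate for the dilation.\<close>

lemma connected_sum_2:
  assumes "normalized t" shows "connected_sum t 2 = 1"
proof -
  have "connected_pairings {1..2::nat} = {{{1, 2}}}"
  proof
    show "connected_pairings {1..2::nat} \<subseteq> {{{1, 2}}}"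
    proof
      fix K :: "nat set set" assume K: "K \<in> connected_pairings {1..2}"
      note D = connected_pairingsD[OF K]
      have "B = {1, 2}" if "B \<in> K" for B
      proof -
        have "B \<subseteq> {1..2}" "card B = card {1..2::nat}" using D(2,4) that by auto
        then have "B = {1..2}" by (intro card_subset_eq) auto
        then show ?thesis by auto
      qed
      moreover have "K \<noteq> {}" using D(3) by (simp add: crossing_connected_def)
      ultimately have "K = {{1, 2}}" by blast
      then show "K \<in> {{{1, 2}}}" by simp
    qed
    have "{{1, 2}} \<in> pair_partitions {1..2::nat}"
      by (auto simp: pair_partitions_def partition_on_def)
    then show "{{{1, 2}}} \<subseteq> connected_pairings {1..2::nat}"
      by (simp add: connected_pairings_def num_components_eq_1_iff[simplified] crossing_connected_def)
  qed
  then show ?thesis using assms by (simp add: connected_sum_def normalized_def)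
qed

lemma symmetric_measure_integral:
  fixes f :: "real \<Rightarrow> 'b::{banach, second_countable_topology}"
  assumes "real_distribution \<mu>" "symmetric_measure \<mu>" "f \<in> borel_measurable borel"
  shows "(\<integral>x. f (- x) \<partial>\<mu>) = (\<integral>x. f x \<partial>\<mu>)"
proof -
  interpret real_distribution \<mu> by fact
  have "(\<integral>x. f x \<partial>distr \<mu> borel uminus) = (\<integral>x. f (- x) \<partial>\<mu>)"
    using assms(3) by (intro integral_distr) auto
  then show ?thesis using assms(2) by (simp add: symmetric_measure_def)
qed

lemma symmetric_measure_integral_odd:
  fixes f :: "real \<Rightarrow> real"
  assumes "real_distribution \<mu>" "symmetric_measure \<mu>" "f \<in> borel_measurable borel" "\<And>x. f (- x) = - f x"
  shows "(\<integral>x. f x \<partial>\<mu>) = 0"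
  using symmetric_measure_integral[OF assms(1-3)] unfolding assms(4) by simp

text \<open>Symmetry is used twice: it gives mean zero, as the inversion of 1/G requires, and it
  makes the Cauchy transform imaginary on the imaginary axis.\<close>

theorem semicircle_mix_moments:
  fixes r :: "nat \<Rightarrow> real"
  assumes \<mu>: "real_distribution \<mu>" "symmetric_measure \<mu>" "has_all_moments \<mu>"
    and r: "\<And>n. n \<ge> 1 \<Longrightarrow> moment \<mu> n = noncrossing_sum r {1..n}" and b: "0 \<le> b" "b \<le> 1"
  shows "is_free_convolution (dilate (sqrt b) \<mu>) (dilate (sqrt (1 - b)) semicircle) (semicircle_mix \<mu> b)"
    and "has_all_moments (semicircle_mix \<mu> b)"
    and "moment (semicircle_mix \<mu> b) n
      = noncrossing_sum (\<lambda>n. sqrt b ^ n * r n + (if n = 2 then 1 - b else 0)) {1..n}"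
proof -
  interpret \<mu>: real_distribution \<mu> by (rule \<mu>(1))
  let ?M = "dilate (sqrt b) \<mu>" and ?N = "dilate (sqrt (1 - b)) semicircle"
  have int\<mu>: "integrable \<mu> (\<lambda>x. x ^ n)" for n using \<mu>(3) by (simp add: has_all_moments_def)
  have M: "real_distribution ?M" by (rule real_distribution_dilate[OF \<mu>(1)])
  have pm: "(\<lambda>x::real. x ^ n) \<in> borel_measurable borel" for n by measurable
  have mom: "integrable ?M (\<lambda>x. x ^ n)" for n
    unfolding integral_dilate(2)[OF \<mu>(1) pm] power_mult_distrib by (intro integrable_mult_right int\<mu>)
  have momv: "(\<integral>x. x ^ n \<partial>?M) = sqrt b ^ n * moment \<mu> n" for n
    unfolding integral_dilate(1)[OF \<mu>(1) pm] power_mult_distrib moment_def by (rule integral_mult_right_zero)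
  have r0: "moment \<mu> n = noncrossing_sum r {1..n}" for n
  proof (cases "n = 0")
    case True
    then show ?thesis using \<mu>.prob_space by (simp add: moment_def)
  qed (simp add: r)
  have rM: "(\<integral>x. x ^ n \<partial>?M) = noncrossing_sum (\<lambda>n. sqrt b ^ n * r n) {1..n}" for n
    unfolding momv r0 by (simp add: noncrossing_sum_scale)
  have mean: "(\<integral>x. x \<partial>?M) = 0"
  proof -
    have "(\<integral>x. x \<partial>\<mu>) = 0" by (rule symmetric_measure_integral_odd[OF \<mu>(1,2)]) auto
    then show ?thesis using momv[of 1] by (simp add: moment_def)
  qed
  \<comment> \<open>The real part of the kernel at an imaginary point is an odd function of
    x.\<close>
  have imag: "Re (cauchy_transform ?M (\<i> * of_real v)) = 0" if v: "v > 0" for v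
  proof -
    have v': "Im (\<i> * of_real v) > 0" using v by simp
    have c: "continuous_on UNIV (\<lambda>x. 1 / (\<i> * of_real v - complex_of_real x))"
      using isCont_cauchy_kernel[OF v'] by (simp add: continuous_at_imp_continuous_on)
    have "continuous_on UNIV (\<lambda>x. 1 / (\<i> * of_real v - complex_of_real (sqrt b * x)))"
      by (rule continuous_on_compose2[OF c]) (auto intro!: continuous_intros)
    then have m: "(\<lambda>x. Re (1 / (\<i> * of_real v - complex_of_real (sqrt b * x)))) \<in> borel_measurable borel"
      by (intro borel_measurable_continuous_onI continuous_on_Re)
    have "integrable \<mu> (\<lambda>x. 1 / (\<i> * of_real v - complex_of_real (sqrt b * x)))"
      using integral_dilate(2)[OF \<mu>(1) borel_measurable_continuous_onI[OF c]]
        real_distribution.integrable_cauchy_kernel[OF M v'] by blast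
    from integral_Re[OF this]
    have "Re (cauchy_transform ?M (\<i> * of_real v)) = (\<integral>x. Re (1 / (\<i> * of_real v - complex_of_real (sqrt b * x))) \<partial>\<mu>)"
      unfolding cauchy_transform_dilate[OF \<mu>(1) v'] by simp
    also have "\<dots> = 0"
      by (rule symmetric_measure_integral_odd[OF \<mu>(1,2) m]) (simp add: Re_divide)
    finally show ?thesis .
  qed
  have s: "0 \<le> 1 - b" using b by simp
  have i1: "integrable ?M (\<lambda>x. x)" using mom[of 1] by simp
  obtain \<rho> where \<rho>: "real_distribution \<rho>"
    "\<And>w. Im w > 0 \<Longrightarrow> Im (w + of_real (1 - b) * cauchy_transform ?M w) > 0 \<Longrightarrow>
       cauchy_transform \<rho> (w + of_real (1 - b) * cauchy_transform ?M w) = cauchy_transform ?M w"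
    using real_distribution.semicircular_perturbation[OF M s i1] by blast
  have \<nu>: "1 / cauchy_transform ?N (z + of_real (1 - b) / z) = z" if "Im z > sqrt (1 - b) + 1" for z
    using cauchy_transform_dilate_semicircle[of "sqrt (1 - b)" z] that s by (simp add: real_sqrt_pow2)
  have conv: "is_free_convolution ?M ?N \<rho>"
    by (rule is_free_convolution_semicircular[OF M mom mean s \<nu> \<rho>])
  have N: "real_distribution ?N" by (rule real_distribution_dilate[OF real_distribution_semicircle])
  have Nsq: "integrable ?N (\<lambda>x. x\<^sup>2)"
    unfolding integral_dilate(2)[OF real_distribution_semicircle pm]
    by (intro integral_semicircle(1) continuous_intros)
  \<comment> \<open>The constructed law is the value of the definite description; its uniqueness
    uses the second moments of both factors.\<close>
  have mix: "semicircle_mix \<mu> b = \<rho>"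
    unfolding semicircle_mix_def free_convolution_def
  proof (rule the_equality)
    show "\<rho>' = \<rho>" if "is_free_convolution ?M ?N \<rho>'" for \<rho>'
      by (rule free_convolution_unique[OF M mom N Nsq that conv])
  qed (rule conv)
  show "is_free_convolution ?M ?N (semicircle_mix \<mu> b)" unfolding mix by (rule conv)
  note S = semicircular_perturbation_moments[OF M mom imag rM s \<rho>]
  show "has_all_moments (semicircle_mix \<mu> b)" unfolding mix has_all_moments_def using S(1) by simp
  show "moment (semicircle_mix \<mu> b) n
      = noncrossing_sum (\<lambda>n. sqrt b ^ n * r n + (if n = 2 then 1 - b else 0)) {1..n}"
    unfolding mix moment_def by (rule S(2))
qed

theorem theorem4:
  fixes \<mu> :: "real measure" and t :: "nat set set \<Rightarrow> complex"
  assumes "real_distribution \<mu>"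
    and "symmetric_measure \<mu>"
    and "has_all_moments \<mu>"
    and "normalized t"
    and "strongly_multiplicative t"
    and "\<And>n::nat. n \<ge> 1 \<Longrightarrow>
           complex_of_real (moment \<mu> (2 * n)) = (\<Sum>V\<in>pair_partitions {1..2 * n}. t V)"
  shows "(\<forall>b::real. 0 \<le> b \<and> b \<le> 1 \<longrightarrow>
            is_free_convolution (dilate (sqrt b) \<mu>) (dilate (sqrt (1 - b)) semicircle)
              (semicircle_mix \<mu> b) \<and>
            has_all_moments (semicircle_mix \<mu> b)) \<and>
         (\<forall>(n::nat) (b::real). n \<ge> 1 \<and> 0 \<le> b \<and> b \<le> 1 \<longrightarrow>
            complex_of_real (moment (semicircle_mix \<mu> b) (2 * n)) =
              (\<Sum>V\<in>pair_partitions {1..2 * n}.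
                 complex_of_real (b ^ num_nonsingletons V) * t V)) \<and>
         (\<forall>n::nat. n \<ge> 1 \<longrightarrow>
            complex_of_real (free_cumulant \<mu> (2 * n)) =
              (\<Sum>V | V \<in> pair_partitions {1..2 * n} \<and> num_components V = 1. t V)) \<and>
         (\<forall>(n::nat) (b::real). n > 1 \<and> 0 \<le> b \<and> b \<le> 1 \<longrightarrow>
            complex_of_real (free_cumulant (semicircle_mix \<mu> b) (2 * n)) =
              complex_of_real (b ^ n) *
              (\<Sum>V | V \<in> pair_partitions {1..2 * n} \<and> num_components V = 1. t V) \<and>
            free_cumulant (semicircle_mix \<mu> b) (2 * n) = b ^ n * free_cumulant \<mu> (2 * n)) \<and>
         (\<forall>b::real. 0 \<le> b \<and> b \<le> 1 \<longrightarrow>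
            free_cumulant (semicircle_mix \<mu> b) 2 = free_cumulant \<mu> 2)"
proof -
  define \<kappa> where "\<kappa> = connected_sum t"
  define r where "r n = Re (\<kappa> n)" for n
  have odd0: "moment \<mu> n = 0" if "odd n" for n
    unfolding moment_def
    by (rule symmetric_measure_integral_odd[OF assms(1,2)]) (use that in auto)
  \<comment> \<open>The hypothesis covers even orders. For odd orders the moment vanishes by
    symmetry, and there are no pair-partitions.\<close>
  have m\<kappa>: "complex_of_real (moment \<mu> n) = noncrossing_sum \<kappa> {1..n}" if n: "n \<ge> 1" for n
  proof -
    have "complex_of_real (moment \<mu> n) = (\<Sum>V\<in>pair_partitions {1..n}. t V)"
    proof (cases "even n")
      case True
      then obtain m where "n = 2 * m" by (elim evenE)
      then show ?thesis using assms(6)[of m] n by simp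
    next
      case False
      then show ?thesis using odd0[of n] pair_partitions_odd[of n] by simp
    qed
    also have "\<dots> = noncrossing_sum \<kappa> {1..n}"
      using sum_pair_partitions_eq_noncrossing[OF assms(5) n, of 1]
      by (simp add: noncrossing_sum_def \<kappa>_def cong: if_cong)
    finally show ?thesis .
  qed
  have \<kappa>r: "\<kappa> n = complex_of_real (r n)" if n: "n \<ge> 1" for n
  proof -
    \<comment> \<open>The conjugate sequence has the same, real, moments; uniqueness of cumulants
      over the complex numbers then shows that the sums are real.\<close>
    have "cnj (\<kappa> n) = \<kappa> n"
    proof (rule noncrossing_cumulants_unique[OF _ n])
      fix m :: nat assume m: "m \<ge> 1"
      have "noncrossing_sum (\<lambda>n. cnj (\<kappa> n)) {1..m} = cnj (noncrossing_sum \<kappa> {1..m})"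
        by (simp add: noncrossing_sum_def)
      then show "noncrossing_sum (\<lambda>n. cnj (\<kappa> n)) {1..m} = noncrossing_sum \<kappa> {1..m}"
        using m\<kappa>[OF m] by (metis complex_cnj_complex_of_real)
    qed
    then show ?thesis by (simp add: r_def complex_eq_iff)
  qed
  have mr: "moment \<mu> n = noncrossing_sum r {1..n}" if n: "n \<ge> 1" for n
  proof -
    have "complex_of_real (moment \<mu> n) = noncrossing_sum (\<lambda>n. complex_of_real (r n)) {1..n}"
      unfolding m\<kappa>[OF n] by (rule noncrossing_sum_cong[OF \<kappa>r]) auto
    then show ?thesis by (simp only: noncrossing_sum_of_real of_real_eq_iff)
  qed
  have r0: "r 0 = 0" by (simp add: r_def \<kappa>_def connected_sum_0)
  have rodd: "r n = 0" if "odd n" for n by (simp add: r_def \<kappa>_def connected_sum_odd[OF that])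
  have r2: "r 2 = 1" by (simp add: r_def \<kappa>_def connected_sum_2[OF assms(4)])
  have fc: "free_cumulant \<mu> = r" by (rule free_cumulant_eqI[OF r0 mr])
  have \<kappa>sum: "(\<Sum>V | V \<in> pair_partitions {1..2 * n} \<and> num_components V = 1. t V) = complex_of_real (r (2 * n))"
    if "n \<ge> 1" for n
    using \<kappa>r[of "2 * n"] that by (simp add: \<kappa>_def connected_sum_def connected_pairings_def)
  define w where "w b n = (if n = 2 then 1 else b ^ (n div 2)) * r n" for b :: real and n
  \<comment> \<open>At n = 2 this is b + (1 - b) = 1, since \<open>r 2 = 1\<close>. For odd n the
    cumulant vanishes, so the half-integer power of \<open>b\<close> never appears.\<close>
  have ws: "sqrt b ^ n * r n + (if n = 2 then 1 - b else 0) = w b n" if b: "0 \<le> b" for b n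
  proof (cases "even n")
    case True
    then obtain m where m: "n = 2 * m" by (elim evenE)
    have "sqrt b ^ n = b ^ m" unfolding m power_mult using b by simp
    then show ?thesis using r2 m by (auto simp: w_def)
  next
    case False
    then show ?thesis by (auto simp: w_def rodd)
  qed
  have mix: "is_free_convolution (dilate (sqrt b) \<mu>) (dilate (sqrt (1 - b)) semicircle) (semicircle_mix \<mu> b)"
    "has_all_moments (semicircle_mix \<mu> b)" "\<And>n. moment (semicircle_mix \<mu> b) n = noncrossing_sum (w b) {1..n}"
    if b: "0 \<le> b" "b \<le> 1" for b
    using semicircle_mix_moments[OF assms(1-3) mr b] unfolding ws[OF b(1)] by simp_all
  have fcb: "free_cumulant (semicircle_mix \<mu> b) = w b" if b: "0 \<le> b" "b \<le> 1" for b
    by (rule free_cumulant_eqI) (use mix(3)[OF b] r0 in \<open>simp_all add: w_def\<close>)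
  have mixm: "complex_of_real (moment (semicircle_mix \<mu> b) n)
      = (\<Sum>V\<in>pair_partitions {1..n}. complex_of_real (b ^ num_nonsingletons V) * t V)"
    if n: "n \<ge> 1" and b: "0 \<le> b" "b \<le> 1" for n b
  proof -
    have "complex_of_real (moment (semicircle_mix \<mu> b) n) = noncrossing_sum (\<lambda>n. complex_of_real (w b n)) {1..n}"
      unfolding mix(3)[OF b] by (rule noncrossing_sum_of_real[symmetric])
    also have "\<dots> = noncrossing_sum (\<lambda>n. (if n = 2 then 1 else of_real b ^ (n div 2)) * \<kappa> n) {1..n}"
      by (rule noncrossing_sum_cong) (auto simp: w_def \<kappa>r)
    also have "\<dots> = (\<Sum>V\<in>pair_partitions {1..n}. of_real b ^ num_nonsingletons V * t V)"
      unfolding sum_pair_partitions_eq_noncrossing[OF assms(5) n] noncrossing_sum_def \<kappa>_def ..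
    finally show ?thesis by simp
  qed
  show ?thesis
  proof (intro conjI allI impI)
    fix b :: real assume b: "0 \<le> b \<and> b \<le> 1"
    then show "is_free_convolution (dilate (sqrt b) \<mu>) (dilate (sqrt (1 - b)) semicircle) (semicircle_mix \<mu> b)"
      "has_all_moments (semicircle_mix \<mu> b)" using mix by auto
    show "free_cumulant (semicircle_mix \<mu> b) 2 = free_cumulant \<mu> 2" using b by (simp add: fcb fc w_def)
  next
    fix n :: nat and b :: real assume nb: "n \<ge> 1 \<and> 0 \<le> b \<and> b \<le> 1"
    show "complex_of_real (moment (semicircle_mix \<mu> b) (2 * n)) =
      (\<Sum>V\<in>pair_partitions {1..2 * n}. complex_of_real (b ^ num_nonsingletons V) * t V)"
      by (rule mixm) (use nb in auto)
  next
    fix n :: nat assume "n \<ge> 1"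
    then show "complex_of_real (free_cumulant \<mu> (2 * n)) =
      (\<Sum>V | V \<in> pair_partitions {1..2 * n} \<and> num_components V = 1. t V)"
      by (simp only: \<kappa>sum fc)
  next
    fix n :: nat and b :: real assume nb: "n > 1 \<and> 0 \<le> b \<and> b \<le> 1"
    then have n1: "n \<ge> 1" and e: "free_cumulant (semicircle_mix \<mu> b) (2 * n) = b ^ n * r (2 * n)"
      by (simp_all add: fcb w_def)
    show "free_cumulant (semicircle_mix \<mu> b) (2 * n) = b ^ n * free_cumulant \<mu> (2 * n)"
      unfolding e fc ..
    show "complex_of_real (free_cumulant (semicircle_mix \<mu> b) (2 * n)) = complex_of_real (b ^ n) *
      (\<Sum>V | V \<in> pair_partitions {1..2 * n} \<and> num_components V = 1. t V)"
      unfolding e \<kappa>sum[OF n1] by simp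
  qed
qed

end
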